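(* Let $\Omega\subset\mathbb{R}^2$ be a convex polygon whose lowest vertex is the origin and one of whose edges lies on the $x$-axis, and let $\Gamma_r$ denote its boundary. Let $u$ be of class $C^2$ and $v$ of class $C^1$ on the boundary layer $\Omega_\gamma^+\cup\Gamma_r\cup\Omega_\gamma^-$, and let $\mathcal{N}_\Omega$ be any one of the three nonlocal Neumann operators $\mathcal{N}_\Omega^-$, $\mathcal{N}_\Omega^+$, $\mathcal{N}_\Omega^*$; assume $u\in S_N(\Omega)$ for this operator. Then, as $\delta\to0$, $$(\mathcal{N}_\Omega u,v)_{G}=\langle\sigma\,\partial_{\mathbf n}u,v\rangle_{\Gamma_r}+\mathcal{O}(\delta),$$ where $G=\Omega_\gamma^-$ if $\mathcal{N}_\Omega=\mathcal{N}_\Omega^-$ and $G=\Omega_\gamma^+$ if $\mathcal{N}_\Omega\in\{\mathcal{N}_\Omega^+,\mathcal{N}_\Omega^*\}$.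
   Context: Kernel: for each horizon $\delta>0$, $\gamma_\delta(\mathbf x,\mathbf y)=\widetilde\gamma_\delta(|\mathbf x-\mathbf y|)$ for $\mathbf x,\mathbf y\in\mathbb{R}^2$, with $\widetilde\gamma_\delta\ge0$, $\widetilde\gamma_\delta\in L^1(0,\delta)$, $\gamma_\delta(\mathbf x,\mathbf y)=0$ if $|\mathbf x-\mathbf y|>\delta$, and $\sigma:=\frac{\pi}{2}\int_0^\delta r^3\widetilde\gamma_\delta(r)\,dr$ finite and independent of $\delta$. Sets: $B_\delta(\mathbf x)$ is the disc of radius $\delta$ centered at $\mathbf x$; $\Omega$ is open; $\Omega^-=\{\mathbf x\in\Omega:B_\delta(\mathbf x)\subset\Omega\}$, $\Omega_\gamma^-=\Omega\setminus\overline{\Omega^-}$, $\Omega^+=\mathbb{R}^2\setminus\overline{\{\mathbf x:B_\delta(\mathbf x)\cap\Omega=\emptyset\}}$, $\Omega_\gamma^+=\Omega^+\setminus\overline\Omega$. Operators: $\mathcal{N}_\Omega^-u(\mathbf x)=-\int_{\Omega_\gamma^+}[u(\mathbf x)-u(\mathbf y)]\gamma_\delta(\mathbf x,\mathbf y)d\mathbf y$ for $\mathbf x\in\Omega_\gamma^-$; $\mathcal{N}_\Omega^+u(\mathbf x)=\int_{\Omega_\gamma^-}[u(\mathbf x)-u(\mathbf y)]\gamma_\delta(\mathbf x,\mathbf y)d\mathbf y$ for $\mathbf x\in\Omega_\gamma^+$; $\mathcal{N}_\Omega^*u(\mathbf x)=\int_{\Omega^+}[u(\mathbf x)-u(\mathbf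 y)]\gamma_\delta(\mathbf x,\mathbf y)d\mathbf y$ for $\mathbf x\in\Omega_\gamma^+$. $S_N(\Omega)$ is the set of $u$ for which $|\mathcal{N}_\Omega u|$ is bounded on the layer where $\mathcal{N}_\Omega u$ is defined. Notation: $(w,v)_G=\int_G wv\,d\mathbf x$; $\langle w,v\rangle_{\Gamma_r}=\int_{\Gamma_r}wv$ with respect to arc length; $\partial_{\mathbf n}$ is the outward normal derivative (defined off the vertices). The functions $u,v$ are fixed, i.e. given on the boundary layer $\{\mathrm{dist}(\mathbf x,\Gamma_r)<\delta_0\}$ for some fixed $\delta_0>0$ and independent of $\delta$; $\mathcal{O}(\delta)$ denotes a quantity bounded by $C\delta$ for all sufficiently small $\delta$, with $C$ independent of $\delta$. *)

theory Defs
  imports "HOL-Analysis.Analysis" "HOL-Library.Landau_Symbols"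
begin

section \<open>Kernels\<close>

text \<open>
  A family of radial profiles \<open>g \<delta>\<close>, one for each horizon \<open>\<delta> > 0\<close>; the second moment \<open>\<sigma>\<close> is
  one number for the whole family. Only values of \<open>g \<delta>\<close> on \<open>[0, \<infinity>)\<close> matter.
\<close>

definition kernel_family :: "(real \<Rightarrow> real \<Rightarrow> real) \<Rightarrow> real \<Rightarrow> bool" where
  "kernel_family g \<sigma> \<longleftrightarrow>
    (\<forall>\<delta>>0.
      (\<forall>r\<ge>0. g \<delta> r \<ge> 0) \<and>
      g \<delta> absolutely_integrable_on {0<..<\<delta>} \<and>
      (\<forall>r>\<delta>. g \<delta> r = 0) \<and>
      (\<lambda>r. r ^ 3 * g \<delta> r) absolutely_integrable_on {0<..<\<delta>} \<and>
      \<sigma> = pi / 2 * (LINT r:{0<..<\<delta>}|lebesgue. r ^ 3 * g \<delta> r))"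

definition kern :: "(real \<Rightarrow> real \<Rightarrow> real) \<Rightarrow> real \<Rightarrow> real^2 \<Rightarrow> real^2 \<Rightarrow> real" where
  "kern g \<delta> x y = g \<delta> (norm (x - y))"

section \<open>Boundary layers\<close>

text \<open>\<open>\<Omega>\<^sup>-\<close>, \<open>\<Omega>\<^sub>\<gamma>\<^sup>-\<close>, \<open>\<Omega>\<^sup>+\<close> and \<open>\<Omega>\<^sub>\<gamma>\<^sup>+\<close>, in this order.\<close>

definition shrunk :: "real \<Rightarrow> (real^2) set \<Rightarrow> (real^2) set" where
  "shrunk \<delta> \<Omega> = {x \<in> \<Omega>. ball x \<delta> \<subseteq> \<Omega>}"

definition inner_layer :: "real \<Rightarrow> (real^2) set \<Rightarrow> (real^2) set" where
  "inner_layer \<delta> \<Omega> = \<Omega> - closure (shrunk \<delta> \<Omega>)"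

definition enlarged :: "real \<Rightarrow> (real^2) set \<Rightarrow> (real^2) set" where
  "enlarged \<delta> \<Omega> = UNIV - closure {x. ball x \<delta> \<inter> \<Omega> = {}}"

definition outer_layer :: "real \<Rightarrow> (real^2) set \<Rightarrow> (real^2) set" where
  "outer_layer \<delta> \<Omega> = enlarged \<delta> \<Omega> - closure \<Omega>"

section \<open>Nonlocal Neumann operators\<close>

text \<open>
  The operators are total functions of \<open>x\<close>, meaningful for \<open>x\<close> in \<open>inner_layer \<delta> \<Omega>\<close> for the
  first one and for \<open>x\<close> in \<open>outer_layer \<delta> \<Omega>\<close> for the other two. Values of \<open>u\<close> at distance more
  than \<open>\<delta>\<close> from \<open>x\<close> are irrelevant because the kernel vanishes there.
\<close>

definition neumann_minus ::
  "(real \<Rightarrow> real \<Rightarrow> real) \<Rightarrow> real \<Rightarrow> (real^2) set \<Rightarrow> (real^2 \<Rightarrow> real) \<Rightarrow> real^2 \<Rightarrow> real" where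
  "neumann_minus g \<delta> \<Omega> u x =
    - (LINT y:outer_layer \<delta> \<Omega>|lebesgue. (u x - u y) * kern g \<delta> x y)"

definition neumann_plus ::
  "(real \<Rightarrow> real \<Rightarrow> real) \<Rightarrow> real \<Rightarrow> (real^2) set \<Rightarrow> (real^2 \<Rightarrow> real) \<Rightarrow> real^2 \<Rightarrow> real" where
  "neumann_plus g \<delta> \<Omega> u x =
    (LINT y:inner_layer \<delta> \<Omega>|lebesgue. (u x - u y) * kern g \<delta> x y)"

definition neumann_star ::
  "(real \<Rightarrow> real \<Rightarrow> real) \<Rightarrow> real \<Rightarrow> (real^2) set \<Rightarrow> (real^2 \<Rightarrow> real) \<Rightarrow> real^2 \<Rightarrow> real" where
  "neumann_star g \<delta> \<Omega> u x =
    (LINT y:enlarged \<delta> \<Omega>|lebesgue. (u x - u y) * kern g \<delta> x y)"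

text \<open>The set \<open>S\<^sub>N\<close> for an operator \<open>T\<close> whose values are defined on \<open>G\<close>.\<close>

definition S_N :: "((real^2 \<Rightarrow> real) \<Rightarrow> real^2 \<Rightarrow> real) \<Rightarrow> (real^2) set \<Rightarrow> (real^2 \<Rightarrow> real) set" where
  "S_N T G = {u. \<exists>M. \<forall>x\<in>G. \<bar>T u x\<bar> \<le> M}"

section \<open>Convex polygons\<close>

text \<open>A convex polygon as an open set; its vertices and edges are those of its closure.\<close>

definition convex_polygon :: "(real^2) set \<Rightarrow> bool" where
  "convex_polygon \<Omega> \<longleftrightarrow> open \<Omega> \<and> convex \<Omega> \<and> \<Omega> \<noteq> {} \<and> polytope (closure \<Omega>)"

definition polygon_vertices :: "(real^2) set \<Rightarrow> (real^2) set" where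
  "polygon_vertices \<Omega> = {p. p extreme_point_of closure \<Omega>}"

definition polygon_edges :: "(real^2) set \<Rightarrow> (real^2) set set" where
  "polygon_edges \<Omega> = {E. E edge_of closure \<Omega>}"

text \<open>
  Arc length integral over a segment. The endpoints are determined by \<open>E\<close> up to order, and the
  value does not depend on the order.
\<close>

definition segment_integral :: "(real^2) set \<Rightarrow> (real^2 \<Rightarrow> real) \<Rightarrow> real" where
  "segment_integral E f =
    (let (a, b) = (SOME (a, b). E = closed_segment a b)
     in LINT t:{0..1}|lebesgue. f ((1 - t) *\<^sub>R a + t *\<^sub>R b) * dist a b)"

definition boundary_integral :: "(real^2) set \<Rightarrow> (real^2 \<Rightarrow> real) \<Rightarrow> real" where
  "boundary_integral \<Omega> f = (\<Sum>E\<in>polygon_edges \<Omega>. segment_integral E f)"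

text \<open>
  The outward unit normal at a boundary point of a convex set. For a polygon it is unique exactly
  off the vertices; at the vertices the value is unspecified, which does not affect boundary
  integrals.
\<close>

definition outward_normal :: "(real^2) set \<Rightarrow> real^2 \<Rightarrow> real^2" where
  "outward_normal \<Omega> x = (THE n. norm n = 1 \<and> (\<forall>y\<in>\<Omega>. n \<bullet> (y - x) \<le> 0))"

definition normal_derivative :: "(real^2) set \<Rightarrow> (real^2 \<Rightarrow> real) \<Rightarrow> real^2 \<Rightarrow> real" where
  "normal_derivative \<Omega> u x = frechet_derivative u (at x) (outward_normal \<Omega> x)"

section \<open>Functions of class \<open>C\<^sup>1\<close> and \<open>C\<^sup>2\<close> on an open set\<close>

definition C1_on :: "('a::real_normed_vector \<Rightarrow> 'b::real_normed_vector) \<Rightarrow> 'a set \<Rightarrow> bool" where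
  "C1_on f S \<longleftrightarrow>
    (\<exists>f'. (\<forall>x\<in>S. (f has_derivative blinfun_apply (f' x)) (at x)) \<and> continuous_on S f')"

definition C2_on :: "('a::real_normed_vector \<Rightarrow> 'b::real_normed_vector) \<Rightarrow> 'a set \<Rightarrow> bool" where
  "C2_on f S \<longleftrightarrow>
    (\<exists>f'. (\<forall>x\<in>S. (f has_derivative blinfun_apply (f' x)) (at x)) \<and> C1_on f' S)"

end

theory Submission
  imports Defs
begin

text \<open>
  Read the double integral \<open>\<integral> N u \<cdot> v\<close> as an integral over displacements. A pair of points that
  interact across the boundary consists of \<open>x \<in> \<Omega>\<close> and \<open>x + z \<notin> closure \<Omega>\<close> with
  \<open>norm z < \<delta>\<close>; after Fubini the integrals for the first two operators become
  \<open>\<integral> \<gamma>(z) F(z) dz\<close>, where \<open>F(z)\<close> integrates \<open>(u(x+z) - u(x)) \<cdot> v\<close> over the exit set of all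
  \<open>x \<in> \<Omega>\<close> with \<open>x + z \<notin> closure \<Omega>\<close>, and \<open>v\<close> is taken at \<open>x\<close> or at \<open>x + z\<close>.

  For fixed \<open>z\<close> the exit set is almost a disjoint union of parallelograms: for each edge \<open>E\<close> whose
  outward normal \<open>n\<close> has \<open>n \<bullet> z > 0\<close>, the points \<open>p - t z\<close> with \<open>p \<in> E\<close> and \<open>0 < t < 1\<close>. What these
  parallelograms contain in excess sits near the vertices and has area of order \<open>(norm z)^2\<close>. Along
  \<open>p - t z\<close> the integrand is \<open>Du(p) z \<cdot> v(p)\<close> up to an error of order \<open>\<delta> norm z\<close>. As the area
  element of a parallelogram is \<open>(n \<bullet> z) ds dt\<close>, with \<open>s\<close> the arc length on \<open>E\<close>,
  \<open>F(z)\<close> is the sum over the edges of \<open>max 0 (n \<bullet> z) \<cdot> \<integral>\<^sub>E Du(p) z \<cdot> v(p)\<close>, up to an error of order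
  \<open>\<delta> (norm z)^2\<close> (lemma \<open>crossing_integral_estimate\<close>).

  It remains to integrate against the kernel. By radial symmetry
  \<open>\<integral> \<gamma>(z) max 0 (n \<bullet> z) (a \<bullet> z) dz = \<sigma> (a \<bullet> n)\<close>, half of the isotropic second moment (lemma
  \<open>radial_half_plane_moment\<close>); this turns the main term into \<open>\<sigma> \<integral> \<partial>\<^sub>n u \<cdot> v\<close>. As
  \<open>\<integral> \<gamma>(z) (norm z)^2 dz = 4 \<sigma>\<close> for every \<open>\<delta>\<close>, the error is of order \<open>\<delta>\<close> (lemma
  \<open>crossing_flux_estimate\<close>).

  The third operator contains in addition the interactions between pairs of points of the outer
  layer. As \<open>u(x) - u(y)\<close> is antisymmetric in the pair, their contribution equals
  \<open>1/2 \<integral>\<integral> \<gamma> (u(x) - u(y)) (v(x) - v(y))\<close>, which is bounded by \<open>(norm z)^2\<close> against the kernel, times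
  the area of the layer; that area is of order \<open>\<delta>\<close> (lemmas \<open>neumann_star_integral\<close> and
  \<open>measure_outer_layer\<close>).
\<close>

section \<open>Integration in oblique coordinates of the plane\<close>

definition cross2 :: "real^2 \<Rightarrow> real^2 \<Rightarrow> real" where
  "cross2 d e = d$1 * e$2 - d$2 * e$1"

text \<open>
  Both sides agree on boxes, since a linear map scales the measure of the preimage of a box by the
  determinant.
\<close>

lemma lborel_linear_image:
  fixes T :: "real^'n::{finite,wellorder} \<Rightarrow> real^'n::{finite,wellorder}"
  assumes T: "linear T" and d: "det (matrix T) \<noteq> 0"
  shows "lborel = density (distr lborel borel T) (\<lambda>_. ennreal \<bar>det (matrix T)\<bar>)"
proof (rule lborel_eqI)
  have [measurable]: "T \<in> borel_measurable borel"
    using T linear_continuous_on linear_conv_bounded_linear borel_measurable_continuous_onI by blast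
  fix l u :: "real^'n::{finite,wellorder}"
  assume le: "\<And>b. b \<in> Basis \<Longrightarrow> l \<bullet> b \<le> u \<bullet> b"
  let ?B = "box l u"
  have inj: "inj T" using T d det_nz_iff_inj by blast
  then have surj: "surj T" using T linear_injective_imp_surjective by blast
  obtain S where S: "linear S" "\<And>x. S (T x) = x" "\<And>x. T (S x) = x"
    by (metis T inj linear_injective_isomorphism)
  have pre: "T -` ?B = S ` ?B" using S(2,3) by (auto simp: image_iff) metis
  have meas: "T -` ?B \<in> lmeasurable"
    unfolding pre by (rule measurable_linear_image[OF S(1)]) simp
  have "measure lebesgue (T ` (T -` ?B)) = \<bar>det (matrix T)\<bar> * measure lebesgue (T -` ?B)"
    by (rule measure_linear_image[OF T meas])
  also have "T ` (T -` ?B) = ?B" using surj by (simp add: surj_image_vimage_eq)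
  finally have m: "measure lebesgue ?B = \<bar>det (matrix T)\<bar> * measure lebesgue (T -` ?B)" .
  have b[measurable]: "T -` ?B \<in> sets borel"
    using measurable_sets[of T borel borel ?B] by simp
  have e: "emeasure lborel (T -` ?B) = ennreal (measure lebesgue (T -` ?B))"
    using emeasure_eq_measure2[OF meas] b by (simp add: emeasure_completion)
  have "emeasure (density (distr lborel borel T) (\<lambda>_. ennreal \<bar>det (matrix T)\<bar>)) ?B
     = ennreal \<bar>det (matrix T)\<bar> * emeasure lborel (T -` ?B)"
    by (simp add: emeasure_density_const emeasure_distr)
  also have "\<dots> = ennreal (measure lebesgue ?B)"
    unfolding e m by (simp add: ennreal_mult)
  also have "measure lebesgue ?B = (\<Prod>b\<in>Basis. (u - l) \<bullet> b)"
    using le by (simp add: measure_lborel_box)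
  finally show "emeasure (density (distr lborel borel T) (\<lambda>_. ennreal \<bar>det (matrix T)\<bar>)) ?B
     = ennreal (\<Prod>b\<in>Basis. (u - l) \<bullet> b)" .
qed simp

lemma lborel_vec2:
  "lborel = distr (lborel :: (real \<times> real) measure) borel (\<lambda>(s,t). vector [s, t] :: real^2)"
proof (rule lborel_eqI)
  fix l u :: "real^2"
  assume le: "\<And>b. b \<in> Basis \<Longrightarrow> l \<bullet> b \<le> u \<bullet> b"
  have [measurable]: "(\<lambda>(s,t). vector [s, t] :: real^2) \<in> borel_measurable (borel :: (real\<times>real) measure)"
    by (intro borel_measurable_continuous_onI)
       (auto simp: split_beta continuous_on_componentwise[where 'b="real^2"] Basis_vec_def inner_axis
          forall_2 vector_2 intro!: continuous_intros)
  have "(\<lambda>(s,t). vector [s, t] :: real^2) -` box l u = box (l$1, l$2) (u$1,u$2)"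
    by (auto simp: box_def Basis_vec_def Basis_prod_def inner_axis forall_2 vector_2)
  moreover have "l$1 \<le> u$1" "l$2 \<le> u$2"
    using le[of "axis 1 1"] le[of "axis 2 1"] by (auto simp: Basis_vec_def inner_axis)
  moreover have "(\<Prod>b\<in>Basis. (u - l) \<bullet> b) = (u$1 - l$1) * (u$2 - l$2)"
  proof -
    have B: "(Basis :: (real^2) set) = {axis 1 1, axis 2 1}"
      by (auto simp: Basis_vec_def) (metis exhaust_2)
    have "axis 1 1 \<noteq> (axis 2 1 :: real^2)" by (simp add: axis_eq_axis)
    then show ?thesis unfolding B by (simp add: inner_axis)
  qed
  ultimately show "emeasure (distr lborel borel (\<lambda>(s, t). vector [s, t])) (box l u) = ennreal (\<Prod>b\<in>Basis. (u - l) \<bullet> b)"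
    by (simp add: emeasure_distr emeasure_lborel_box_eq Basis_prod_def)
qed simp

lemma lborel_plane_coordinates:
  fixes a d e :: "real^2"
  assumes "cross2 d e \<noteq> 0"
  shows "lborel = density (distr (lborel :: (real \<times> real) measure) borel
            (\<lambda>p. a + fst p *\<^sub>R d + snd p *\<^sub>R e)) (\<lambda>_. ennreal \<bar>cross2 d e\<bar>)"
proof -
  define T :: "real^2 \<Rightarrow> real^2" where "T w = (w$1) *\<^sub>R d + (w$2) *\<^sub>R e" for w
  have lin: "linear T"
    by (rule linearI) (auto simp: T_def algebra_simps)
  have det: "det (matrix T) = cross2 d e"
    by (simp add: det_2 matrix_def T_def cross2_def axis_def)
  have [measurable]: "T \<in> borel_measurable borel"
    using lin linear_continuous_on linear_conv_bounded_linear borel_measurable_continuous_onI by blast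
  have [measurable]: "(\<lambda>(s,t). vector [s, t] :: real^2) \<in> borel_measurable (borel :: (real\<times>real) measure)"
    by (intro borel_measurable_continuous_onI)
       (auto simp: split_beta continuous_on_componentwise[where 'b="real^2"] Basis_vec_def inner_axis
          forall_2 vector_2 intro!: continuous_intros)
  have "(lborel::(real^2) measure) = distr lborel borel ((+) a)"
    by (rule lborel_distr_plus[symmetric])
  also have "\<dots> = distr (density (distr lborel borel T) (\<lambda>_. ennreal \<bar>cross2 d e\<bar>)) borel ((+) a)"
    using lborel_linear_image[OF lin] assms det by simp
  also have "\<dots> = density (distr (distr lborel borel T) borel ((+) a)) (\<lambda>_. ennreal \<bar>cross2 d e\<bar>)"
    by (rule density_distr[symmetric]) auto
  also have "distr (distr lborel borel T) borel ((+) a)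
      = distr lborel borel (\<lambda>w. a + T w)"
    by (subst distr_distr) (auto simp: o_def)
  also have "\<dots> = distr (distr lborel borel (\<lambda>(s,t). vector [s, t] :: real^2)) borel (\<lambda>w. a + T w)"
    using lborel_vec2 by simp
  also have "\<dots> = distr lborel borel (\<lambda>p. a + fst p *\<^sub>R d + snd p *\<^sub>R e)"
    by (subst distr_distr) (auto simp: o_def T_def vector_2 split_beta add.assoc)
  finally show ?thesis .
qed

lemma
  fixes a d e :: "real^2" and f :: "real^2 \<Rightarrow> real"
  assumes ne: "cross2 d e \<noteq> 0" and f[measurable]: "f \<in> borel_measurable borel"
  shows integral_plane_coordinates:
    "(\<integral>x. f x \<partial>lborel) = \<bar>cross2 d e\<bar> * (\<integral>p. f (a + fst p *\<^sub>R d + snd p *\<^sub>R e) \<partial>lborel)"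
  and integrable_plane_coordinates:
    "integrable lborel f \<longleftrightarrow> integrable lborel (\<lambda>p. f (a + fst p *\<^sub>R d + snd p *\<^sub>R e))"
proof -
  have [measurable]: "(\<lambda>p. a + fst p *\<^sub>R d + snd p *\<^sub>R e) \<in> borel_measurable (borel::(real\<times>real) measure)"
    by (intro borel_measurable_continuous_onI continuous_intros)
  let ?D = "density (distr lborel borel (\<lambda>p::real\<times>real. a + fst p *\<^sub>R d + snd p *\<^sub>R e)) (\<lambda>_. ennreal \<bar>cross2 d e\<bar>)"
  have L: "lborel = ?D" by (rule lborel_plane_coordinates[OF ne])
  have "(\<integral>x. f x \<partial>lborel) = (\<integral>x. f x \<partial>?D)" using L by simp
  also have "\<dots> = (\<integral>x. \<bar>cross2 d e\<bar> *\<^sub>R f x \<partial>distr lborel borel (\<lambda>p::real\<times>real. a + fst p *\<^sub>R d + snd p *\<^sub>R e))"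
    by (subst integral_density) auto
  also have "\<dots> = (\<integral>p. \<bar>cross2 d e\<bar> *\<^sub>R f (a + fst p *\<^sub>R d + snd p *\<^sub>R e) \<partial>lborel)"
    by (subst integral_distr) auto
  finally show "(\<integral>x. f x \<partial>lborel) = \<bar>cross2 d e\<bar> * (\<integral>p. f (a + fst p *\<^sub>R d + snd p *\<^sub>R e) \<partial>lborel)"
    by simp
  have "integrable lborel f \<longleftrightarrow> integrable ?D f" using L by simp
  also have "\<dots> \<longleftrightarrow> integrable (distr lborel borel (\<lambda>p::real\<times>real. a + fst p *\<^sub>R d + snd p *\<^sub>R e)) (\<lambda>x. \<bar>cross2 d e\<bar> *\<^sub>R f x)"
    by (subst integrable_density) auto
  also have "\<dots> \<longleftrightarrow> integrable lborel (\<lambda>p. \<bar>cross2 d e\<bar> *\<^sub>R f (a + fst p *\<^sub>R d + snd p *\<^sub>R e))"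
    by (subst integrable_distr_eq) auto
  finally show "integrable lborel f \<longleftrightarrow> integrable lborel (\<lambda>p. f (a + fst p *\<^sub>R d + snd p *\<^sub>R e))"
    using ne by simp
qed

section \<open>Moments of radial kernels\<close>

text \<open>
  Polar coordinates as the distribution of the norm: the disc of radius \<open>a\<close> has area \<open>pi * a\<^sup>2\<close>, the
  integral of \<open>2 * pi * r\<close>.
\<close>

lemma distr_norm_plane:
  "distr (lborel :: (real^2) measure) borel norm = density lborel (\<lambda>r. ennreal (2 * pi * r) * indicator {0..} r)"
  (is "?M = ?N")
proof (rule measure_eqI_generator_eq[where E="range atMost" and \<Omega>=UNIV and A="\<lambda>i. {..real i}"])
  show "Int_stable (range (atMost :: real \<Rightarrow> _))" by (auto simp: Int_stable_def)
  have em: "emeasure ?M {..a} = ennreal (pi * a\<^sup>2) * indicator {0..} a" for a :: real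
  proof -
    have "emeasure ?M {..a} = emeasure lborel (norm -` {..a} :: (real^2) set)"
      by (subst emeasure_distr) auto
    also have "norm -` {..a} = cball (0::real^2) a" by (auto simp: dist_norm)
    also have "emeasure lborel (cball (0::real^2) a) = ennreal (pi * a\<^sup>2) * indicator {0..} a"
      by (cases "a \<ge> 0") (auto simp: emeasure_cball eval_unit_ball_vol)
    finally show ?thesis .
  qed
  have en: "emeasure ?N {..a} = ennreal (pi * a\<^sup>2) * indicator {0..} a" for a :: real
  proof (cases "a \<ge> 0")
    case True
    have "emeasure ?N {..a} = (\<integral>\<^sup>+ r. ennreal (2 * pi * r) * indicator {0..a} r \<partial>lborel)"
      by (subst emeasure_density) (auto intro!: nn_integral_cong simp: indicator_def)
    also have "\<dots> = ennreal (pi * a\<^sup>2 - pi * 0\<^sup>2)"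
      by (rule nn_integral_FTC_Icc) (use True in \<open>auto intro!: derivative_eq_intros\<close>)
    finally show ?thesis using True by simp
  next
    case False
    then have "emeasure ?N {..a} = 0"
      by (subst emeasure_density) (auto simp: nn_integral_0_iff_AE indicator_def)
    then show ?thesis using False by simp
  qed
  show "emeasure ?M X = emeasure ?N X" if "X \<in> range atMost" for X
    using that em en by auto
  show "emeasure ?M {..real i} \<noteq> \<infinity>" for i
    unfolding em by (auto simp: ennreal_mult_eq_top_iff)
  show "(\<Union>i. {..real i}) = UNIV" by (auto simp: real_arch_simple)
qed (auto simp: borel_eq_atMost)

text \<open>
  This carries the almost-everywhere representation of a profile by a Borel function over to the
  kernel in the plane.
\<close>

lemma AE_norm_plane:
  assumes "AE r in lborel. P (r::real)"
  shows "AE z in (lborel :: (real^2) measure). P (norm z)"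
proof -
  obtain N where N: "N \<in> null_sets lborel" "{r. \<not> P r} \<subseteq> N"
    using assms unfolding eventually_ae_filter by auto
  then have [measurable]: "N \<in> sets borel" by auto
  have "AE r in lborel. r \<notin> N" using N AE_not_in by blast
  then have "AE r in density lborel (\<lambda>r. ennreal (2 * pi * r) * indicator {0..} r). r \<notin> N"
    by (subst AE_density) auto
  then have "AE z in (lborel :: (real^2) measure). norm z \<notin> N"
    unfolding distr_norm_plane[symmetric] by (subst (asm) AE_distr_iff) auto
  then show ?thesis by eventually_elim (use N in auto)
qed

lemma
  fixes f :: "real \<Rightarrow> real"
  assumes [measurable]: "f \<in> borel_measurable borel" and neg: "\<And>r. r \<le> 0 \<Longrightarrow> f r = 0"
  shows integral_radial_plane: "(\<integral>z. f (norm (z::real^2)) \<partial>lborel) = 2 * pi * (\<integral>r. r * f r \<partial>lborel)"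
  and integrable_radial_plane: "integrable lborel (\<lambda>z::real^2. f (norm z)) \<longleftrightarrow> integrable lborel (\<lambda>r. r * f r)"
proof -
  let ?w = "\<lambda>r::real. 2 * pi * r * indicator {0..} r"
  have w: "ennreal (2 * pi * r) * indicator {0..} r = ennreal (?w r)" for r
    by (auto simp: indicator_def)
  have eq: "?w r *\<^sub>R f r = 2 * pi * (r * f r)" for r
    using neg[of r] by (auto simp: indicator_def)
  have "(\<integral>z. f (norm (z::real^2)) \<partial>lborel) = (\<integral>r. f r \<partial>distr (lborel :: (real^2) measure) borel norm)"
    by (subst integral_distr) auto
  also have "\<dots> = (\<integral>r. ?w r *\<^sub>R f r \<partial>lborel)"
    unfolding distr_norm_plane w by (subst integral_density) (auto simp: indicator_def)
  finally show "(\<integral>z. f (norm (z::real^2)) \<partial>lborel) = 2 * pi * (\<integral>r. r * f r \<partial>lborel)"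
    unfolding eq by simp
  have "integrable lborel (\<lambda>z::real^2. f (norm z)) \<longleftrightarrow> integrable (distr (lborel :: (real^2) measure) borel norm) f"
    by (subst integrable_distr_eq) auto
  also have "\<dots> \<longleftrightarrow> integrable lborel (\<lambda>r. ?w r *\<^sub>R f r)"
    unfolding distr_norm_plane w by (subst integrable_density) (auto simp: indicator_def)
  finally show "integrable lborel (\<lambda>z::real^2. f (norm z)) \<longleftrightarrow> integrable lborel (\<lambda>r. r * f r)"
    unfolding eq by simp
qed

text \<open>
  The rotation of \<open>n\<close> by a right angle, which completes a unit vector to an orthonormal basis.
\<close>

definition perp :: "real^2 \<Rightarrow> real^2" where
  "perp n = vector [- (n$2), n$1]"

lemma perp_simps [simp]:
  "norm (perp n) = norm n" "n \<bullet> perp n = 0" "perp n \<bullet> n = 0" "cross2 n (perp n) = (norm n)\<^sup>2"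
  by (simp_all add: perp_def norm_eq_sqrt_inner inner_vec_def sum_2 vector_2 cross2_def)

lemma perp_expand:
  assumes "norm n = 1"
  shows "a = (n \<bullet> a) *\<^sub>R n + (perp n \<bullet> a) *\<^sub>R perp n"
proof -
  have "n$1 * n$1 + n$2 * n$2 = 1"
    using assms by (simp add: norm_eq_sqrt_inner inner_vec_def sum_2)
  then have "a$1 = (n$1 * n$1 + n$2 * n$2) * a$1" "a$2 = (n$1 * n$1 + n$2 * n$2) * a$2" by auto
  then show ?thesis
    by (simp add: vec_eq_iff forall_2 perp_def inner_vec_def sum_2 vector_2 algebra_simps)
qed

lemma norm_orthonormal_combination:
  fixes n m :: "'a::real_inner"
  assumes "norm n = 1" "norm m = 1" "n \<bullet> m = 0"
  shows "norm (s *\<^sub>R n + t *\<^sub>R m) = sqrt (s\<^sup>2 + t\<^sup>2)"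
proof -
  have "n \<bullet> n = 1" "m \<bullet> m = 1" using assms by (auto simp: dot_square_norm)
  then show ?thesis using assms(3)
    by (simp add: norm_eq_sqrt_inner inner_simps inner_commute power2_eq_square)
qed

context
  fixes h :: "real \<Rightarrow> real"
  assumes h[measurable]: "h \<in> borel_measurable borel" and h_nonneg: "\<And>r. 0 \<le> h r"
    and h_neg: "\<And>r. r \<le> 0 \<Longrightarrow> h r = 0" and h_int: "integrable lborel (\<lambda>r. r ^ 3 * h r)"
begin

lemma radial_second_moment:
  shows "integrable lborel (\<lambda>z::real^2. h (norm z) * (norm z)\<^sup>2)"
   and "(\<integral>z. h (norm z) * (norm (z::real^2))\<^sup>2 \<partial>lborel) = 2 * pi * (\<integral>r. r ^ 3 * h r \<partial>lborel)"
proof -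
  have eq: "r * (h r * r\<^sup>2) = r ^ 3 * h r" for r :: real by (simp add: power2_eq_square power3_eq_cube)
  show "integrable lborel (\<lambda>z::real^2. h (norm z) * (norm z)\<^sup>2)"
    using h_int by (subst integrable_radial_plane[where f="\<lambda>r. h r * r\<^sup>2"]) (auto simp: h_neg eq)
  show "(\<integral>z. h (norm z) * (norm (z::real^2))\<^sup>2 \<partial>lborel) = 2 * pi * (\<integral>r. r ^ 3 * h r \<partial>lborel)"
    by (subst integral_radial_plane[where f="\<lambda>r. h r * r\<^sup>2"]) (auto simp: h_neg eq)
qed

lemma radial_integrable_quadratic:
  fixes q :: "real^2 \<Rightarrow> real"
  assumes [measurable]: "q \<in> borel_measurable borel" and q: "\<And>z. \<bar>q z\<bar> \<le> C * (norm z)\<^sup>2"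
  shows "integrable lborel (\<lambda>z. h (norm z) * q z)"
proof (rule Bochner_Integration.integrable_bound)
  show "integrable lborel (\<lambda>z::real^2. C * (h (norm z) * (norm z)\<^sup>2))"
    using radial_second_moment(1) by simp
  show "AE z in lborel. norm (h (norm z) * q z) \<le> norm (C * (h (norm z) * (norm z)\<^sup>2))"
  proof (rule AE_I2)
    fix z :: "real^2"
    have "norm (h (norm z) * q z) = h (norm z) * \<bar>q z\<bar>" using h_nonneg by (simp add: abs_mult)
    also have "\<dots> \<le> h (norm z) * (C * (norm z)\<^sup>2)" using q h_nonneg by (intro mult_left_mono) auto
    also have "\<dots> = C * (h (norm z) * (norm z)\<^sup>2)" by simp
    also have "\<dots> \<le> norm (C * (h (norm z) * (norm z)\<^sup>2))" by simp
    finally show "norm (h (norm z) * q z) \<le> norm (C * (h (norm z) * (norm z)\<^sup>2))" .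
  qed
qed simp

lemma
  fixes e f :: "real^2" and q :: "real^2 \<Rightarrow> real"
  assumes e: "norm e = 1" "norm f = 1" "e \<bullet> f = 0" and q[measurable]: "q \<in> borel_measurable borel"
  shows integral_orthonormal_coordinates: "(\<integral>z. h (norm z) * q z \<partial>lborel)
      = (\<integral>p. h (sqrt ((fst p)\<^sup>2 + (snd p)\<^sup>2)) * q (fst p *\<^sub>R e + snd p *\<^sub>R f) \<partial>lborel)" (is ?eq)
    and integrable_orthonormal_coordinates: "integrable lborel (\<lambda>z. h (norm z) * q z) \<longleftrightarrow>
      integrable lborel (\<lambda>p. h (sqrt ((fst p)\<^sup>2 + (snd p)\<^sup>2)) * q (fst p *\<^sub>R e + snd p *\<^sub>R f))" (is ?int)
proof -
  have "(cross2 e f)\<^sup>2 = (e \<bullet> e) * (f \<bullet> f) - (e \<bullet> f)\<^sup>2"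
    by (simp add: cross2_def inner_vec_def sum_2) algebra
  also have "\<dots> = 1" using e by (simp add: dot_square_norm)
  finally have c: "\<bar>cross2 e f\<bar> = 1" by (simp add: power2_eq_1_iff) linarith
  then have ne: "cross2 e f \<noteq> 0" by auto
  have [measurable]: "(\<lambda>z. h (norm z) * q z) \<in> borel_measurable borel" by simp
  show ?eq ?int
    using integral_plane_coordinates[OF ne, of "\<lambda>z. h (norm z) * q z" 0]
      integrable_plane_coordinates[OF ne, of "\<lambda>z. h (norm z) * q z" 0]
    by (simp_all add: norm_orthonormal_combination[OF e] c)
qed

text \<open>
  In the orthonormal basis given by \<open>n\<close> and \<open>perp n\<close>, reflection symmetry of the kernel
  removes the tangential component of \<open>a\<close>. The normal component sees one half plane out of two and one
  coordinate direction out of two, hence a quarter of the full second moment \<open>2 * pi * \<integral> r^3 h\<close>.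
\<close>

lemma radial_half_plane_moment:
  fixes n a :: "real^2"
  assumes n: "norm n = 1"
  shows "(\<integral>z. h (norm z) * (max 0 (n \<bullet> z) * (a \<bullet> z)) \<partial>lborel)
     = pi / 2 * (\<integral>r. r ^ 3 * h r \<partial>lborel) * (a \<bullet> n)"
proof -
  define m where "m = perp n"
  have m: "norm m = 1" "n \<bullet> m = 0" "m \<bullet> n = 0" "cross2 n m = 1" using n by (auto simp: m_def)
  have nn: "n \<bullet> n = 1" "m \<bullet> m = 1" using n m by (auto simp: dot_square_norm)
  define H where "H p = h (sqrt ((fst p)\<^sup>2 + (snd p)\<^sup>2))" for p :: "real \<times> real"
  have cs: "\<bar>n \<bullet> z\<bar> \<le> norm z" "\<bar>m \<bullet> z\<bar> \<le> norm z" for z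
    using Cauchy_Schwarz_ineq2[of n z] Cauchy_Schwarz_ineq2[of m z] n m by auto
  let ?mix = "\<lambda>z. max 0 (n \<bullet> z) * (m \<bullet> z)" and ?pos = "\<lambda>z. (max 0 (n \<bullet> z))\<^sup>2" and ?sq = "\<lambda>z. (n \<bullet> z)\<^sup>2"
  have pos_le: "max 0 (n \<bullet> z) \<le> norm z" for z using cs(1)[of z] by auto
  have int_mix: "integrable lborel (\<lambda>z. h (norm z) * ?mix z)"
  proof (rule radial_integrable_quadratic[where C=1])
    show "\<bar>max 0 (n \<bullet> z) * (m \<bullet> z)\<bar> \<le> 1 * (norm z)\<^sup>2" for z
      using mult_mono[OF pos_le cs(2)] by (simp add: abs_mult power2_eq_square)
  qed simp
  have int_pos: "integrable lborel (\<lambda>z. h (norm z) * ?pos z)"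
  proof (rule radial_integrable_quadratic[where C=1])
    show "\<bar>(max 0 (n \<bullet> z))\<^sup>2\<bar> \<le> 1 * (norm z)\<^sup>2" for z
      using power_mono[OF pos_le, of z 2] by simp
  qed simp
  have int_sq: "integrable lborel (\<lambda>z. h (norm z) * ?sq z)"
  proof (rule radial_integrable_quadratic[where C=1])
    show "\<bar>(n \<bullet> z)\<^sup>2\<bar> \<le> 1 * (norm z)\<^sup>2" for z
      using power_mono[OF cs(1), of z 2] by simp
  qed simp
  have frames: "norm (- n) = 1" "norm (- m) = 1" "n \<bullet> - m = 0" "- n \<bullet> m = 0" using n m by auto
  note P = integral_orthonormal_coordinates[folded H_def] and Q = integrable_orthonormal_coordinates[folded H_def]
  \<comment> \<open>The mixed moment is odd under the reflection that fixes \<open>n\<close>.\<close>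
  have "(\<integral>z. h (norm z) * ?mix z \<partial>lborel) = (\<integral>p. H p * (max 0 (fst p) * snd p) \<partial>lborel)"
    using m nn by (subst P[OF n m(1) m(2)]) (simp_all add: inner_simps)
  moreover have "(\<integral>z. h (norm z) * ?mix z \<partial>lborel) = (\<integral>p. - (H p * (max 0 (fst p) * snd p)) \<partial>lborel)"
    using m nn by (subst P[OF n frames(2) frames(3)]) (simp_all add: inner_simps)
  ultimately have mix: "(\<integral>z. h (norm z) * ?mix z \<partial>lborel) = 0" by simp
  \<comment> \<open>The two half planes contribute equally.\<close>
  have p1: "(\<integral>z. h (norm z) * ?pos z \<partial>lborel) = (\<integral>p. H p * (max 0 (fst p))\<^sup>2 \<partial>lborel)"
    using m nn by (subst P[OF n m(1) m(2)]) (simp_all add: inner_simps)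
  have p2: "(\<integral>z. h (norm z) * ?pos z \<partial>lborel) = (\<integral>p. H p * (max 0 (- fst p))\<^sup>2 \<partial>lborel)"
    using m nn by (subst P[OF frames(1) m(1) frames(4)]) (simp_all add: inner_simps)
  have i1: "integrable lborel (\<lambda>p. H p * (max 0 (fst p))\<^sup>2)"
    using int_pos m nn by (subst (asm) Q[OF n m(1) m(2)]) (simp_all add: inner_simps)
  have i2: "integrable lborel (\<lambda>p. H p * (max 0 (- fst p))\<^sup>2)"
    using int_pos m nn by (subst (asm) Q[OF frames(1) m(1) frames(4)]) (simp_all add: inner_simps)
  have "2 * (\<integral>z. h (norm z) * ?pos z \<partial>lborel) = (\<integral>p. H p * (max 0 (fst p))\<^sup>2 + H p * (max 0 (- fst p))\<^sup>2 \<partial>lborel)"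
    using p1 p2 i1 i2 by simp
  also have "\<dots> = (\<integral>p. H p * (fst p)\<^sup>2 \<partial>lborel)"
    by (intro Bochner_Integration.integral_cong) (auto simp: max_def)
  finally have pos: "2 * (\<integral>z. h (norm z) * ?pos z \<partial>lborel) = (\<integral>p. H p * (fst p)\<^sup>2 \<partial>lborel)" .
  \<comment> \<open>The two coordinate directions share the full second moment equally.\<close>
  have s1: "(\<integral>z. h (norm z) * ?sq z \<partial>lborel) = (\<integral>p. H p * (fst p)\<^sup>2 \<partial>lborel)"
    using m nn by (subst P[OF n m(1) m(2)]) (simp_all add: inner_simps)
  have s2: "(\<integral>z. h (norm z) * ?sq z \<partial>lborel) = (\<integral>p. H p * (snd p)\<^sup>2 \<partial>lborel)"
    using m nn by (subst P[OF m(1) n m(3)]) (simp_all add: inner_simps)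
  have j1: "integrable lborel (\<lambda>p. H p * (fst p)\<^sup>2)"
    using int_sq m nn by (subst (asm) Q[OF n m(1) m(2)]) (simp_all add: inner_simps)
  have j2: "integrable lborel (\<lambda>p. H p * (snd p)\<^sup>2)"
    using int_sq m nn by (subst (asm) Q[OF m(1) n m(3)]) (simp_all add: inner_simps)
  have nz: "(norm (fst p *\<^sub>R n + snd p *\<^sub>R m))\<^sup>2 = (fst p)\<^sup>2 + (snd p)\<^sup>2" for p
    using norm_orthonormal_combination[of n m "fst p" "snd p"] n m by simp
  have "2 * pi * (\<integral>r. r ^ 3 * h r \<partial>lborel) = (\<integral>z. h (norm z) * (norm (z::real^2))\<^sup>2 \<partial>lborel)"
    by (rule radial_second_moment(2)[symmetric])
  also have "\<dots> = (\<integral>p. H p * ((fst p)\<^sup>2 + (snd p)\<^sup>2) \<partial>lborel)"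
    using m nn by (subst P[OF n m(1) m(2)]) (simp_all add: nz)
  also have "\<dots> = (\<integral>p. H p * (fst p)\<^sup>2 \<partial>lborel) + (\<integral>p. H p * (snd p)\<^sup>2 \<partial>lborel)"
    using j1 j2 by (simp add: distrib_left)
  also have "\<dots> = 4 * (\<integral>z. h (norm z) * ?pos z \<partial>lborel)"
    using pos s1 s2 by simp
  finally have val: "(\<integral>z. h (norm z) * ?pos z \<partial>lborel) = pi / 2 * (\<integral>r. r ^ 3 * h r \<partial>lborel)" by simp
  have az: "a \<bullet> z = (a \<bullet> n) * (n \<bullet> z) + (a \<bullet> m) * (m \<bullet> z)" for z
    using arg_cong[OF perp_expand[OF n, of a], of "\<lambda>a. a \<bullet> z"] by (simp add: m_def inner_simps inner_commute)
  have "(\<integral>z. h (norm z) * (max 0 (n \<bullet> z) * (a \<bullet> z)) \<partial>lborel)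
     = (\<integral>z. (a \<bullet> n) * (h (norm z) * ?pos z) + (a \<bullet> m) * (h (norm z) * ?mix z) \<partial>lborel)"
  proof (intro Bochner_Integration.integral_cong refl)
    fix z
    have sq: "(max 0 (n \<bullet> z))\<^sup>2 = max 0 (n \<bullet> z) * (n \<bullet> z)" by (auto simp: max_def power2_eq_square)
    show "h (norm z) * (max 0 (n \<bullet> z) * (a \<bullet> z))
        = (a \<bullet> n) * (h (norm z) * ?pos z) + (a \<bullet> m) * (h (norm z) * ?mix z)"
      unfolding az[of z] sq by (simp only: algebra_simps)
  qed
  also have "\<dots> = (a \<bullet> n) * (\<integral>z. h (norm z) * ?pos z \<partial>lborel) + (a \<bullet> m) * (\<integral>z. h (norm z) * ?mix z \<partial>lborel)"
    using int_pos int_mix by simp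
  finally show ?thesis using val mix by simp
qed

end

text \<open>
  Everything the asymptotics use about the kernel at one horizon \<open>\<delta>\<close>. The last two clauses are
  the only place where the profile enters quantitatively, and they do not depend on \<open>\<delta>\<close>.
\<close>

definition moment_kernel :: "real \<Rightarrow> real \<Rightarrow> (real^2 \<Rightarrow> real) \<Rightarrow> bool" where
  "moment_kernel \<delta> \<sigma> \<Gamma> \<longleftrightarrow>
     \<Gamma> \<in> borel_measurable borel \<and> (\<forall>z. 0 \<le> \<Gamma> z) \<and> (\<forall>z. \<delta> \<le> norm z \<longrightarrow> \<Gamma> z = 0) \<and>
     (\<forall>z. \<Gamma> (- z) = \<Gamma> z) \<and> integrable lborel \<Gamma> \<and>
     integrable lborel (\<lambda>z. \<Gamma> z * (norm z)\<^sup>2) \<and>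
     (\<integral>z. \<Gamma> z * (norm z)\<^sup>2 \<partial>lborel) = 4 * \<sigma> \<and>
     (\<forall>n a. norm n = 1 \<longrightarrow> (\<integral>z. \<Gamma> z * (max 0 (n \<bullet> z) * (a \<bullet> z)) \<partial>lborel) = \<sigma> * (a \<bullet> n))"

text \<open>
  The profile is only Lebesgue measurable; it agrees almost everywhere on \<open>{0<..<\<delta>}\<close> with a
  nonnegative Borel function, and \<open>\<Gamma>\<close> is the radial function built from that representative.
  Plain integrability of \<open>\<Gamma>\<close> comes from the weight \<open>r \<le> \<delta>\<close> of polar coordinates.
\<close>

lemma kernel_family_moment_kernel:
  assumes "kernel_family g \<sigma>" "0 < \<delta>"
  obtains \<Gamma> where "moment_kernel \<delta> \<sigma> \<Gamma>" "AE z in lborel. g \<delta> (norm z) = \<Gamma> z"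
proof -
  let ?I = "{0<..<\<delta>}"
  have g0: "\<And>r. r \<ge> 0 \<Longrightarrow> g \<delta> r \<ge> 0" and gout: "\<And>r. r > \<delta> \<Longrightarrow> g \<delta> r = 0"
    and gint: "set_integrable lebesgue ?I (g \<delta>)" and sg: "\<sigma> = pi / 2 * (LINT r:?I|lebesgue. r ^ 3 * g \<delta> r)"
    and g3: "set_integrable lebesgue ?I (\<lambda>r. r ^ 3 * g \<delta> r)"
    using assms(1)[unfolded kernel_family_def, rule_format, OF assms(2)] by blast+
  have "(\<lambda>r. indicator ?I r *\<^sub>R g \<delta> r) \<in> borel_measurable lebesgue"
    using gint unfolding set_integrable_def by auto
  then obtain h0 where [measurable]: "h0 \<in> borel_measurable lborel"
    and h0: "AE r in lborel. indicator ?I r *\<^sub>R g \<delta> r = h0 r"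
    using completion_ex_borel_measurable_real[of _ lborel] by blast
  \<comment> \<open>Truncation makes \<open>h\<close> nonnegative and zero outside the open interval at every point.\<close>
  define h where "h r = indicator ?I r * max 0 (h0 r)" for r
  have [measurable]: "h \<in> borel_measurable borel" unfolding h_def by auto
  have hnn: "0 \<le> h r" for r by (auto simp: h_def indicator_def)
  have hneg: "h r = 0" if "r \<le> 0 \<or> \<delta> \<le> r" for r using that by (auto simp: h_def indicator_def)
  have gh: "AE r in lborel. indicator ?I r * g \<delta> r = h r"
    using h0
  proof eventually_elim
    case (elim r)
    show ?case
      using elim g0[of r] by (cases "r \<in> ?I") (simp_all add: h_def)
  qed
  have int1: "integrable lborel h"
  proof -
    have "integrable lebesgue h"
      using gint unfolding set_integrable_def
      by (subst integrable_cong_AE[where g="\<lambda>r. indicator ?I r *\<^sub>R g \<delta> r"])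
         (use gh in \<open>auto intro: measurable_completion simp: AE_completion_iff\<close>)
    then show ?thesis by (simp add: integrable_completion)
  qed
  have r3: "AE r in lebesgue. r ^ 3 * h r = indicator ?I r *\<^sub>R (r ^ 3 * g \<delta> r)"
    unfolding AE_completion_iff using gh by eventually_elim (auto simp: indicator_def)
  have m3: "(\<lambda>r. r ^ 3 * h r) \<in> borel_measurable lebesgue" by (intro measurable_completion) auto
  have int3: "integrable lborel (\<lambda>r. r ^ 3 * h r)"
  proof -
    have "integrable lebesgue (\<lambda>r. r ^ 3 * h r)"
      using integrable_cong_AE[OF m3 borel_measurable_integrable r3] g3 unfolding set_integrable_def by blast
    then show ?thesis by (simp add: integrable_completion)
  qed
  have sg': "\<sigma> = pi / 2 * (\<integral>r. r ^ 3 * h r \<partial>lborel)"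
  proof -
    have "(LINT r:?I|lebesgue. r ^ 3 * g \<delta> r) = integral\<^sup>L lebesgue (\<lambda>r. r ^ 3 * h r)"
      unfolding set_lebesgue_integral_def
      using integral_cong_AE[OF m3 borel_measurable_integrable r3] g3 unfolding set_integrable_def by auto
    then show ?thesis using sg by (simp add: integral_completion)
  qed
  define \<Gamma> where "\<Gamma> z = h (norm z)" for z :: "real^2"
  have "integrable lborel (\<lambda>r. r * h r)"
  proof (rule Bochner_Integration.integrable_bound)
    show "integrable lborel (\<lambda>r. \<delta> * h r)" using int1 by simp
    have "\<bar>r\<bar> * h r \<le> \<delta> * h r" for r
    proof (cases "r \<le> 0 \<or> \<delta> \<le> r")
      case False
      then show ?thesis using hnn by (intro mult_right_mono) auto
    qed (simp add: hneg)
    then show "AE r in lborel. norm (r * h r) \<le> norm (\<delta> * h r)"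
      using hnn assms(2) by (intro AE_I2) (simp add: abs_mult)
  qed auto
  then have intG: "integrable lborel \<Gamma>"
    unfolding \<Gamma>_def using hneg by (subst integrable_radial_plane) auto
  have 1: "moment_kernel \<delta> \<sigma> \<Gamma>"
    unfolding moment_kernel_def
  proof (intro conjI allI impI)
    show "\<Gamma> \<in> borel_measurable borel" unfolding \<Gamma>_def by auto
    show "integrable lborel \<Gamma>" by (rule intG)
    show "integrable lborel (\<lambda>z. \<Gamma> z * (norm z)\<^sup>2)"
      unfolding \<Gamma>_def by (rule radial_second_moment(1)) (use hnn hneg int3 in auto)
    show "(\<integral>z. \<Gamma> z * (norm z)\<^sup>2 \<partial>lborel) = 4 * \<sigma>"
      unfolding \<Gamma>_def by (subst radial_second_moment(2)) (use hnn hneg int3 sg' in auto)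
    show "(\<integral>z. \<Gamma> z * (max 0 (n \<bullet> z) * (a \<bullet> z)) \<partial>lborel) = \<sigma> * (a \<bullet> n)" if "norm n = 1" for n a
      unfolding \<Gamma>_def by (subst radial_half_plane_moment) (use hnn hneg int3 sg' that in auto)
  qed (auto simp: \<Gamma>_def hnn hneg)
  have "AE r in lborel. r \<noteq> 0 \<and> r \<noteq> \<delta> \<and> indicator ?I r * g \<delta> r = h r"
    using gh AE_lborel_singleton[of 0] AE_lborel_singleton[of \<delta>] by eventually_elim auto
  then have "AE z in lborel. norm (z::real^2) \<noteq> 0 \<and> norm z \<noteq> \<delta> \<and> indicator ?I (norm z) * g \<delta> (norm z) = h (norm z)"
    by (rule AE_norm_plane)
  then have "AE z in lborel. g \<delta> (norm (z::real^2)) = \<Gamma> z"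
  proof eventually_elim
    case (elim z)
    show ?case
    proof (cases "norm z < \<delta>")
      case True
      with elim show ?thesis by (auto simp: \<Gamma>_def indicator_def)
    next
      case False
      with elim gout[of "norm z"] hneg[of "norm z"] show ?thesis by (auto simp: \<Gamma>_def)
    qed
  qed
  with 1 show ?thesis using that by blast
qed

section \<open>Edges and normals of a convex polygon\<close>

text \<open>
  The endpoints are those chosen in \<open>segment_integral\<close>, so that arc length integrals can be
  written in the parametrization \<open>edge_point\<close>.
\<close>

definition edge_start :: "(real^2) set \<Rightarrow> real^2" where
  "edge_start E = fst (SOME (a, b). E = closed_segment a b)"

definition edge_end :: "(real^2) set \<Rightarrow> real^2" where
  "edge_end E = snd (SOME (a, b). E = closed_segment a b)"

definition edge_vector :: "(real^2) set \<Rightarrow> real^2" where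
  "edge_vector E = edge_end E - edge_start E"

definition edge_point :: "(real^2) set \<Rightarrow> real \<Rightarrow> real^2" where
  "edge_point E s = edge_start E + s *\<^sub>R edge_vector E"

definition edge_normal :: "(real^2) set \<Rightarrow> (real^2) set \<Rightarrow> real^2" where
  "edge_normal \<Omega> E = (SOME n. norm n = 1 \<and> (\<forall>x\<in>\<Omega>. n \<bullet> x < n \<bullet> edge_start E) \<and>
     E = closure \<Omega> \<inter> {x. n \<bullet> x = n \<bullet> edge_start E})"

text \<open>
  The parallelogram swept out by the edge \<open>E\<close> when it is moved back by \<open>z\<close>: from each of its
  points the displacement \<open>z\<close> crosses the line of \<open>E\<close>. The sides are left out, so
  that the strips of different edges through which \<open>z\<close> points outward are disjoint.
\<close>

definition exit_strip :: "(real^2) set \<Rightarrow> real^2 \<Rightarrow> (real^2) set" where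
  "exit_strip E z = {edge_point E s - t *\<^sub>R z | s t. 0 < s \<and> s < 1 \<and> 0 < t \<and> t < 1}"

lemma frontier_crossing:
  fixes x y :: "'a::real_normed_vector"
  assumes "x \<in> S" "y \<notin> S"
  obtains t where "0 \<le> t" "t \<le> 1" "x + t *\<^sub>R (y - x) \<in> frontier S"
proof -
  have "closed_segment x y \<inter> frontier S \<noteq> {}"
    using assms by (intro connected_Int_frontier) auto
  then obtain q where q: "q \<in> closed_segment x y" "q \<in> frontier S" by blast
  then obtain t where t: "0 \<le> t" "t \<le> 1" "q = (1 - t) *\<^sub>R x + t *\<^sub>R y" by (auto simp: in_segment)
  have "q = x + t *\<^sub>R (y - x)" unfolding t(3) by (simp add: algebra_simps)
  then show ?thesis using that t(1,2) q(2) by blast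
qed

lemma segment_integral_edge_point:
  "segment_integral E f = (LINT s:{0..1}|lebesgue. f (edge_point E s) * norm (edge_vector E))"
  by (simp add: segment_integral_def edge_point_def edge_vector_def edge_start_def edge_end_def
      split_beta dist_norm norm_minus_commute algebra_simps)

lemma abs_cross2_normal:
  assumes n: "norm n = 1" and d: "n \<bullet> d = 0"
  shows "\<bar>cross2 d z\<bar> = norm d * \<bar>n \<bullet> z\<bar>"
proof -
  have n1: "n$1 * n$1 + n$2 * n$2 = 1"
    using n by (simp add: norm_eq_sqrt_inner inner_vec_def sum_2)
  have nd: "n$1 * d$1 + n$2 * d$2 = 0" using d by (simp add: inner_vec_def sum_2)
  define l where "l = n$1 * d$2 - n$2 * d$1"
  have "l * n$1 = (n$1 * n$1 + n$2 * n$2) * d$2 - n$2 * (n$1 * d$1 + n$2 * d$2)"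
    "l * n$2 = - (n$1 * n$1 + n$2 * n$2) * d$1 + n$1 * (n$1 * d$1 + n$2 * d$2)"
    unfolding l_def by algebra+
  then have l: "d$2 = l * n$1" "d$1 = - (l * n$2)" unfolding n1 nd by auto
  have c: "cross2 d z = - (l * (n \<bullet> z))"
    by (simp add: cross2_def l inner_vec_def sum_2 algebra_simps)
  have "(norm d)\<^sup>2 = (n$1 * n$1 + n$2 * n$2) * l\<^sup>2"
    unfolding power2_norm_eq_inner by (simp add: inner_vec_def sum_2 l power2_eq_square algebra_simps)
  then have "norm d = \<bar>l\<bar>" unfolding n1 by (metis abs_norm_cancel mult_1 power2_eq_iff_nonneg abs_ge_zero power2_abs norm_ge_zero)
  then show ?thesis by (simp add: c abs_mult)
qed

text \<open>
  At distance \<open>d\<close> from the end with the smaller value, an affine function that is nonnegative at both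
  ends of \<open>[0,1]\<close> is at least \<open>d\<close> times its maximum.
\<close>

lemma measure_affine_sublevel:
  fixes \<phi>0 \<phi>1 \<epsilon> :: real
  assumes "0 \<le> \<phi>0" "0 \<le> \<phi>1" "0 < max \<phi>0 \<phi>1" "0 \<le> \<epsilon>"
  shows "measure lborel {s. 0 < s \<and> s < 1 \<and> (1 - s) * \<phi>0 + s * \<phi>1 \<le> \<epsilon>} \<le> \<epsilon> / max \<phi>0 \<phi>1"
proof -
  define M where "M = max \<phi>0 \<phi>1"
  have M: "M > 0" using assms by (simp add: M_def)
  let ?S = "{s. 0 < s \<and> s < 1 \<and> (1 - s) * \<phi>0 + s * \<phi>1 \<le> \<epsilon>}"
  have "?S \<subseteq> {1 - \<epsilon> / M .. 1} \<or> ?S \<subseteq> {0 .. \<epsilon> / M}"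
  proof (cases "\<phi>0 \<le> \<phi>1")
    case True
    have "s * M \<le> \<epsilon>" if "s \<in> ?S" for s
    proof -
      have "0 \<le> (1 - s) * \<phi>0" using that assms by simp
      then show ?thesis using that True by (simp add: M_def)
    qed
    then have "?S \<subseteq> {0 .. \<epsilon> / M}" using M by (auto simp: field_simps)
    then show ?thesis ..
  next
    case False
    have "(1 - s) * M \<le> \<epsilon>" if "s \<in> ?S" for s
    proof -
      have "0 \<le> s * \<phi>1" using that assms by simp
      then show ?thesis using that False by (simp add: M_def)
    qed
    then have "?S \<subseteq> {1 - \<epsilon> / M .. 1}" using M by (force simp: field_simps)
    then show ?thesis ..
  qed
  moreover have e: "0 \<le> \<epsilon> / M" using M assms by simp
  ultimately have "measure lborel ?S \<le> \<epsilon> / M"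
    using measure_mono_fmeasurable[of ?S "{1 - \<epsilon> / M .. 1}" lborel] measure_mono_fmeasurable[of ?S "{0 .. \<epsilon> / M}" lborel]
    by (auto simp: fmeasurable_compact)
  then show ?thesis by (simp add: M_def)
qed

context
  fixes \<Omega> :: "(real^2) set"
  assumes polygon: "convex_polygon \<Omega>"
begin

lemma polygon_basics:
  shows polygon_open: "open \<Omega>" and polygon_convex: "convex \<Omega>" and polygon_nonempty: "\<Omega> \<noteq> {}"
    and polygon_polytope: "polytope (closure \<Omega>)" and polygon_bounded: "bounded \<Omega>"
    and polygon_compact_closure: "compact (closure \<Omega>)"
    and polygon_interior_closure: "interior (closure \<Omega>) = \<Omega>"
    and polygon_frontier: "frontier \<Omega> = closure \<Omega> - \<Omega>"
    and polygon_finite_edges: "finite (polygon_edges \<Omega>)"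
proof -
  show o: "open \<Omega>" "convex \<Omega>" "\<Omega> \<noteq> {}" and p: "polytope (closure \<Omega>)"
    using polygon by (auto simp: convex_polygon_def)
  show c: "compact (closure \<Omega>)" using p by (rule polytope_imp_compact)
  show "bounded \<Omega>" by (rule bounded_subset[OF compact_imp_bounded[OF c] closure_subset])
  show "interior (closure \<Omega>) = \<Omega>" using o by (simp add: convex_interior_closure interior_open)
  show "frontier \<Omega> = closure \<Omega> - \<Omega>" using o by (simp add: frontier_def interior_open)
  show "finite (polygon_edges \<Omega>)"
    using finite_polytope_faces[OF p] by (rule rev_finite_subset) (auto simp: polygon_edges_def edge_of_def)
qed

lemma polygon_aff_dim: "aff_dim (closure \<Omega>) = 2"
  using aff_dim_nonempty_interior[of "closure \<Omega>"] polygon_interior_closure polygon_nonempty by simp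

text \<open>
  The closure has dimension two, so its facets are exactly its edges.
\<close>

lemma frontier_eq_Union_edges: "frontier \<Omega> = \<Union> (polygon_edges \<Omega>)"
proof -
  have "frontier \<Omega> = rel_frontier (closure \<Omega>)"
    using rel_interior_nonempty_interior[of "closure \<Omega>"] polygon_interior_closure polygon_nonempty
    by (simp add: rel_frontier_def polygon_frontier)
  also have "\<dots> = \<Union> {F. F facet_of closure \<Omega>}"
    by (rule rel_frontier_of_polyhedron[OF polytope_imp_polyhedron[OF polygon_polytope]])
  also have "{F. F facet_of closure \<Omega>} = polygon_edges \<Omega>"
    unfolding polygon_edges_def edge_of_def facet_of_def polygon_aff_dim by (auto simp: aff_dim_empty)
  finally show ?thesis .
qed

lemma edge_segment:
  assumes E: "E \<in> polygon_edges \<Omega>"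
  shows "E = closed_segment (edge_start E) (edge_end E)" "edge_vector E \<noteq> 0"
proof -
  have f: "E face_of closure \<Omega>" "aff_dim E = 1" using E by (auto simp: polygon_edges_def edge_of_def)
  have "polytope E" using face_of_polytope_polytope[OF polygon_polytope f(1)] .
  then have c: "compact E" "convex E" by (auto simp: polytope_imp_compact polytope_imp_convex)
  have ne: "E \<noteq> {}" "collinear E" using f(2) by (auto simp: aff_dim_empty collinear_aff_dim)
  obtain a b where ab: "E = closed_segment a b"
    by (rule compact_convex_collinear_segment[OF ne(1) c ne(2)])
  define p where "p = (SOME (a, b). E = closed_segment a b)"
  have "\<exists>x. (case x of (a, b) \<Rightarrow> E = closed_segment a b)" using ab by auto
  from someI_ex[OF this] have "case p of (a, b) \<Rightarrow> E = closed_segment a b" unfolding p_def .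
  then show s: "E = closed_segment (edge_start E) (edge_end E)"
    unfolding edge_start_def edge_end_def p_def[symmetric] by (simp add: split_beta)
  show "edge_vector E \<noteq> 0"
  proof
    assume "edge_vector E = 0"
    then have "E = {edge_start E}" using s by (simp add: edge_vector_def)
    then show False using f(2) aff_dim_sing[of "edge_start E"] by simp
  qed
qed

lemma edge_mem_iff: "E \<in> polygon_edges \<Omega> \<Longrightarrow> x \<in> E \<longleftrightarrow> x \<in> closed_segment (edge_start E) (edge_end E)"
  by (rule arg_cong[OF edge_segment(1)])

lemma edge_ends:
  assumes "E \<in> polygon_edges \<Omega>"
  shows "edge_start E \<in> E" "edge_end E \<in> E"
  by (simp_all add: edge_mem_iff[OF assms])

text \<open>
  Faces of a polyhedron are exposed. The inequality is strict on \<open>\<Omega>\<close> because \<open>\<Omega>\<close> is open and a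
  step along the normal would leave the supporting half plane.
\<close>

lemma edge_normal:
  assumes E: "E \<in> polygon_edges \<Omega>"
  shows norm_edge_normal: "norm (edge_normal \<Omega> E) = 1"
    and edge_normal_less: "\<And>x. x \<in> \<Omega> \<Longrightarrow> edge_normal \<Omega> E \<bullet> x < edge_normal \<Omega> E \<bullet> edge_start E"
    and edge_eq_supporting: "E = closure \<Omega> \<inter> {x. edge_normal \<Omega> E \<bullet> x = edge_normal \<Omega> E \<bullet> edge_start E}"
proof -
  have f: "E face_of closure \<Omega>" "aff_dim E = 1" using E by (auto simp: polygon_edges_def edge_of_def)
  then have "E exposed_face_of closure \<Omega>"
    using exposed_face_of_polyhedron[OF polytope_imp_polyhedron[OF polygon_polytope]] by simp
  then obtain m c where m: "closure \<Omega> \<subseteq> {x. m \<bullet> x \<le> c}" "E = closure \<Omega> \<inter> {x. m \<bullet> x = c}"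
    unfolding exposed_face_of_def by blast
  have "m \<noteq> 0"
  proof
    assume "m = 0"
    then have "E = {} \<or> E = closure \<Omega>" using m(2) by auto
    then show False using f(2) polygon_aff_dim by (auto simp: aff_dim_empty)
  qed
  define n where "n = m /\<^sub>R norm m"
  have n1: "norm n = 1" using \<open>m \<noteq> 0\<close> by (simp add: n_def)
  have mn: "m = norm m *\<^sub>R n" using \<open>m \<noteq> 0\<close> by (simp add: n_def)
  have st: "edge_start E \<in> E" by (rule edge_ends[OF E])
  have mx: "m \<bullet> x = norm m * (n \<bullet> x)" for x using arg_cong[OF mn, of "\<lambda>w. w \<bullet> x"] by simp
  have c: "c = norm m * (n \<bullet> edge_start E)" using m(2) st mx by force
  have le: "n \<bullet> x \<le> n \<bullet> edge_start E" if "x \<in> closure \<Omega>" for x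
    using m(1) that \<open>m \<noteq> 0\<close> unfolding mx c by auto
  have eq: "E = closure \<Omega> \<inter> {x. n \<bullet> x = n \<bullet> edge_start E}"
    using m(2) \<open>m \<noteq> 0\<close> unfolding mx c by simp
  have less: "n \<bullet> x < n \<bullet> edge_start E" if x: "x \<in> \<Omega>" for x
  proof -
    obtain e where e: "e > 0" "cball x e \<subseteq> \<Omega>" using polygon_open x open_contains_cball by blast
    then have "x + e *\<^sub>R n \<in> cball x e" using n1 by (simp add: dist_norm)
    then have "n \<bullet> (x + e *\<^sub>R n) \<le> n \<bullet> edge_start E" using e closure_subset by (intro le) blast
    moreover have "n \<bullet> n = 1" using n1 by (simp add: dot_square_norm)
    ultimately show ?thesis using e by (simp add: inner_simps)
  qed
  have "norm n = 1 \<and> (\<forall>x\<in>\<Omega>. n \<bullet> x < n \<bullet> edge_start E) \<and>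
     E = closure \<Omega> \<inter> {x. n \<bullet> x = n \<bullet> edge_start E}"
    by (intro conjI ballI n1 eq) (rule less)
  from someI[of "\<lambda>n. norm n = 1 \<and> (\<forall>x\<in>\<Omega>. n \<bullet> x < n \<bullet> edge_start E) \<and>
     E = closure \<Omega> \<inter> {x. n \<bullet> x = n \<bullet> edge_start E}", OF this, folded edge_normal_def]
  have N: "norm (edge_normal \<Omega> E) = 1" "\<forall>x\<in>\<Omega>. edge_normal \<Omega> E \<bullet> x < edge_normal \<Omega> E \<bullet> edge_start E"
    "E = closure \<Omega> \<inter> {x. edge_normal \<Omega> E \<bullet> x = edge_normal \<Omega> E \<bullet> edge_start E}" by blast+
  show "norm (edge_normal \<Omega> E) = 1" by (rule N)
  show "edge_normal \<Omega> E \<bullet> x < edge_normal \<Omega> E \<bullet> edge_start E" if "x \<in> \<Omega>" for x using N(2) that by blast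
  show "E = closure \<Omega> \<inter> {x. edge_normal \<Omega> E \<bullet> x = edge_normal \<Omega> E \<bullet> edge_start E}" by (rule N)
qed

lemma edge_subset_closure: "E \<in> polygon_edges \<Omega> \<Longrightarrow> E \<subseteq> closure \<Omega>"
  by (simp add: polygon_edges_def edge_of_def face_of_imp_subset)

lemma edge_supporting:
  assumes "E \<in> polygon_edges \<Omega>" "x \<in> E"
  shows "edge_normal \<Omega> E \<bullet> x = edge_normal \<Omega> E \<bullet> edge_start E"
  using edge_eq_supporting[OF assms(1)] assms(2) by blast

lemma edge_normal_le:
  assumes "E \<in> polygon_edges \<Omega>" "x \<in> closure \<Omega>"
  shows "edge_normal \<Omega> E \<bullet> x \<le> edge_normal \<Omega> E \<bullet> edge_start E"
proof -
  have "closure \<Omega> \<subseteq> {x. edge_normal \<Omega> E \<bullet> x \<le> edge_normal \<Omega> E \<bullet> edge_start E}"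
    using edge_normal_less[OF assms(1)] by (intro closure_minimal closed_halfspace_le) force
  then show ?thesis using assms by blast
qed

lemma normal_component_le:
  assumes "E \<in> polygon_edges \<Omega>"
  shows "\<bar>edge_normal \<Omega> E \<bullet> z\<bar> \<le> norm z"
  using Cauchy_Schwarz_ineq2[of "edge_normal \<Omega> E" z] norm_edge_normal[OF assms] by simp

lemma edge_point_in_edge:
  assumes E: "E \<in> polygon_edges \<Omega>"
  shows "0 \<le> s \<Longrightarrow> s \<le> 1 \<Longrightarrow> edge_point E s \<in> E"
    and "x \<in> E \<Longrightarrow> \<exists>s. 0 \<le> s \<and> s \<le> 1 \<and> x = edge_point E s"
proof -
  have ep: "edge_point E s = (1 - s) *\<^sub>R edge_start E + s *\<^sub>R edge_end E" for s
    by (simp add: edge_point_def edge_vector_def algebra_simps)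
  show "0 \<le> s \<Longrightarrow> s \<le> 1 \<Longrightarrow> edge_point E s \<in> E"
    unfolding edge_mem_iff[OF E] ep in_segment by blast
  show "x \<in> E \<Longrightarrow> \<exists>s. 0 \<le> s \<and> s \<le> 1 \<and> x = edge_point E s"
    unfolding edge_mem_iff[OF E] ep in_segment by blast
qed

lemma edge_normal_orthogonal:
  assumes E: "E \<in> polygon_edges \<Omega>"
  shows "edge_normal \<Omega> E \<bullet> edge_vector E = 0"
proof -
  show ?thesis using edge_supporting[OF E edge_ends(2)[OF E]] by (simp add: edge_vector_def inner_simps)
qed

lemma edge_normal_edge_point:
  assumes E: "E \<in> polygon_edges \<Omega>"
  shows "edge_normal \<Omega> E \<bullet> edge_point E s = edge_normal \<Omega> E \<bullet> edge_start E"
  using edge_normal_orthogonal[OF E] by (simp add: edge_point_def inner_simps)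

lemma edge_subset_frontier: "E \<in> polygon_edges \<Omega> \<Longrightarrow> E \<subseteq> frontier \<Omega>"
  using frontier_eq_Union_edges by blast

lemma orthogonal_edge_vector_parallel:
  assumes E: "E \<in> polygon_edges \<Omega>" and m: "m \<bullet> edge_vector E = 0"
  shows "m = (edge_normal \<Omega> E \<bullet> m) *\<^sub>R edge_normal \<Omega> E"
proof -
  let ?n = "edge_normal \<Omega> E" and ?d = "edge_vector E"
  have n: "norm ?n = 1" using E by (rule norm_edge_normal)
  have d: "?d = (perp ?n \<bullet> ?d) *\<^sub>R perp ?n"
    using perp_expand[OF n, of ?d] edge_normal_orthogonal[OF E] by simp
  have "perp ?n \<bullet> ?d \<noteq> 0" using d edge_segment(2)[OF E] by auto
  moreover have "(perp ?n \<bullet> ?d) * (perp ?n \<bullet> m) = 0" using m d by (metis inner_commute inner_scaleR_left)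
  ultimately have "perp ?n \<bullet> m = 0" by simp
  then show ?thesis using perp_expand[OF n, of m] by simp
qed

text \<open>
  A unit vector that supports \<open>\<Omega>\<close> at a point strictly between the ends of an edge must be orthogonal
  to the edge, since both ends lie in the half plane; so it is plus or minus the normal of the edge,
  and the sign is fixed by any point of \<open>\<Omega>\<close>.
\<close>

lemma outward_normal_edge_point:
  assumes E: "E \<in> polygon_edges \<Omega>" and s: "0 < s" "s < 1"
  shows "outward_normal \<Omega> (edge_point E s) = edge_normal \<Omega> E"
  unfolding outward_normal_def
proof (rule the_equality)
  let ?n = "edge_normal \<Omega> E" and ?p = "edge_point E s"
  have np: "?n \<bullet> (y - ?p) < 0" if "y \<in> \<Omega>" for y
    using edge_normal_less[OF E that] edge_normal_edge_point[OF E, of s] by (simp add: inner_simps)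
  then show "norm ?n = 1 \<and> (\<forall>y\<in>\<Omega>. ?n \<bullet> (y - ?p) \<le> 0)"
    using norm_edge_normal[OF E] by (auto intro: less_imp_le)
  fix m assume m: "norm m = 1 \<and> (\<forall>y\<in>\<Omega>. m \<bullet> (y - ?p) \<le> 0)"
  have "closure \<Omega> \<subseteq> {y. m \<bullet> y \<le> m \<bullet> ?p}"
    using m by (intro closure_minimal closed_halfspace_le) (auto simp: inner_simps)
  moreover have "edge_start E \<in> closure \<Omega>" "edge_end E \<in> closure \<Omega>"
    using edge_subset_closure[OF E] edge_ends[OF E] by blast+
  ultimately have "m \<bullet> edge_start E \<le> m \<bullet> ?p" "m \<bullet> edge_end E \<le> m \<bullet> ?p" by blast+
  moreover have "edge_end E = edge_start E + edge_vector E" by (simp add: edge_vector_def)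
  ultimately have "0 \<le> s * (m \<bullet> edge_vector E)" "(1 - s) * (m \<bullet> edge_vector E) \<le> 0"
    by (auto simp: edge_point_def inner_simps algebra_simps)
  then have "m \<bullet> edge_vector E = 0" using s by (auto simp: zero_le_mult_iff mult_le_0_iff)
  then have mn: "m = (?n \<bullet> m) *\<^sub>R ?n" by (rule orthogonal_edge_vector_parallel[OF E])
  obtain y where y: "y \<in> \<Omega>" using polygon_nonempty by blast
  have "(?n \<bullet> m) * (?n \<bullet> (y - ?p)) \<le> 0" using m y mn by (metis inner_scaleR_left)
  then have "0 \<le> ?n \<bullet> m" using np[OF y] by (auto simp: mult_le_0_iff)
  moreover have "\<bar>?n \<bullet> m\<bar> = 1" using m mn norm_edge_normal[OF E] by (metis mult.right_neutral norm_scaleR)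
  ultimately have c: "?n \<bullet> m = 1" by linarith
  show "m = ?n" using mn[unfolded c] by simp
qed

text \<open>
  If both ends of \<open>E\<close> were on the supporting line of \<open>F\<close>, the two normals would be parallel. They cannot
  be opposite, because \<open>\<Omega>\<close> is nonempty; so they agree and the two edges are the same face. This is the
  reason why \<open>E\<close> stays away from that line except near a common vertex.
\<close>

lemma distinct_edges_gap:
  assumes E: "E \<in> polygon_edges \<Omega>" and F: "F \<in> polygon_edges \<Omega>" and ne: "E \<noteq> F"
    and st: "edge_normal \<Omega> F \<bullet> edge_start E = edge_normal \<Omega> F \<bullet> edge_start F"
    and en: "edge_normal \<Omega> F \<bullet> edge_end E = edge_normal \<Omega> F \<bullet> edge_start F"
  shows False
proof -
  let ?n = "edge_normal \<Omega> E" and ?m = "edge_normal \<Omega> F"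
  have "?m \<bullet> edge_vector E = 0" using st en by (simp add: edge_vector_def inner_simps)
  then have mn: "?m = (?n \<bullet> ?m) *\<^sub>R ?n" by (rule orthogonal_edge_vector_parallel[OF E])
  have ab: "\<bar>?n \<bullet> ?m\<bar> = 1"
    using mn norm_edge_normal[OF E] norm_edge_normal[OF F] by (metis mult.right_neutral norm_scaleR)
  obtain y where y: "y \<in> \<Omega>" using polygon_nonempty by blast
  have "?m \<bullet> y < ?m \<bullet> edge_start E" "?n \<bullet> y < ?n \<bullet> edge_start E"
    using edge_normal_less[OF E y] edge_normal_less[OF F y] st by auto
  moreover have "?m = - ?n" if c: "?n \<bullet> ?m = -1" using mn[unfolded c] by simp
  ultimately have "?n \<bullet> ?m \<noteq> -1" by fastforce
  then have c: "?n \<bullet> ?m = 1" using ab by linarith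
  have "?m = ?n" using mn[unfolded c] by simp
  have "E = closure \<Omega> \<inter> {x. ?n \<bullet> x = ?n \<bullet> edge_start E}" by (rule edge_eq_supporting[OF E])
  also have "\<dots> = closure \<Omega> \<inter> {x. ?m \<bullet> x = ?m \<bullet> edge_start F}"
    using st \<open>?m = ?n\<close> by simp
  also have "\<dots> = F" by (rule edge_eq_supporting[OF F, symmetric])
  finally have "E = F" .
  with ne show False by (rule notE)
qed

section \<open>Exit strips\<close>

text \<open>
  \<open>\<Omega>\<close> is the intersection of the open half planes of its edges: the segment to \<open>x\<close> from
  a point of \<open>\<Omega>\<close> meets the frontier in some edge, and beyond it stays beyond its line.
\<close>

lemma outside_supporting_half_plane:
  assumes "x \<notin> \<Omega>"
  shows "\<exists>E\<in>polygon_edges \<Omega>. edge_normal \<Omega> E \<bullet> edge_start E \<le> edge_normal \<Omega> E \<bullet> x"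
proof -
  obtain y where y: "y \<in> \<Omega>" using polygon_nonempty by blast
  obtain t where t: "0 \<le> t" "t \<le> 1" and q: "y + t *\<^sub>R (x - y) \<in> frontier \<Omega>"
    using frontier_crossing[OF y assms] by blast
  then obtain E where E: "E \<in> polygon_edges \<Omega>" "y + t *\<^sub>R (x - y) \<in> E" using frontier_eq_Union_edges by blast
  let ?n = "edge_normal \<Omega> E"
  have nq: "?n \<bullet> (y + t *\<^sub>R (x - y)) = ?n \<bullet> edge_start E" using E by (intro edge_supporting)
  have ny: "?n \<bullet> y < ?n \<bullet> edge_start E" by (rule edge_normal_less[OF E(1) y])
  have "?n \<bullet> edge_start E \<le> ?n \<bullet> x"
  proof (rule ccontr)
    assume "\<not> ?thesis"
    then have "(1 - t) * (?n \<bullet> y) + t * (?n \<bullet> x) < ?n \<bullet> edge_start E"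
      using convex_bound_lt[OF ny, of "?n \<bullet> x" "1 - t" t] t by simp
    then show False using nq by (simp add: inner_simps algebra_simps)
  qed
  then show ?thesis using E by blast
qed

lemma exit_through_edge:
  assumes x: "x \<in> \<Omega>" and xz: "x + z \<notin> closure \<Omega>"
  obtains E t where "E \<in> polygon_edges \<Omega>" "0 < t" "t < 1" "x + t *\<^sub>R z \<in> E" "0 < edge_normal \<Omega> E \<bullet> z"
proof -
  have "x + z \<notin> \<Omega>" using xz closure_subset by blast
  then obtain t where t: "0 \<le> t" "t \<le> 1" and "x + t *\<^sub>R (x + z - x) \<in> frontier \<Omega>"
    using frontier_crossing[OF x] by blast
  then have q: "x + t *\<^sub>R z \<in> frontier \<Omega>" by simp
  have "t \<noteq> 0" "t \<noteq> 1" using q assms unfolding polygon_frontier by auto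
  then have t': "0 < t" "t < 1" using t by auto
  obtain E where E: "E \<in> polygon_edges \<Omega>" "x + t *\<^sub>R z \<in> E" using q frontier_eq_Union_edges by blast
  let ?n = "edge_normal \<Omega> E"
  have "?n \<bullet> (x + t *\<^sub>R z) = ?n \<bullet> edge_start E" using E by (intro edge_supporting)
  then have "0 < t * (?n \<bullet> z)" using edge_normal_less[OF E(1) x] by (simp add: inner_simps)
  then have "0 < ?n \<bullet> z" using t' by (simp add: zero_less_mult_iff)
  then show ?thesis using that E t' by blast
qed

text \<open>
  Moving on by \<open>z\<close>, a common point of two strips reaches both edges, and it cannot reach one strictly
  before the other because it would then be outside the closed polygon. So it reaches a common point of
  the relative interiors, which different edges do not have.
\<close>

lemma exit_strips_disjoint:
  assumes E: "E \<in> polygon_edges \<Omega>" "0 < edge_normal \<Omega> E \<bullet> z"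
    and F: "F \<in> polygon_edges \<Omega>" "0 < edge_normal \<Omega> F \<bullet> z"
    and x: "x \<in> exit_strip E z" "x \<in> exit_strip F z"
  shows "E = F"
proof (rule ccontr)
  assume ne: "E \<noteq> F"
  obtain s t where s: "0 < s" "s < 1" "x = edge_point E s - t *\<^sub>R z" using x(1) by (auto simp: exit_strip_def)
  obtain s' t' where s': "0 < s'" "s' < 1" "x = edge_point F s' - t' *\<^sub>R z" using x(2) by (auto simp: exit_strip_def)
  have sub: "edge_point E s \<in> closure \<Omega>" "edge_point F s' \<in> closure \<Omega>"
    using edge_point_in_edge(1)[OF E(1), of s] edge_point_in_edge(1)[OF F(1), of s'] s s'
      edge_subset_closure[OF E(1)] edge_subset_closure[OF F(1)] by auto
  have pp: "edge_point F s' = edge_point E s + (t' - t) *\<^sub>R z"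
    using s(3) s'(3) by (simp add: algebra_simps)
  \<comment> \<open>Neither point of the closed polygon can be beyond the supporting line of the other.\<close>
  have "(t' - t) * (edge_normal \<Omega> E \<bullet> z) \<le> 0"
    using edge_normal_le[OF E(1) sub(2)] edge_normal_edge_point[OF E(1), of s] unfolding pp by (simp add: inner_simps)
  moreover have "0 \<le> (t' - t) * (edge_normal \<Omega> F \<bullet> z)"
    using edge_normal_le[OF F(1) sub(1)] edge_normal_edge_point[OF F(1), of s'] unfolding pp by (simp add: inner_simps)
  ultimately have "t' = t" using E(2) F(2) by (auto simp: zero_le_mult_iff mult_le_0_iff)
  then have p: "edge_point F s' = edge_point E s" using pp by simp
  let ?m = "edge_normal \<Omega> F"
  have ends: "edge_start E \<in> closure \<Omega>" "edge_end E \<in> closure \<Omega>"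
    using edge_subset_closure[OF E(1)] edge_ends[OF E(1)] by blast+
  have le: "?m \<bullet> edge_start E \<le> ?m \<bullet> edge_start F" "?m \<bullet> edge_end E \<le> ?m \<bullet> edge_start F"
    using edge_normal_le[OF F(1) ends(1)] edge_normal_le[OF F(1) ends(2)] by auto
  have "?m \<bullet> edge_start F = ?m \<bullet> edge_point E s" using edge_normal_edge_point[OF F(1), of s'] unfolding p by (rule sym)
  also have "\<dots> = (1 - s) * (?m \<bullet> edge_start E) + s * (?m \<bullet> edge_end E)"
    by (simp add: edge_point_def edge_vector_def inner_simps algebra_simps)
  finally have sum: "(1 - s) * (?m \<bullet> edge_start F - ?m \<bullet> edge_start E) + s * (?m \<bullet> edge_start F - ?m \<bullet> edge_end E) = 0"
    by (simp add: algebra_simps)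
  have "0 \<le> (1 - s) * (?m \<bullet> edge_start F - ?m \<bullet> edge_start E)" "0 \<le> s * (?m \<bullet> edge_start F - ?m \<bullet> edge_end E)"
    using le s by auto
  then have "(1 - s) * (?m \<bullet> edge_start F - ?m \<bullet> edge_start E) = 0" "s * (?m \<bullet> edge_start F - ?m \<bullet> edge_end E) = 0"
    using sum by linarith+
  then have "?m \<bullet> edge_start E = ?m \<bullet> edge_start F" "?m \<bullet> edge_end E = ?m \<bullet> edge_start F"
    using s(1,2) by auto
  then show False by (rule distinct_edges_gap[OF E(1) F(1) ne])
qed

lemma exit_strip_leaves:
  assumes E: "E \<in> polygon_edges \<Omega>" "0 < edge_normal \<Omega> E \<bullet> z" and t: "t < 1"
  shows "edge_point E s - t *\<^sub>R z + z \<notin> closure \<Omega>"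
proof
  assume "edge_point E s - t *\<^sub>R z + z \<in> closure \<Omega>"
  then have "edge_normal \<Omega> E \<bullet> (edge_point E s - t *\<^sub>R z + z) \<le> edge_normal \<Omega> E \<bullet> edge_start E"
    by (rule edge_normal_le[OF E(1)])
  moreover have "edge_normal \<Omega> E \<bullet> (edge_point E s - t *\<^sub>R z + z)
      = edge_normal \<Omega> E \<bullet> edge_start E + (1 - t) * (edge_normal \<Omega> E \<bullet> z)"
    using edge_normal_edge_point[OF E(1), of s] by (simp add: inner_diff_right inner_add_right left_diff_distrib)
  moreover have "0 < (1 - t) * (edge_normal \<Omega> E \<bullet> z)" using E(2) t by simp
  ultimately show False by linarith
qed

text \<open>
  The parameters of the points of \<open>E\<close> that are within distance \<open>\<epsilon>\<close> of the supporting line of another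
  edge. A point of the strip of \<open>E\<close> can lie outside \<open>\<Omega>\<close> only above such a parameter, with
  \<open>\<epsilon> = norm z\<close>.
\<close>

definition corner_parameters :: "(real^2) set \<Rightarrow> real \<Rightarrow> real set" where
  "corner_parameters E \<epsilon> = {s. 0 < s \<and> s < 1 \<and> (\<exists>F\<in>polygon_edges \<Omega> - {E}.
      edge_normal \<Omega> F \<bullet> edge_start F - \<epsilon> \<le> edge_normal \<Omega> F \<bullet> edge_point E s)}"

lemma exit_strip_outside_corner:
  assumes E: "E \<in> polygon_edges \<Omega>" "0 < edge_normal \<Omega> E \<bullet> z" and st: "0 < s" "s < 1" "0 < t" "t < 1"
    and out: "edge_point E s - t *\<^sub>R z \<notin> \<Omega>"
  shows "s \<in> corner_parameters E (norm z)"
proof -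
  obtain F where F: "F \<in> polygon_edges \<Omega>"
    "edge_normal \<Omega> F \<bullet> edge_start F \<le> edge_normal \<Omega> F \<bullet> (edge_point E s - t *\<^sub>R z)"
    using outside_supporting_half_plane[OF out] by blast
  have "F \<noteq> E"
  proof
    assume "F = E"
    then have "t * (edge_normal \<Omega> E \<bullet> z) \<le> 0"
      using F edge_normal_edge_point[OF E(1), of s] by (simp add: inner_simps)
    then show False using E st by (simp add: mult_le_0_iff)
  qed
  have "- (t * (edge_normal \<Omega> F \<bullet> z)) \<le> \<bar>t\<bar> * \<bar>edge_normal \<Omega> F \<bullet> z\<bar>"
    by (metis abs_ge_minus_self abs_mult)
  also have "\<dots> \<le> 1 * norm z"
    using st normal_component_le[OF F(1), of z] by (intro mult_mono) auto
  finally have "edge_normal \<Omega> F \<bullet> edge_start F - norm z \<le> edge_normal \<Omega> F \<bullet> edge_point E s"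
    using F(2) by (simp add: inner_simps)
  then show ?thesis unfolding corner_parameters_def using F \<open>F \<noteq> E\<close> st by blast
qed

lemma
  shows corner_parameters_borel: "corner_parameters E \<epsilon> \<in> sets borel"
    and measure_corner_parameters: "\<exists>K\<ge>0. \<forall>E\<in>polygon_edges \<Omega>. \<forall>\<epsilon>\<ge>0. measure lborel (corner_parameters E \<epsilon>) \<le> K * \<epsilon>"
proof -
  let ?n = "edge_normal \<Omega>"
  define B where "B E F \<epsilon> = {s. 0 < s \<and> s < 1 \<and> ?n F \<bullet> edge_start F - \<epsilon> \<le> ?n F \<bullet> edge_point E s}" for E F \<epsilon>
  have cpB: "corner_parameters E \<epsilon> = (\<Union>F\<in>polygon_edges \<Omega> - {E}. B E F \<epsilon>)" for E \<epsilon>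
    by (auto simp: corner_parameters_def B_def)
  have Bb[measurable]: "B E F \<epsilon> \<in> sets borel" for E F \<epsilon>
    unfolding B_def edge_point_def by measurable
  show "corner_parameters E \<epsilon> \<in> sets borel" for E \<epsilon>
    unfolding cpB using polygon_finite_edges by (intro sets.finite_UN) auto
  \<comment> \<open>For fixed edges the distance to the line of \<open>F\<close> is affine along \<open>E\<close>; its maximum is at an end.\<close>
  define k where "k E F = 1 / max (?n F \<bullet> edge_start F - ?n F \<bullet> edge_start E) (?n F \<bullet> edge_start F - ?n F \<bullet> edge_end E)" for E F
  have ends: "edge_start E \<in> closure \<Omega>" "edge_end E \<in> closure \<Omega>" if E: "E \<in> polygon_edges \<Omega>" for E
    using edge_subset_closure[OF E] edge_ends[OF E] by blast+
  have gaps: "0 \<le> ?n F \<bullet> edge_start F - ?n F \<bullet> edge_start E" "0 \<le> ?n F \<bullet> edge_start F - ?n F \<bullet> edge_end E"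
    if "E \<in> polygon_edges \<Omega>" "F \<in> polygon_edges \<Omega>" for E F
    using edge_normal_le[OF that(2) ends(1)[OF that(1)]] edge_normal_le[OF that(2) ends(2)[OF that(1)]] by auto
  have k0: "0 \<le> k E F" if "E \<in> polygon_edges \<Omega>" "F \<in> polygon_edges \<Omega>" for E F
    using gaps[OF that] by (simp add: k_def)
  have one: "measure lborel (B E F \<epsilon>) \<le> k E F * \<epsilon>"
    if "E \<in> polygon_edges \<Omega>" "F \<in> polygon_edges \<Omega> - {E}" "0 \<le> \<epsilon>" for E F \<epsilon>
  proof -
    let ?a = "?n F \<bullet> edge_start F - ?n F \<bullet> edge_start E" and ?b = "?n F \<bullet> edge_start F - ?n F \<bullet> edge_end E"
    have "B E F \<epsilon> = {s. 0 < s \<and> s < 1 \<and> (1 - s) * ?a + s * ?b \<le> \<epsilon>}"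
    proof -
      have eq: "(1 - s) * ?a + s * ?b = ?n F \<bullet> edge_start F - ?n F \<bullet> edge_point E s" for s
        unfolding edge_point_def edge_vector_def by (simp add: inner_simps algebra_simps)
      show ?thesis unfolding B_def eq by (intro Collect_cong conj_cong refl) linarith
    qed
    moreover have "0 < max ?a ?b"
    proof (rule ccontr)
      assume "\<not> 0 < max ?a ?b"
      then have "?a = 0" "?b = 0" using gaps[of E F] that by auto
      then have st: "?n F \<bullet> edge_start E = ?n F \<bullet> edge_start F" "?n F \<bullet> edge_end E = ?n F \<bullet> edge_start F" by linarith+
      have "F \<in> polygon_edges \<Omega>" "E \<noteq> F" using that(2) by blast+
      then show False using distinct_edges_gap[OF that(1) _ _ st] by blast
    qed
    ultimately have "measure lborel (B E F \<epsilon>) \<le> \<epsilon> / max ?a ?b"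
      using measure_affine_sublevel[of ?a ?b \<epsilon>] gaps[of E F] that by simp
    then show ?thesis by (simp add: k_def)
  qed
  let ?K = "\<Sum>E\<in>polygon_edges \<Omega>. \<Sum>F\<in>polygon_edges \<Omega>. k E F"
  have "measure lborel (corner_parameters E \<epsilon>) \<le> ?K * \<epsilon>" if E: "E \<in> polygon_edges \<Omega>" and e: "0 \<le> \<epsilon>" for E \<epsilon>
  proof -
    have "measure lborel (corner_parameters E \<epsilon>) \<le> (\<Sum>F\<in>polygon_edges \<Omega> - {E}. measure lborel (B E F \<epsilon>))"
      unfolding cpB
    proof (rule measure_UNION_le)
      show "finite (polygon_edges \<Omega> - {E})" using polygon_finite_edges by simp
    qed simp
    also have "\<dots> \<le> (\<Sum>F\<in>polygon_edges \<Omega> - {E}. k E F * \<epsilon>)" using E e one by (intro sum_mono) auto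
    also have "\<dots> = (\<Sum>F\<in>polygon_edges \<Omega> - {E}. k E F) * \<epsilon>" by (simp add: sum_distrib_right)
    also have "\<dots> \<le> (\<Sum>F\<in>polygon_edges \<Omega>. k E F) * \<epsilon>"
      using e E k0 polygon_finite_edges by (intro mult_right_mono sum_mono2) auto
    also have "\<dots> \<le> ?K * \<epsilon>"
      using e E k0 polygon_finite_edges
      by (intro mult_right_mono member_le_sum[of E "polygon_edges \<Omega>" "\<lambda>E. \<Sum>F\<in>polygon_edges \<Omega>. k E F"] sum_nonneg) auto
    finally show ?thesis .
  qed
  moreover have "0 \<le> ?K" using k0 by (intro sum_nonneg) auto
  ultimately show "\<exists>K\<ge>0. \<forall>E\<in>polygon_edges \<Omega>. \<forall>\<epsilon>\<ge>0. measure lborel (corner_parameters E \<epsilon>) \<le> K * \<epsilon>" by blast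
qed

end

lemma C1_on_imp_continuous_on:
  fixes f :: "'a::real_normed_vector \<Rightarrow> 'b::real_normed_vector"
  assumes "C1_on f S" shows "continuous_on S f"
proof (rule continuous_at_imp_continuous_on, rule ballI)
  fix x assume "x \<in> S"
  with assms obtain D where "(f has_derivative D) (at x)" unfolding C1_on_def by blast
  then show "isCont f x" by (rule has_derivative_continuous)
qed

section \<open>Uniform bounds near the boundary\<close>

text \<open>
  The radius is halved to obtain a compact neighbourhood of \<open>K\<close>, where the function and its derivative are
  bounded. The Lipschitz bound is stated on balls around points of \<open>K\<close> because the mean value
  inequality needs convexity, which the neighbourhood does not have.
\<close>

lemma C1_on_collar_bounds:
  fixes f :: "'a::euclidean_space \<Rightarrow> 'b::real_normed_vector"
  assumes f: "C1_on f {x. infdist x K < r}" and K: "compact K" "K \<noteq> {}" and r: "0 < r"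
  obtains M where "0 \<le> M" "\<And>p x. p \<in> K \<Longrightarrow> x \<in> ball p (r/2) \<Longrightarrow> norm (f x) \<le> M"
    "\<And>p x y. p \<in> K \<Longrightarrow> x \<in> ball p (r/2) \<Longrightarrow> y \<in> ball p (r/2) \<Longrightarrow> norm (f x - f y) \<le> M * norm (x - y)"
proof -
  obtain f' where f': "\<And>x. infdist x K < r \<Longrightarrow> (f has_derivative blinfun_apply (f' x)) (at x)"
    and cont: "continuous_on {x. infdist x K < r} f'"
    using f unfolding C1_on_def mem_Collect_eq by (elim exE conjE) blast
  let ?L = "{x. infdist x K \<le> r/2}"
  have L: "compact ?L" using K r by (intro compact_infdist_le) auto
  have sub: "?L \<subseteq> {x. infdist x K < r}" using r by auto
  have "continuous_on ?L f'" by (rule continuous_on_subset[OF cont sub])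
  then have "bounded (f' ` ?L)" by (intro compact_imp_bounded compact_continuous_image L)
  then obtain M1 where M1': "\<forall>y\<in>f' ` ?L. norm y \<le> M1" unfolding bounded_iff ..
  have M1: "norm (f' x) \<le> M1" if "x \<in> ?L" for x by (rule bspec[OF M1' imageI[OF that]])
  have "continuous_on ?L f" by (rule continuous_on_subset[OF C1_on_imp_continuous_on[OF f] sub])
  then have "bounded (f ` ?L)" by (intro compact_imp_bounded compact_continuous_image L)
  then obtain M2 where M2': "\<forall>y\<in>f ` ?L. norm y \<le> M2" unfolding bounded_iff ..
  have M2: "norm (f x) \<le> M2" if "x \<in> ?L" for x by (rule bspec[OF M2' imageI[OF that]])
  have ballL: "x \<in> ?L" if "p \<in> K" "x \<in> ball p (r/2)" for p x
  proof -
    have "infdist x K \<le> dist x p" by (rule infdist_le[OF that(1)])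
    also have "\<dots> \<le> r/2" using that(2) by (simp add: dist_commute[of x p])
    finally show ?thesis by simp
  qed
  define M where "M = max 0 (max M1 M2)"
  have "norm (f x) \<le> M" if "p \<in> K" "x \<in> ball p (r/2)" for p x
    using M2[OF ballL[OF that]] by (simp add: M_def)
  moreover have "norm (f x - f y) \<le> M * norm (x - y)" if p: "p \<in> K" "x \<in> ball p (r/2)" "y \<in> ball p (r/2)" for p x y
  proof (rule differentiable_bound[OF convex_ball])
    fix w assume w: "w \<in> ball p (r/2)"
    have wL: "w \<in> ?L" by (rule ballL[OF p(1) w])
    then have "infdist w K < r" using sub by blast
    then show "(f has_derivative blinfun_apply (f' w)) (at w within ball p (r/2))"
      by (rule has_derivative_at_withinI[OF f'])
    have "norm (f' w) \<le> M" using M1[OF wL] by (simp add: M_def)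
    then show "onorm (blinfun_apply (f' w)) \<le> M" unfolding norm_blinfun.rep_eq .
  qed (rule p)+
  moreover have "0 \<le> M" by (simp add: M_def)
  ultimately show ?thesis by (intro that[of M])
qed

lemma C2_on_imp_C1_on:
  fixes f :: "'a::real_normed_vector \<Rightarrow> 'b::real_normed_vector"
  assumes "C2_on f S" shows "C1_on f S"
proof -
  obtain f' where f': "\<And>x. x \<in> S \<Longrightarrow> (f has_derivative blinfun_apply (f' x)) (at x)" "C1_on f' S"
    using assms unfolding C2_on_def by blast
  have "continuous_on S f'" by (rule C1_on_imp_continuous_on[OF f'(2)])
  then show ?thesis unfolding C1_on_def by (intro exI[of _ f'] conjI ballI f'(1))
qed

text \<open>
  Mean value inequality for \<open>u\<close> minus its linear part at \<open>p\<close>, whose derivative is at most \<open>M * \<rho>\<close> on the ball.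
\<close>

lemma linearization_error:
  fixes u :: "'a::real_normed_vector \<Rightarrow> real" and u' :: "'a \<Rightarrow> 'a \<Rightarrow>\<^sub>L real"
  assumes d: "\<And>w. w \<in> ball p \<rho> \<Longrightarrow> (u has_derivative blinfun_apply (u' w)) (at w)"
    and lip: "\<And>w. w \<in> ball p \<rho> \<Longrightarrow> norm (u' w - u' p) \<le> M * norm (w - p)" and M: "0 \<le> M"
    and x: "x \<in> ball p \<rho>" and y: "y \<in> ball p \<rho>"
  shows "\<bar>u y - u x - blinfun_apply (u' p) (y - x)\<bar> \<le> M * \<rho> * norm (y - x)"
proof -
  have "norm ((u y - blinfun_apply (u' p) y) - (u x - blinfun_apply (u' p) x)) \<le> M * \<rho> * norm (y - x)"
  proof (rule differentiable_bound[OF convex_ball, where x=y and y=x])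
    fix w assume w: "w \<in> ball p \<rho>"
    show "((\<lambda>w. u w - blinfun_apply (u' p) w) has_derivative blinfun_apply (u' w - u' p)) (at w within ball p \<rho>)"
    proof -
      have "((\<lambda>w. u w - blinfun_apply (u' p) w) has_derivative (\<lambda>h. blinfun_apply (u' w) h - blinfun_apply (u' p) h)) (at w)"
        by (intro has_derivative_diff d[OF w] bounded_linear_imp_has_derivative blinfun.bounded_linear_right)
      moreover have "blinfun_apply (u' w - u' p) = (\<lambda>h. blinfun_apply (u' w) h - blinfun_apply (u' p) h)"
        by (rule ext) (rule blinfun.diff_left)
      ultimately show ?thesis by (simp only: has_derivative_at_withinI)
    qed
    have "norm (u' w - u' p) \<le> M * norm (w - p)" by (rule lip[OF w])
    also have "\<dots> \<le> M * \<rho>"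
      using w M by (intro mult_left_mono) (simp_all add: dist_norm norm_minus_commute[of p w])
    finally show "onorm (blinfun_apply (u' w - u' p)) \<le> M * \<rho>" unfolding norm_blinfun.rep_eq .
  qed (rule x y)+
  moreover have "u y - u x - blinfun_apply (u' p) (y - x)
      = (u y - blinfun_apply (u' p) y) - (u x - blinfun_apply (u' p) x)"
    unfolding blinfun.diff_right by simp
  ultimately show ?thesis by (simp only: real_norm_def)
qed

section \<open>Integrals over the exit set\<close>

lemma unit_square_fst:
  fixes \<phi> :: "real \<Rightarrow> real"
  assumes [measurable]: "\<phi> \<in> borel_measurable borel" and b: "\<And>s. 0 < s \<Longrightarrow> s < 1 \<Longrightarrow> \<bar>\<phi> s\<bar> \<le> b"
  shows "integrable lborel (\<lambda>p :: real \<times> real. indicator ({0<..<1} \<times> {0<..<1}) p * \<phi> (fst p))"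
    and "(\<integral>p. indicator ({0<..<1} \<times> {0<..<1}) (p :: real \<times> real) * \<phi> (fst p) \<partial>lborel) = (\<integral>s. indicator {0<..<1} s * \<phi> s \<partial>lborel)"
proof -
  let ?Q = "{0<..<1::real} \<times> {0<..<1::real}"
  have Q: "?Q = box (0,0) (1,1)" by (auto simp: box_def Basis_prod_def)
  have [measurable]: "?Q \<in> sets borel" unfolding Q by simp
  have "fst \<in> borel_measurable (borel :: (real \<times> real) measure)"
    by (intro borel_measurable_continuous_onI continuous_intros)
  then have [measurable]: "(\<lambda>p::real\<times>real. \<phi> (fst p)) \<in> borel_measurable borel"
    by (rule measurable_compose) (rule assms(1))
  show i: "integrable lborel (\<lambda>p. indicator ?Q p * \<phi> (fst p))"
  proof (rule integrableI_bounded_set[where A="?Q" and B=b])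
    show "emeasure lborel ?Q < \<infinity>" unfolding Q by (simp add: emeasure_lborel_box_eq)
    show "(\<lambda>p. indicator ?Q p * \<phi> (fst p)) \<in> borel_measurable lborel"
      by measurable
  qed (use b in auto)
  then have "(\<integral>p. indicator ?Q p * \<phi> (fst p) \<partial>lborel)
      = (\<integral>s. (\<integral>t. indicator ?Q (s, t) * \<phi> s \<partial>lborel) \<partial>lborel)"
    unfolding lborel_prod[symmetric] by (subst lborel_pair.integral_fst'[symmetric]) auto
  also have "\<dots> = (\<integral>s. indicator {0<..<1} s * \<phi> s \<partial>lborel)"
  proof (rule Bochner_Integration.integral_cong)
    fix s :: real
    have "(\<lambda>t. indicator ?Q (s, t) * \<phi> s) = (\<lambda>t. (indicator {0<..<1} s * \<phi> s) * indicator {0<..<1} t)"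
      by (auto simp: indicator_def)
    then show "(\<integral>t. indicator ?Q (s, t) * \<phi> s \<partial>lborel) = indicator {0<..<1} s * \<phi> s"
      by simp
  qed simp
  finally show "(\<integral>p. indicator ?Q p * \<phi> (fst p) \<partial>lborel) = (\<integral>s. indicator {0<..<1} s * \<phi> s \<partial>lborel)" .
qed

text \<open>
  Used for the lines through the vertices in direction \<open>z\<close>, the part of the exit set that the open
  strips miss.
\<close>

lemma AE_not_on_line:
  fixes z a :: "real^2" assumes "z \<noteq> 0"
  shows "AE x in lborel. cross2 x z \<noteq> cross2 a z"
proof -
  have p: "perp z \<bullet> x = - cross2 x z" for x
    by (simp add: perp_def cross2_def inner_vec_def sum_2 vector_2 algebra_simps)
  have "perp z \<noteq> 0" using assms perp_simps(1)[of z] by (metis norm_eq_zero)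
  then have "negligible {x. perp z \<bullet> x = perp z \<bullet> a}" by (intro negligible_hyperplane) auto
  then have "AE x in lebesgue. x \<notin> {x. perp z \<bullet> x = perp z \<bullet> a}"
    unfolding negligible_iff_null_sets by (rule AE_not_in)
  then show ?thesis unfolding AE_completion_iff p by simp
qed

definition exit_set :: "(real^2) set \<Rightarrow> real^2 \<Rightarrow> (real^2) set" where
  "exit_set \<Omega> z = {x \<in> \<Omega>. x + z \<notin> closure \<Omega>}"

context
  fixes \<Omega> :: "(real^2) set" and E :: "(real^2) set" and z :: "real^2"
  assumes polygon: "convex_polygon \<Omega>" and E: "E \<in> polygon_edges \<Omega>" and out: "0 < edge_normal \<Omega> E \<bullet> z"
begin

text \<open>
  The area element of the strip in the parameters \<open>(s, t)\<close> of \<open>edge_point E s - t *\<^sub>R z\<close>.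
\<close>

lemma strip_jacobian: "\<bar>cross2 (edge_vector E) (- z)\<bar> = norm (edge_vector E) * (edge_normal \<Omega> E \<bullet> z)"
  using abs_cross2_normal[OF norm_edge_normal[OF polygon E] edge_normal_orthogonal[OF polygon E], of "-z"] out
  by simp

lemma strip_jacobian_nonzero: "cross2 (edge_vector E) (- z) \<noteq> 0" "cross2 (edge_vector E) z \<noteq> 0"
proof -
  show *: "cross2 (edge_vector E) (- z) \<noteq> 0"
  proof
    assume "cross2 (edge_vector E) (- z) = 0"
    then have "norm (edge_vector E) * (edge_normal \<Omega> E \<bullet> z) = 0" using strip_jacobian by (simp only: abs_zero)
    then show False using out edge_segment(2)[OF polygon E] by simp
  qed
  then show "cross2 (edge_vector E) z \<noteq> 0" by (simp add: cross2_def algebra_simps)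
qed

text \<open>
  Cramer's rule for the two parameters of a point of the strip; it makes measurability evident.
\<close>

lemma exit_strip_coordinates:
  "exit_strip E z = {x. cross2 (x - edge_start E) z / cross2 (edge_vector E) z \<in> {0<..<1} \<and>
      cross2 (x - edge_start E) (edge_vector E) / cross2 (edge_vector E) z \<in> {0<..<1}}"
proof -
  let ?d = "edge_vector E" and ?c = "cross2 (edge_vector E) z"
  note nz = strip_jacobian_nonzero(2)
  show ?thesis
  proof (intro set_eqI iffI)
    fix x assume "x \<in> exit_strip E z"
    then obtain s t where st: "0 < s" "s < 1" "0 < t" "t < 1" and x: "x = edge_point E s - t *\<^sub>R z"
      by (auto simp: exit_strip_def)
    have "cross2 (x - edge_start E) z = s * ?c" "cross2 (x - edge_start E) ?d = t * ?c"
      unfolding x by (simp_all add: cross2_def edge_point_def algebra_simps)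
    then show "x \<in> {x. cross2 (x - edge_start E) z / ?c \<in> {0<..<1} \<and> cross2 (x - edge_start E) ?d / ?c \<in> {0<..<1}}"
      using nz st by simp
  next
    fix x assume x: "x \<in> {x. cross2 (x - edge_start E) z / ?c \<in> {0<..<1} \<and> cross2 (x - edge_start E) ?d / ?c \<in> {0<..<1}}"
    define s t where "s = cross2 (x - edge_start E) z / ?c" and "t = cross2 (x - edge_start E) ?d / ?c"
    have s: "s * ?c = cross2 (x - edge_start E) z" and t: "t * ?c = cross2 (x - edge_start E) ?d"
      using nz by (simp_all add: s_def t_def)
    define y where "y = x - edge_start E"
    have "?c * y$1 = cross2 y z * ?d$1 - cross2 y ?d * z$1" "?c * y$2 = cross2 y z * ?d$2 - cross2 y ?d * z$2"
      unfolding cross2_def by algebra+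
    then have "?c * y$1 = ?c * (s * ?d$1 - t * z$1)" "?c * y$2 = ?c * (s * ?d$2 - t * z$2)"
      unfolding y_def s[symmetric] t[symmetric] by (simp_all add: algebra_simps)
    then have "y$1 = s * ?d$1 - t * z$1" "y$2 = s * ?d$2 - t * z$2" using nz by auto
    then have "y = s *\<^sub>R ?d - t *\<^sub>R z" by (simp add: vec_eq_iff forall_2)
    then have "x = edge_point E s - t *\<^sub>R z" by (simp add: y_def edge_point_def algebra_simps)
    moreover have "0 < s" "s < 1" "0 < t" "t < 1" using x by (auto simp: s_def t_def)
    ultimately show "x \<in> exit_strip E z" unfolding exit_strip_def by blast
  qed
qed

lemma exit_strip_borel: "exit_strip E z \<in> sets borel"
proof -
  have [measurable]: "(\<lambda>x. cross2 (x - a) b) \<in> borel_measurable borel" for a b :: "real^2"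
    unfolding cross2_def by (intro borel_measurable_continuous_onI continuous_intros)
  show ?thesis unfolding exit_strip_coordinates by measurable
qed

lemma exit_strip_parameters:
  "edge_start E + fst p *\<^sub>R edge_vector E + snd p *\<^sub>R (- z) \<in> exit_strip E z \<longleftrightarrow> p \<in> {0<..<1} \<times> {0<..<1}"
proof -
  let ?d = "edge_vector E" and ?c = "cross2 (edge_vector E) z"
  have "cross2 (edge_start E + fst p *\<^sub>R ?d + snd p *\<^sub>R (- z) - edge_start E) z = fst p * ?c"
    "cross2 (edge_start E + fst p *\<^sub>R ?d + snd p *\<^sub>R (- z) - edge_start E) ?d = snd p * ?c"
    by (simp_all add: cross2_def algebra_simps)
  then show ?thesis
    unfolding exit_strip_coordinates using strip_jacobian_nonzero(2) by (simp add: mem_Times_iff)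
qed

lemma
  fixes f :: "real^2 \<Rightarrow> real"
  assumes [measurable]: "f \<in> borel_measurable borel"
    and bnd: "\<And>x. x \<in> exit_strip E z \<Longrightarrow> \<bar>f x\<bar> \<le> B"
  shows integrable_exit_strip: "integrable lborel (\<lambda>x. indicator (exit_strip E z) x * f x)"
    and integral_exit_strip: "(\<integral>x. indicator (exit_strip E z) x * f x \<partial>lborel)
      = norm (edge_vector E) * (edge_normal \<Omega> E \<bullet> z) *
        (\<integral>p. indicator ({0<..<1} \<times> {0<..<1}) p * f (edge_point E (fst p) - snd p *\<^sub>R z) \<partial>lborel)"
    and integrable_exit_strip_parameters:
      "integrable lborel (\<lambda>p. indicator ({0<..<1} \<times> {0<..<1}) p * f (edge_point E (fst p) - snd p *\<^sub>R z))"
proof -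
  note exit_strip_borel[measurable]
  let ?Q = "{0<..<1::real} \<times> {0<..<1::real}"
  let ?P = "\<lambda>p::real\<times>real. edge_start E + fst p *\<^sub>R edge_vector E + snd p *\<^sub>R (- z)"
  have Q: "?Q = box (0,0) (1,1)" by (auto simp: box_def Basis_prod_def)
  have [measurable]: "?Q \<in> sets borel" unfolding Q by simp
  have ind: "indicator (exit_strip E z) (?P p) = (indicator ?Q p :: real)" for p
    using exit_strip_parameters[of p] by (simp add: indicator_def)
  have P: "?P p = edge_point E (fst p) - snd p *\<^sub>R z" for p by (simp add: edge_point_def)
  have [measurable]: "?P \<in> borel_measurable borel"
    by (intro borel_measurable_continuous_onI continuous_intros)
  have m: "(\<lambda>x. indicator (exit_strip E z) x * f x) \<in> borel_measurable borel" by measurable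
  have "integrable lborel (\<lambda>p. indicator ?Q p * f (?P p))"
  proof (rule integrableI_bounded_set[where A="?Q" and B=B])
    show "emeasure lborel ?Q < \<infinity>" unfolding Q by (simp add: emeasure_lborel_box_eq)
    show "AE x in lborel. x \<in> ?Q \<longrightarrow> norm (indicator ?Q x * f (?P x)) \<le> B"
      using bnd exit_strip_parameters by (intro AE_I2) auto
    show "(\<lambda>p. indicator ?Q p * f (?P p)) \<in> borel_measurable lborel" by measurable
  qed (auto intro!: AE_I2)
  then show i: "integrable lborel (\<lambda>p. indicator ?Q p * f (edge_point E (fst p) - snd p *\<^sub>R z))" unfolding P .
  show "integrable lborel (\<lambda>x. indicator (exit_strip E z) x * f x)"
    unfolding integrable_plane_coordinates[OF strip_jacobian_nonzero(1) m, of "edge_start E"] unfolding ind unfolding P by (rule i)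
  show "(\<integral>x. indicator (exit_strip E z) x * f x \<partial>lborel)
      = norm (edge_vector E) * (edge_normal \<Omega> E \<bullet> z) *
        (\<integral>p. indicator ?Q p * f (edge_point E (fst p) - snd p *\<^sub>R z) \<partial>lborel)"
    unfolding integral_plane_coordinates[OF strip_jacobian_nonzero(1) m, of "edge_start E"] unfolding ind unfolding P strip_jacobian ..
qed

lemma exit_strip_integral_approx:
  fixes f :: "real^2 \<Rightarrow> real" and H :: "real \<Rightarrow> real"
  assumes f: "f \<in> borel_measurable borel"
    and bnd: "\<And>x. x \<in> exit_strip E z \<Longrightarrow> \<bar>f x\<bar> \<le> B"
    and H: "H \<in> borel_measurable borel" and Hb: "\<And>s. 0 < s \<Longrightarrow> s < 1 \<Longrightarrow> \<bar>H s\<bar> \<le> C"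
    and app: "\<And>s t. 0 < s \<Longrightarrow> s < 1 \<Longrightarrow> 0 < t \<Longrightarrow> t < 1 \<Longrightarrow> \<bar>f (edge_point E s - t *\<^sub>R z) - H s\<bar> \<le> \<eta>"
  shows "\<bar>(\<integral>x. indicator (exit_strip E z) x * f x \<partial>lborel)
     - norm (edge_vector E) * (edge_normal \<Omega> E \<bullet> z) * (\<integral>s. indicator {0<..<1} s * H s \<partial>lborel)\<bar>
     \<le> norm (edge_vector E) * norm z * \<eta>"
proof -
  let ?Q = "{0<..<1::real} \<times> {0<..<1::real}"
  let ?J = "norm (edge_vector E) * (edge_normal \<Omega> E \<bullet> z)"
  let ?F = "\<lambda>p. indicator ?Q p * f (edge_point E (fst p) - snd p *\<^sub>R z)"
  have Q: "?Q = box (0,0) (1,1)" by (auto simp: box_def Basis_prod_def)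
  note i1 = integrable_exit_strip_parameters[OF f bnd]
  note i2 = unit_square_fst[OF H Hb] and i3 = unit_square_fst[of "\<lambda>_. \<eta>" "\<bar>\<eta>\<bar>"]
  have J: "0 \<le> ?J" using out by simp
  have n: "edge_normal \<Omega> E \<bullet> z \<le> norm z"
    using normal_component_le[OF polygon E, of z] by simp
  have e0: "0 \<le> \<eta>" using app[of "1/2" "1/2"] by simp
  have "\<bar>(\<integral>p. ?F p - indicator ?Q p * H (fst p) \<partial>lborel)\<bar> \<le> (\<integral>p. indicator ?Q p * \<eta> \<partial>lborel)"
  proof (rule integral_abs_bound_integral)
    show "integrable lborel (\<lambda>p. ?F p - indicator ?Q p * H (fst p))" using i1 i2(1) by auto
    show "integrable lborel (\<lambda>p. indicator ?Q p * \<eta>)" using i3(1) by simp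
    show "\<bar>?F p - indicator ?Q p * H (fst p)\<bar> \<le> indicator ?Q p * \<eta>" for p :: "real \<times> real"
      using app[of "fst p" "snd p"] by (cases "p \<in> ?Q") (auto simp: mem_Times_iff)
  qed
  also have "(\<integral>p. indicator ?Q p * \<eta> \<partial>lborel) = \<eta>" using i3(2) by simp
  also have "(\<integral>p. ?F p - indicator ?Q p * H (fst p) \<partial>lborel)
      = (\<integral>p. ?F p \<partial>lborel) - (\<integral>s. indicator {0<..<1} s * H s \<partial>lborel)"
    using i1 i2 by simp
  finally have *: "\<bar>(\<integral>p. ?F p \<partial>lborel) - (\<integral>s. indicator {0<..<1} s * H s \<partial>lborel)\<bar> \<le> \<eta>" .
  have "\<bar>?J * (\<integral>p. ?F p \<partial>lborel) - ?J * (\<integral>s. indicator {0<..<1} s * H s \<partial>lborel)\<bar>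
     = ?J * \<bar>(\<integral>p. ?F p \<partial>lborel) - (\<integral>s. indicator {0<..<1} s * H s \<partial>lborel)\<bar>"
    unfolding right_diff_distrib[symmetric] abs_mult[of ?J] abs_of_nonneg[OF J] ..
  also have "\<dots> \<le> ?J * \<eta>" using * J by (intro mult_left_mono)
  also have "\<dots> \<le> norm (edge_vector E) * norm z * \<eta>"
    using n e0 by (intro mult_right_mono mult_left_mono) auto
  finally show ?thesis by (subst integral_exit_strip[OF f bnd])
qed

text \<open>
  The part of the strip outside \<open>\<Omega>\<close> lies above the corner parameters, a set of measure at most
  \<open>K * norm z\<close>, and the area element contributes a second factor \<open>norm z\<close>.
\<close>

lemma exit_strip_corner_defect:
  fixes f :: "real^2 \<Rightarrow> real"
  assumes f[measurable]: "f \<in> borel_measurable borel"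
    and bnd: "\<And>x. x \<in> exit_strip E z \<Longrightarrow> \<bar>f x\<bar> \<le> B"
    and K: "measure lborel (corner_parameters \<Omega> E (norm z)) \<le> K * norm z"
  shows "\<bar>\<integral>x. indicator (exit_strip E z - \<Omega>) x * f x \<partial>lborel\<bar> \<le> norm (edge_vector E) * K * B * (norm z)\<^sup>2"
proof -
  have [measurable]: "\<Omega> \<in> sets borel" using polygon_open[OF polygon] by simp
  note exit_strip_borel[measurable] corner_parameters_borel[OF polygon, measurable]
  let ?Q = "{0<..<1::real} \<times> {0<..<1::real}"
  let ?J = "norm (edge_vector E) * (edge_normal \<Omega> E \<bullet> z)"
  let ?c = "corner_parameters \<Omega> E (norm z)"
  have B0: "0 \<le> B"
  proof -
    have "edge_point E (1/2) - (1/2) *\<^sub>R z \<in> exit_strip E z"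
      unfolding exit_strip_def by (rule CollectI, intro exI[of _ "1/2"]) simp
    then show ?thesis using bnd by fastforce
  qed
  have cint: "integrable lborel (\<lambda>p. indicator ?Q p * (B * indicator ?c (fst p)))"
      "(\<integral>p. indicator ?Q p * (B * indicator ?c (fst p)) \<partial>lborel) = (\<integral>s. indicator {0<..<1} s * (B * indicator ?c s) \<partial>lborel)"
    by (rule unit_square_fst[where b=B]; use B0 in \<open>auto simp: indicator_def\<close>)+
  have "(\<lambda>s. indicator {0<..<1} s * (B * indicator ?c s)) = (\<lambda>s. B * indicator ?c s)"
    by (auto simp: indicator_def corner_parameters_def[OF polygon])
  then have cval: "(\<integral>s. indicator {0<..<1} s * (B * indicator ?c s) \<partial>lborel) = B * measure lborel ?c" by simp
  define f1 where "f1 x = indicator (- \<Omega>) x * f x" for x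
  have f1[measurable]: "f1 \<in> borel_measurable borel" unfolding f1_def by measurable
  have f1b: "\<bar>f1 x\<bar> \<le> B" if "x \<in> exit_strip E z" for x using bnd[OF that] B0 by (simp add: f1_def indicator_def)
  let ?F = "\<lambda>p. indicator ?Q p * f1 (edge_point E (fst p) - snd p *\<^sub>R z)"
  have n: "edge_normal \<Omega> E \<bullet> z \<le> norm z"
    using normal_component_le[OF polygon E, of z] by simp
  have "\<bar>\<integral>p. ?F p \<partial>lborel\<bar> \<le> (\<integral>p. indicator ?Q p * (B * indicator ?c (fst p)) \<partial>lborel)"
  proof (rule integral_abs_bound_integral)
    show "integrable lborel ?F" by (rule integrable_exit_strip_parameters[OF f1 f1b])
    show "\<bar>?F p\<bar> \<le> indicator ?Q p * (B * indicator ?c (fst p))" for p :: "real \<times> real"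
    proof (cases "p \<in> ?Q")
      case True
      then have st: "0 < fst p" "fst p < 1" "0 < snd p" "snd p < 1" by auto
      have mem: "edge_point E (fst p) - snd p *\<^sub>R z \<in> exit_strip E z" unfolding exit_strip_def using st by blast
      show ?thesis
      proof (cases "edge_point E (fst p) - snd p *\<^sub>R z \<in> \<Omega>")
        case True
        then show ?thesis using B0 by (simp add: f1_def)
      next
        case False
        then have "fst p \<in> ?c" by (rule exit_strip_outside_corner[OF polygon E out st])
        then show ?thesis using f1b[OF mem] \<open>p \<in> ?Q\<close> by simp
      qed
    qed simp
  qed (rule cint(1))
  also have "\<dots> = B * measure lborel ?c" unfolding cint(2) cval ..
  also have "\<dots> \<le> B * (K * norm z)" using K B0 by (intro mult_left_mono)
  finally have F: "\<bar>\<integral>p. ?F p \<partial>lborel\<bar> \<le> B * (K * norm z)" .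
  have "(\<integral>x. indicator (exit_strip E z - \<Omega>) x * f x \<partial>lborel) = (\<integral>x. indicator (exit_strip E z) x * f1 x \<partial>lborel)"
    by (intro Bochner_Integration.integral_cong) (auto simp: f1_def indicator_def)
  also have "\<dots> = ?J * (\<integral>p. ?F p \<partial>lborel)" by (rule integral_exit_strip[OF f1 f1b])
  finally have "\<bar>\<integral>x. indicator (exit_strip E z - \<Omega>) x * f x \<partial>lborel\<bar> = ?J * \<bar>\<integral>p. ?F p \<partial>lborel\<bar>"
    using out by (simp add: abs_mult)
  also have "\<dots> \<le> (norm (edge_vector E) * norm z) * (B * (K * norm z))"
    using n F out by (intro mult_mono mult_left_mono) auto
  finally show ?thesis by (simp add: power2_eq_square mult_ac)
qed

end

text \<open>
  Every point of the exit set leaves through an edge, at an interior point of the edge unless it lies on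
  one of finitely many lines. Conversely a point of a strip belongs to the exit set exactly if it lies
  in \<open>\<Omega>\<close>.
\<close>

lemma exit_set_AE_decomposition:
  assumes polygon: "convex_polygon \<Omega>" and z: "z \<noteq> 0"
  shows "AE x in lborel. indicator (exit_set \<Omega> z) x
     = (\<Sum>E | E \<in> polygon_edges \<Omega> \<and> 0 < edge_normal \<Omega> E \<bullet> z.
         indicator (exit_strip E z) x - indicator (exit_strip E z - \<Omega>) x :: real)"
proof -
  let ?P = "{E. E \<in> polygon_edges \<Omega> \<and> 0 < edge_normal \<Omega> E \<bullet> z}"
  have fin: "finite (polygon_edges \<Omega>)" by (rule polygon_finite_edges[OF polygon])
  have "AE x in lborel. \<forall>E\<in>polygon_edges \<Omega>. cross2 x z \<noteq> cross2 (edge_start E) z \<and> cross2 x z \<noteq> cross2 (edge_end E) z"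
    using fin by (intro AE_finite_allI AE_conjI AE_not_on_line z)
  then show ?thesis
  proof eventually_elim
    case (elim x)
    have covered: "\<exists>E\<in>?P. x \<in> exit_strip E z" if "x \<in> exit_set \<Omega> z"
    proof -
      have "x \<in> \<Omega>" "x + z \<notin> closure \<Omega>" using that by (auto simp: exit_set_def)
      then obtain E t where E: "E \<in> polygon_edges \<Omega>" and t: "0 < t" "t < 1" "x + t *\<^sub>R z \<in> E" and n: "0 < edge_normal \<Omega> E \<bullet> z"
        by (rule exit_through_edge[OF polygon])
      obtain s where s: "0 \<le> s" "s \<le> 1" "x + t *\<^sub>R z = edge_point E s"
        using edge_point_in_edge(2)[OF polygon E t(3)] by blast
      have c: "cross2 x z = cross2 (edge_point E s) z"
        unfolding s(3)[symmetric] by (simp add: cross2_def algebra_simps)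
      have "s \<noteq> 0" "s \<noteq> 1" using c elim E by (auto simp: edge_point_def edge_vector_def)
      moreover have "x = edge_point E s - t *\<^sub>R z" unfolding s(3)[symmetric] by simp
      ultimately have "x \<in> exit_strip E z" unfolding exit_strip_def using s(1,2) t by force
      then show ?thesis using E n by blast
    qed
    show ?case
    proof (cases "\<exists>E\<in>?P. x \<in> exit_strip E z")
      case False
      then have "x \<notin> exit_set \<Omega> z" using covered by blast
      moreover have "(\<Sum>E\<in>?P. indicator (exit_strip E z) x - indicator (exit_strip E z - \<Omega>) x :: real) = 0"
        using False by (intro sum.neutral) auto
      ultimately show ?thesis by simp
    next
      case True
      then obtain E where E: "E \<in> ?P" "x \<in> exit_strip E z" by blast
      have oth: "x \<notin> exit_strip F z" if "F \<in> ?P" "F \<noteq> E" for F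
        using exit_strips_disjoint[OF polygon _ _ _ _ E(2), of F] E(1) that by blast
      have "(\<Sum>F\<in>?P. indicator (exit_strip F z) x - indicator (exit_strip F z - \<Omega>) x :: real)
          = (\<Sum>F\<in>{E}. indicator (exit_strip F z) x - indicator (exit_strip F z - \<Omega>) x)"
        using E(1) oth fin by (intro sum.mono_neutral_right) auto
      also have "\<dots> = indicator \<Omega> x" using E(2) by (simp add: indicator_def)
      also have "\<dots> = indicator (exit_set \<Omega> z) x"
      proof -
        obtain s t where "t < 1" "x = edge_point E s - t *\<^sub>R z" using E(2) by (auto simp: exit_strip_def)
        then have "x + z \<notin> closure \<Omega>" using exit_strip_leaves[OF polygon, of E z t s] E(1) by blast
        then show ?thesis by (simp add: exit_set_def indicator_def)
      qed
      finally show ?thesis by simp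
    qed
  qed
qed

text \<open>
  If the integrand is close to a function \<open>H E\<close> of the exit point, the integral over the exit set is
  close to a sum of integrals over the edges. The term with \<open>B\<close> pays for the corners, the term with
  \<open>\<eta>\<close> for replacing the integrand; the constant depends on the polygon only.
\<close>

lemma exit_set_integral_approx:
  assumes polygon: "convex_polygon \<Omega>"
  obtains C where "0 \<le> C"
    "\<And>z f B \<eta> H D. f \<in> borel_measurable borel \<Longrightarrow> 0 \<le> B \<Longrightarrow> 0 \<le> \<eta> \<Longrightarrow>
      (\<And>E x. E \<in> polygon_edges \<Omega> \<Longrightarrow> x \<in> exit_strip E z \<Longrightarrow> \<bar>f x\<bar> \<le> B) \<Longrightarrow>
      (\<And>E. E \<in> polygon_edges \<Omega> \<Longrightarrow> H E \<in> borel_measurable borel) \<Longrightarrow>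
      (\<And>E s. E \<in> polygon_edges \<Omega> \<Longrightarrow> 0 < s \<Longrightarrow> s < 1 \<Longrightarrow> \<bar>H E s\<bar> \<le> D) \<Longrightarrow>
      (\<And>E s t. E \<in> polygon_edges \<Omega> \<Longrightarrow> 0 < s \<Longrightarrow> s < 1 \<Longrightarrow> 0 < t \<Longrightarrow> t < 1 \<Longrightarrow>
          \<bar>f (edge_point E s - t *\<^sub>R z) - H E s\<bar> \<le> \<eta>) \<Longrightarrow>
      \<bar>(\<integral>x. indicator (exit_set \<Omega> z) x * f x \<partial>lborel)
        - (\<Sum>E\<in>polygon_edges \<Omega>. norm (edge_vector E) * max 0 (edge_normal \<Omega> E \<bullet> z) *
             (\<integral>s. indicator {0<..<1} s * H E s \<partial>lborel))\<bar> \<le> C * (B * (norm z)\<^sup>2 + \<eta> * norm z)"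
proof -
  let ?n = "edge_normal \<Omega>" and ?E = "polygon_edges \<Omega>"
  have fin: "finite ?E" by (rule polygon_finite_edges[OF polygon])
  have [measurable]: "\<Omega> \<in> sets borel" using polygon_open[OF polygon] by simp
  obtain K where K: "0 \<le> K" "\<And>E \<epsilon>. E \<in> ?E \<Longrightarrow> 0 \<le> \<epsilon> \<Longrightarrow> measure lborel (corner_parameters \<Omega> E \<epsilon>) \<le> K * \<epsilon>"
    using measure_corner_parameters[OF polygon] by blast
  define C where "C = (\<Sum>E\<in>?E. norm (edge_vector E)) * max 1 K"
  show ?thesis
  proof (rule that[of C])
    show "0 \<le> C" unfolding C_def by (intro mult_nonneg_nonneg sum_nonneg) auto
    fix z :: "real^2" and f :: "real^2 \<Rightarrow> real" and B \<eta> :: real and H :: "(real^2) set \<Rightarrow> real \<Rightarrow> real" and D :: real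
    assume f[measurable]: "f \<in> borel_measurable borel" and B: "0 \<le> B" and \<eta>: "0 \<le> \<eta>"
      and fB: "\<And>E x. E \<in> ?E \<Longrightarrow> x \<in> exit_strip E z \<Longrightarrow> \<bar>f x\<bar> \<le> B"
      and H: "\<And>E. E \<in> ?E \<Longrightarrow> H E \<in> borel_measurable borel"
      and HD: "\<And>E s. E \<in> ?E \<Longrightarrow> 0 < s \<Longrightarrow> s < 1 \<Longrightarrow> \<bar>H E s\<bar> \<le> D"
      and app: "\<And>E s t. E \<in> ?E \<Longrightarrow> 0 < s \<Longrightarrow> s < 1 \<Longrightarrow> 0 < t \<Longrightarrow> t < 1 \<Longrightarrow>
          \<bar>f (edge_point E s - t *\<^sub>R z) - H E s\<bar> \<le> \<eta>"
    let ?P = "{E. E \<in> ?E \<and> 0 < ?n E \<bullet> z}"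
    let ?I = "\<lambda>E. \<integral>s. indicator {0<..<1} s * H E s \<partial>lborel"
    let ?S = "\<lambda>E. \<integral>x. indicator (exit_strip E z) x * f x \<partial>lborel"
    let ?R = "\<lambda>E. \<integral>x. indicator (exit_strip E z - \<Omega>) x * f x \<partial>lborel"
    have finP: "finite ?P" using fin by simp
    have sumP: "(\<Sum>E\<in>?E. norm (edge_vector E) * max 0 (?n E \<bullet> z) * ?I E)
        = (\<Sum>E\<in>?P. norm (edge_vector E) * (?n E \<bullet> z) * ?I E)"
      by (rule sum.mono_neutral_cong_right) (use fin in \<open>auto simp: max_def\<close>)
    have mE[measurable]: "exit_strip E z \<in> sets borel" if "E \<in> ?P" for E
      using exit_strip_borel[OF polygon, of E z] that by simp
    have iS: "integrable lborel (\<lambda>x. indicator (exit_strip E z) x * f x)" if "E \<in> ?P" for E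
      by (rule integrable_exit_strip[OF polygon _ _ f fB]) (use that in auto)
    have iR: "integrable lborel (\<lambda>x. indicator (exit_strip E z - \<Omega>) x * f x)" if "E \<in> ?P" for E
    proof (rule Bochner_Integration.integrable_bound[OF iS[OF that]])
      show "(\<lambda>x. indicator (exit_strip E z - \<Omega>) x * f x) \<in> borel_measurable lborel" using mE[OF that] by simp
      show "AE x in lborel. norm (indicator (exit_strip E z - \<Omega>) x * f x) \<le> norm (indicator (exit_strip E z) x * f x)"
        by (intro AE_I2) (simp add: indicator_def)
    qed
    have lhs: "(\<integral>x. indicator (exit_set \<Omega> z) x * f x \<partial>lborel) = (\<Sum>E\<in>?P. ?S E - ?R E)"
    proof (cases "z = 0")
      case True
      then have "exit_set \<Omega> z = {}" using closure_subset by (auto simp: exit_set_def)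
      then show ?thesis using True by simp
    next
      case False
      have [measurable]: "closure \<Omega> \<in> sets borel" by simp
      have ms: "exit_set \<Omega> z \<in> sets borel"
        unfolding exit_set_def by measurable
      have "(\<integral>x. indicator (exit_set \<Omega> z) x * f x \<partial>lborel)
        = (\<integral>x. (\<Sum>E\<in>?P. indicator (exit_strip E z) x * f x - indicator (exit_strip E z - \<Omega>) x * f x) \<partial>lborel)"
      proof (rule integral_cong_AE)
        show "(\<lambda>x. indicator (exit_set \<Omega> z) x * f x) \<in> borel_measurable lborel" using ms by simp
        show "(\<lambda>x. \<Sum>E\<in>?P. indicator (exit_strip E z) x * f x - indicator (exit_strip E z - \<Omega>) x * f x) \<in> borel_measurable lborel"
          using mE by (intro borel_measurable_sum) simp
        show "AE x in lborel. indicator (exit_set \<Omega> z) x * f x =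
            (\<Sum>E\<in>?P. indicator (exit_strip E z) x * f x - indicator (exit_strip E z - \<Omega>) x * f x)"
          using exit_set_AE_decomposition[OF polygon False]
        proof eventually_elim
          case (elim x)
          show ?case unfolding elim sum_distrib_right left_diff_distrib ..
        qed
      qed
      also have "\<dots> = (\<Sum>E\<in>?P. ?S E - ?R E)"
        using iS iR by (subst Bochner_Integration.integral_sum) auto
      finally show ?thesis .
    qed
    have "\<bar>(\<Sum>E\<in>?P. ?S E - ?R E) - (\<Sum>E\<in>?P. norm (edge_vector E) * (?n E \<bullet> z) * ?I E)\<bar>
        = \<bar>\<Sum>E\<in>?P. (?S E - norm (edge_vector E) * (?n E \<bullet> z) * ?I E) - ?R E\<bar>"
      by (simp add: sum_subtractf)
    also have "\<dots> \<le> (\<Sum>E\<in>?P. \<bar>(?S E - norm (edge_vector E) * (?n E \<bullet> z) * ?I E) - ?R E\<bar>)"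
      by (rule sum_abs)
    also have "\<dots> \<le> (\<Sum>E\<in>?P. norm (edge_vector E) * (max 1 K * (B * (norm z)\<^sup>2 + \<eta> * norm z)))"
    proof (rule sum_mono)
      fix E assume "E \<in> ?P"
      then have E: "E \<in> ?E" "0 < ?n E \<bullet> z" by auto
      have "\<bar>?S E - norm (edge_vector E) * (?n E \<bullet> z) * ?I E\<bar> \<le> norm (edge_vector E) * norm z * \<eta>"
        by (rule exit_strip_integral_approx[OF polygon E f fB[OF E(1)] H[OF E(1)] HD[OF E(1)] app[OF E(1)]])
      moreover have "\<bar>?R E\<bar> \<le> norm (edge_vector E) * K * B * (norm z)\<^sup>2"
        by (rule exit_strip_corner_defect[OF polygon E f fB[OF E(1)] K(2)[OF E(1)]]) auto
      ultimately have "\<bar>(?S E - norm (edge_vector E) * (?n E \<bullet> z) * ?I E) - ?R E\<bar>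
         \<le> norm (edge_vector E) * (1 * (\<eta> * norm z) + K * (B * (norm z)\<^sup>2))"
        by (simp add: algebra_simps)
      also have "\<dots> \<le> norm (edge_vector E) * (max 1 K * (\<eta> * norm z) + max 1 K * (B * (norm z)\<^sup>2))"
        using B \<eta> by (intro mult_left_mono add_mono mult_right_mono) auto
      finally show "\<bar>(?S E - norm (edge_vector E) * (?n E \<bullet> z) * ?I E) - ?R E\<bar>
         \<le> norm (edge_vector E) * (max 1 K * (B * (norm z)\<^sup>2 + \<eta> * norm z))"
        by (simp add: algebra_simps)
    qed
    also have "\<dots> \<le> (\<Sum>E\<in>?E. norm (edge_vector E) * (max 1 K * (B * (norm z)\<^sup>2 + \<eta> * norm z)))"
      using fin B \<eta> by (intro sum_mono2) auto
    also have "\<dots> = C * (B * (norm z)\<^sup>2 + \<eta> * norm z)" by (simp add: C_def sum_distrib_right mult.assoc)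
    finally show "\<bar>(\<integral>x. indicator (exit_set \<Omega> z) x * f x \<partial>lborel)
        - (\<Sum>E\<in>?E. norm (edge_vector E) * max 0 (?n E \<bullet> z) * ?I E)\<bar> \<le> C * (B * (norm z)\<^sup>2 + \<eta> * norm z)"
      unfolding lhs sumP .
  qed
qed

section \<open>Translations, representatives and Fubini\<close>

lemma
  fixes f :: "'a::euclidean_space \<Rightarrow> real"
  assumes f[measurable]: "f \<in> borel_measurable borel"
  shows integral_lborel_translate: "(\<integral>x. f (a + x) \<partial>lborel) = (\<integral>x. f x \<partial>lborel)"
    and integral_lborel_reflect: "(\<integral>x. f (a - x) \<partial>lborel) = (\<integral>x. f x \<partial>lborel)"
proof -
  have "(\<integral>x. f x \<partial>lborel) = (\<integral>x. f x \<partial>distr lborel borel ((+) a))" by (simp only: lborel_distr_plus)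
  also have "\<dots> = (\<integral>x. f (a + x) \<partial>lborel)" by (rule integral_distr) auto
  finally show "(\<integral>x. f (a + x) \<partial>lborel) = (\<integral>x. f x \<partial>lborel)" ..
  have L: "lborel = distr lborel borel (\<lambda>x::'a. a + (-1) *\<^sub>R x)"
    using lborel_affine[of "-1" a] by (simp add: density_1)
  have "(\<integral>x. f x \<partial>lborel) = (\<integral>x. f x \<partial>distr lborel borel (\<lambda>x. a + (-1) *\<^sub>R x))" by (simp only: L[symmetric])
  also have "\<dots> = (\<integral>x. f (a + (-1) *\<^sub>R x) \<partial>lborel)" by (rule integral_distr) auto
  finally show "(\<integral>x. f (a - x) \<partial>lborel) = (\<integral>x. f x \<partial>lborel)" by simp
qed

lemma AE_lborel_translate:
  assumes "AE z in lborel. P (z::'a::euclidean_space)"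
  shows "AE y in lborel. P (y - x)"
proof -
  obtain N where N: "N \<in> null_sets lborel" "{z. \<not> P z} \<subseteq> N"
    using assms unfolding eventually_ae_filter by auto
  then have [measurable]: "N \<in> sets borel" by auto
  have "AE z in distr lborel borel ((+) (- x)). z \<notin> N" unfolding lborel_distr_plus using N(1) by (rule AE_not_in)
  then have "AE y in lborel. - x + y \<notin> N" by (subst (asm) AE_distr_iff) auto
  then show ?thesis
  proof eventually_elim
    case (elim y)
    then have "y - x \<notin> N" by simp
    then show ?case using N(2) by blast
  qed
qed

lemma integral_lebesgue_eq_lborel:
  fixes f h :: "'a::euclidean_space \<Rightarrow> real"
  assumes h: "h \<in> borel_measurable borel" and ae: "AE x in lborel. f x = h x"
  shows "integral\<^sup>L lebesgue f = integral\<^sup>L lborel h"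
proof -
  have hm: "h \<in> borel_measurable lebesgue" using h by (intro measurable_completion) simp
  have ae': "AE x in lebesgue. h x = f x" unfolding AE_completion_iff using ae by eventually_elim (rule sym)
  have "integral\<^sup>L lebesgue h = integral\<^sup>L lebesgue f"
    by (rule integral_cong_AE[OF hm borel_measurable_AE[OF hm ae'] ae'])
  moreover have "integral\<^sup>L lebesgue h = integral\<^sup>L lborel h"
    using h by (intro integral_completion) simp
  ultimately show ?thesis by simp
qed

lemma
  fixes \<Phi> :: "'a::euclidean_space \<Rightarrow> 'b::euclidean_space \<Rightarrow> real"
  assumes m[measurable]: "case_prod \<Phi> \<in> borel_measurable (lborel \<Otimes>\<^sub>M lborel)"
    and S[measurable]: "S \<in> sets borel" and bS: "bounded S" and \<Gamma>: "integrable lborel \<Gamma>"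
    and bnd: "\<And>x z. \<bar>\<Phi> x z\<bar> \<le> c * indicator S x * \<Gamma> z"
  shows integral_swap_dominated:
      "(\<integral>x. (\<integral>z. \<Phi> x z \<partial>lborel) \<partial>lborel) = (\<integral>z. (\<integral>x. \<Phi> x z \<partial>lborel) \<partial>lborel)"
    and integrable_fst_dominated: "integrable lborel (\<lambda>x. \<integral>z. \<Phi> x z \<partial>lborel)"
    and integrable_snd_dominated: "integrable lborel (\<lambda>z. \<integral>x. \<Phi> x z \<partial>lborel)"
proof -
  have [measurable]: "\<Gamma> \<in> borel_measurable borel" using \<Gamma> by (simp add: borel_measurable_integrable flip: measurable_lborel1)
  have fS: "emeasure lborel S < \<infinity>" using bS by (rule emeasure_bounded_finite)
  have i: "integrable (lborel \<Otimes>\<^sub>M lborel) (case_prod \<Phi>)"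
  proof (rule Bochner_Integration.integrable_bound)
    show "integrable (lborel \<Otimes>\<^sub>M lborel) (\<lambda>(x, z). c * indicator S x * \<Gamma> z)"
    proof (rule lborel_pair.Fubini_integrable)
      show "(\<lambda>(x, z). c * indicator S x * \<Gamma> z) \<in> borel_measurable (lborel \<Otimes>\<^sub>M lborel)" by measurable
      have "(\<lambda>x. \<integral>z. norm (case (x, z) of (x, z) \<Rightarrow> c * indicator S x * \<Gamma> z) \<partial>lborel)
          = (\<lambda>x. \<bar>c\<bar> * (\<integral>z. \<bar>\<Gamma> z\<bar> \<partial>lborel) * indicator S x)"
        by (auto simp: abs_mult indicator_def fun_eq_iff)
      moreover have "integrable lborel (\<lambda>x. \<bar>c\<bar> * (\<integral>z. \<bar>\<Gamma> z\<bar> \<partial>lborel) * indicator S x)"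
        using fS by (intro integrable_mult_right) (simp add: integrable_indicator_iff)
      ultimately show "integrable lborel (\<lambda>x. \<integral>z. norm (case (x, z) of (x, z) \<Rightarrow> c * indicator S x * \<Gamma> z) \<partial>lborel)"
        by simp
      show "AE x in lborel. integrable lborel (\<lambda>z. case (x, z) of (x, z) \<Rightarrow> c * indicator S x * \<Gamma> z)"
        using \<Gamma> by (intro AE_I2) simp
    qed
    show "AE p in lborel \<Otimes>\<^sub>M lborel. norm (case_prod \<Phi> p) \<le> norm (case p of (x, z) \<Rightarrow> c * indicator S x * \<Gamma> z)"
    proof (rule AE_I2)
      fix p :: "'a \<times> 'b"
      obtain x z where p: "p = (x, z)" by (cases p)
      show "norm (case_prod \<Phi> p) \<le> norm (case p of (x, z) \<Rightarrow> c * indicator S x * \<Gamma> z)"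
        using order_trans[OF bnd[of x z] abs_ge_self] unfolding p by simp
    qed
  qed (rule m)
  show "(\<integral>x. (\<integral>z. \<Phi> x z \<partial>lborel) \<partial>lborel) = (\<integral>z. (\<integral>x. \<Phi> x z \<partial>lborel) \<partial>lborel)"
    by (rule lborel_pair.Fubini_integral[OF i, symmetric])
  show "integrable lborel (\<lambda>x. \<integral>z. \<Phi> x z \<partial>lborel)" by (rule lborel_pair.integrable_fst[OF i])
  show "integrable lborel (\<lambda>z. \<integral>x. \<Phi> x z \<partial>lborel)" by (rule lborel_pair.integrable_snd[OF i])
qed

section \<open>The inner and the outer layer\<close>

text \<open>
  So the points at distance at least \<open>\<delta>\<close> from \<open>\<Omega>\<close>, or from its complement, already form a closed set,
  and the closures taken of these sets in the definitions of the layers change nothing.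
\<close>

lemma closed_ball_avoiding: "closed {x::'a::metric_space. ball x \<delta> \<inter> S = {}}"
proof -
  have "- {x. ball x \<delta> \<inter> S = {}} = (\<Union>y\<in>S. ball y \<delta>)"
    by (auto simp: dist_commute)
  moreover have "open (\<Union>y\<in>S. ball y \<delta>)" by blast
  ultimately show ?thesis by (metis closed_def)
qed

lemma inner_layer_eq:
  assumes "0 < \<delta>" shows "inner_layer \<delta> \<Omega> = {x \<in> \<Omega>. \<not> ball x \<delta> \<subseteq> \<Omega>}"
proof -
  have "shrunk \<delta> \<Omega> = {x. ball x \<delta> \<inter> (- \<Omega>) = {}}"
    using assms centre_in_ball unfolding shrunk_def by blast
  then have "closure (shrunk \<delta> \<Omega>) = shrunk \<delta> \<Omega>" using closed_ball_avoiding[of \<delta> "- \<Omega>"] by simp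
  then show ?thesis unfolding inner_layer_def by (auto simp: shrunk_def)
qed

lemma enlarged_eq: "enlarged \<delta> \<Omega> = {x. ball x \<delta> \<inter> \<Omega> \<noteq> {}}"
  using closed_ball_avoiding[of \<delta> \<Omega>] by (auto simp: enlarged_def)

lemma outer_layer_eq: "outer_layer \<delta> \<Omega> = {x. x \<notin> closure \<Omega> \<and> ball x \<delta> \<inter> \<Omega> \<noteq> {}}"
  by (auto simp: outer_layer_def enlarged_eq)

text \<open>
  Both points lie in one ball around a point of the frontier, where the local bounds hold.
\<close>

lemma frontier_point_near:
  fixes x y :: "'a::real_normed_vector"
  assumes "x \<in> S" "y \<notin> S" "norm (y - x) < \<delta>"
  obtains p where "p \<in> frontier S" "x \<in> ball p \<delta>" "y \<in> ball p \<delta>"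
proof -
  obtain t where t: "0 \<le> t" "t \<le> 1" and p: "x + t *\<^sub>R (y - x) \<in> frontier S"
    using frontier_crossing[OF assms(1,2)] by blast
  have "norm (t *\<^sub>R (y - x)) \<le> 1 * norm (y - x)" using t by (simp add: mult_left_le_one_le)
  moreover have "norm ((1 - t) *\<^sub>R (y - x)) \<le> 1 * norm (y - x)" using t by (simp add: mult_left_le_one_le)
  moreover have "x + t *\<^sub>R (y - x) - y = - ((1 - t) *\<^sub>R (y - x))" by (simp add: algebra_simps)
  ultimately have "dist (x + t *\<^sub>R (y - x)) x < \<delta>" "dist (x + t *\<^sub>R (y - x)) y < \<delta>"
    using assms(3) by (simp_all add: dist_norm)
  then show ?thesis using that[OF p] by simp
qed

lemma inner_layer_near_frontier:
  assumes "0 < \<delta>" "x \<in> inner_layer \<delta> \<Omega>"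
  obtains p where "p \<in> frontier \<Omega>" "x \<in> ball p \<delta>"
proof -
  obtain y where "x \<in> \<Omega>" "y \<notin> \<Omega>" "dist x y < \<delta>"
    using assms(2) unfolding inner_layer_eq[OF assms(1)] subset_iff mem_ball by blast
  then show ?thesis using frontier_point_near[of x \<Omega> y \<delta>] that by (metis dist_norm norm_minus_commute)
qed

lemma outer_layer_near_frontier:
  assumes "x \<in> outer_layer \<delta> \<Omega>"
  obtains p where "p \<in> frontier \<Omega>" "x \<in> ball p \<delta>"
proof -
  obtain y where "y \<in> \<Omega>" "dist x y < \<delta>" "x \<notin> closure \<Omega>" using assms by (auto simp: outer_layer_eq)
  moreover then have "x \<notin> \<Omega>" using closure_subset by blast
  ultimately show ?thesis using frontier_point_near[of y \<Omega> x \<delta>] that by (metis dist_norm)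
qed

section \<open>The flux of a displacement through the boundary\<close>

text \<open>
  The analytic data near the boundary, with one constant \<open>M\<close> for all bounds; it depends on \<open>u\<close>, \<open>v\<close>
  and the polygon, but not on the horizon.
\<close>

locale polygon_collar =
  fixes \<Omega> :: "(real^2) set" and u v :: "real^2 \<Rightarrow> real" and u' :: "real^2 \<Rightarrow> (real^2) \<Rightarrow>\<^sub>L real"
    and \<rho> M :: real
  assumes polygon: "convex_polygon \<Omega>" and \<rho>: "0 < \<rho>" and M: "0 \<le> M"
    and u_deriv: "\<And>x. infdist x (frontier \<Omega>) < \<rho> \<Longrightarrow> (u has_derivative blinfun_apply (u' x)) (at x)"
    and u'_cont: "continuous_on {x. infdist x (frontier \<Omega>) < \<rho>} u'"
    and v_cont: "continuous_on {x. infdist x (frontier \<Omega>) < \<rho>} v"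
    and v_bound: "\<And>p x. p \<in> frontier \<Omega> \<Longrightarrow> x \<in> ball p (\<rho>/2) \<Longrightarrow> \<bar>v x\<bar> \<le> M"
    and u'_bound: "\<And>p x. p \<in> frontier \<Omega> \<Longrightarrow> x \<in> ball p (\<rho>/2) \<Longrightarrow> norm (u' x) \<le> M"
    and u_lip: "\<And>p x y. p \<in> frontier \<Omega> \<Longrightarrow> x \<in> ball p (\<rho>/2) \<Longrightarrow> y \<in> ball p (\<rho>/2) \<Longrightarrow> \<bar>u x - u y\<bar> \<le> M * norm (x - y)"
    and v_lip: "\<And>p x y. p \<in> frontier \<Omega> \<Longrightarrow> x \<in> ball p (\<rho>/2) \<Longrightarrow> y \<in> ball p (\<rho>/2) \<Longrightarrow> \<bar>v x - v y\<bar> \<le> M * norm (x - y)"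
    and u'_lip: "\<And>p x y. p \<in> frontier \<Omega> \<Longrightarrow> x \<in> ball p (\<rho>/2) \<Longrightarrow> y \<in> ball p (\<rho>/2) \<Longrightarrow> norm (u' x - u' y) \<le> M * norm (x - y)"

lemma polygon_collar_exists:
  assumes polygon: "convex_polygon \<Omega>" and d: "0 < \<rho>"
    and u: "C2_on u {x. infdist x (frontier \<Omega>) < \<rho>}"
    and v: "C1_on v {x. infdist x (frontier \<Omega>) < \<rho>}"
  shows "\<exists>u' M. polygon_collar \<Omega> u v u' \<rho> M"
proof -
  let ?W = "{x. infdist x (frontier \<Omega>) < \<rho>}"
  have K: "compact (frontier \<Omega>)"
    by (rule compact_frontier_bounded[OF polygon_bounded[OF polygon]])
  have K0: "frontier \<Omega> \<noteq> {}"
    using frontier_not_empty[OF polygon_nonempty[OF polygon]] polygon_bounded[OF polygon] not_bounded_UNIV by blast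
  obtain u' where u': "\<forall>x\<in>?W. (u has_derivative blinfun_apply (u' x)) (at x)" "C1_on u' ?W"
    using u unfolding C2_on_def by blast
  obtain A where A: "0 \<le> A" "\<And>p x. p \<in> frontier \<Omega> \<Longrightarrow> x \<in> ball p (\<rho>/2) \<Longrightarrow> norm (u x) \<le> A"
    "\<And>p x y. p \<in> frontier \<Omega> \<Longrightarrow> x \<in> ball p (\<rho>/2) \<Longrightarrow> y \<in> ball p (\<rho>/2) \<Longrightarrow> norm (u x - u y) \<le> A * norm (x - y)"
    by (rule C1_on_collar_bounds[OF C2_on_imp_C1_on[OF u] K K0 d], rule that)
  obtain B where B: "0 \<le> B" "\<And>p x. p \<in> frontier \<Omega> \<Longrightarrow> x \<in> ball p (\<rho>/2) \<Longrightarrow> norm (v x) \<le> B"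
    "\<And>p x y. p \<in> frontier \<Omega> \<Longrightarrow> x \<in> ball p (\<rho>/2) \<Longrightarrow> y \<in> ball p (\<rho>/2) \<Longrightarrow> norm (v x - v y) \<le> B * norm (x - y)"
    by (rule C1_on_collar_bounds[OF v K K0 d], rule that)
  obtain C where C: "0 \<le> C" "\<And>p x. p \<in> frontier \<Omega> \<Longrightarrow> x \<in> ball p (\<rho>/2) \<Longrightarrow> norm (u' x) \<le> C"
    "\<And>p x y. p \<in> frontier \<Omega> \<Longrightarrow> x \<in> ball p (\<rho>/2) \<Longrightarrow> y \<in> ball p (\<rho>/2) \<Longrightarrow> norm (u' x - u' y) \<le> C * norm (x - y)"
    by (rule C1_on_collar_bounds[OF u'(2) K K0 d], rule that)
  define M where "M = A + B + C"
  have le: "A \<le> M" "B \<le> M" "C \<le> M" "0 \<le> M" using A(1) B(1) C(1) by (simp_all add: M_def)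
  have "polygon_collar \<Omega> u v u' \<rho> M"
  proof
    show "convex_polygon \<Omega>" "0 < \<rho>" "0 \<le> M" using polygon d le by auto
    show "(u has_derivative blinfun_apply (u' x)) (at x)" if "infdist x (frontier \<Omega>) < \<rho>" for x
      using u'(1) that by blast
    show "continuous_on ?W u'" "continuous_on ?W v" by (rule C1_on_imp_continuous_on[OF u'(2)] C1_on_imp_continuous_on[OF v])+
    fix p x assume p: "p \<in> frontier \<Omega>" "x \<in> ball p (\<rho>/2)"
    show "\<bar>v x\<bar> \<le> M" using order_trans[OF B(2)[OF p] le(2)] by (simp only: real_norm_def)
    show "norm (u' x) \<le> M" by (rule order_trans[OF C(2)[OF p] le(3)])
    fix y assume y: "y \<in> ball p (\<rho>/2)"
    show "\<bar>u x - u y\<bar> \<le> M * norm (x - y)"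
      using order_trans[OF A(3)[OF p y] mult_right_mono[OF le(1) norm_ge_zero]] by (simp only: real_norm_def)
    show "\<bar>v x - v y\<bar> \<le> M * norm (x - y)"
      using order_trans[OF B(3)[OF p y] mult_right_mono[OF le(2) norm_ge_zero]] by (simp only: real_norm_def)
    show "norm (u' x - u' y) \<le> M * norm (x - y)"
      by (rule order_trans[OF C(3)[OF p y] mult_right_mono[OF le(3) norm_ge_zero]])
  qed
  then show ?thesis by blast
qed

context polygon_collar
begin

definition collar :: "(real^2) set" where
  "collar = {x. infdist x (frontier \<Omega>) < \<rho>}"

text \<open>
  Outside the collar nothing is known about \<open>u\<close> and \<open>v\<close>, not even measurability. Their extensions
  by zero are Borel functions on the plane, and agree with them wherever the kernel looks.
\<close>

definition U :: "real^2 \<Rightarrow> real" where "U x = indicator collar x *\<^sub>R u x"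
definition V :: "real^2 \<Rightarrow> real" where "V x = indicator collar x *\<^sub>R v x"

lemma open_collar: "open collar"
  unfolding collar_def by (intro open_Collect_less continuous_on_infdist continuous_intros)

lemma ball_subset_collar: "p \<in> frontier \<Omega> \<Longrightarrow> x \<in> ball p \<rho> \<Longrightarrow> x \<in> collar"
  using infdist_le[of p "frontier \<Omega>" x] by (simp add: collar_def dist_commute[of p x])

lemma U_borel [measurable]: "U \<in> borel_measurable borel"
  unfolding U_def
proof (rule borel_measurable_continuous_on_indicator)
  show "collar \<in> sets borel" using open_collar by simp
  show "continuous_on collar u"
  proof (rule continuous_at_imp_continuous_on, rule ballI)
    fix x assume "x \<in> collar"
    then have "infdist x (frontier \<Omega>) < \<rho>" by (simp add: collar_def)
    then show "isCont u x" by (rule has_derivative_continuous[OF u_deriv])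
  qed
qed

lemma V_borel [measurable]: "V \<in> borel_measurable borel"
  unfolding V_def
proof (rule borel_measurable_continuous_on_indicator)
  show "collar \<in> sets borel" using open_collar by simp
  show "continuous_on collar v" using v_cont by (simp add: collar_def)
qed

lemma U_eq: "p \<in> frontier \<Omega> \<Longrightarrow> x \<in> ball p \<rho> \<Longrightarrow> U x = u x"
  and V_eq: "p \<in> frontier \<Omega> \<Longrightarrow> x \<in> ball p \<rho> \<Longrightarrow> V x = v x"
  using ball_subset_collar by (simp_all add: U_def V_def)

lemma half_ball: "x \<in> ball p (\<rho>/2) \<Longrightarrow> x \<in> ball p \<rho>"
  using \<rho> by (simp add: mem_ball)

lemma U_lip:
  assumes "p \<in> frontier \<Omega>" "x \<in> ball p (\<rho>/2)" "y \<in> ball p (\<rho>/2)"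
  shows "\<bar>U x - U y\<bar> \<le> M * norm (x - y)"
  using u_lip[OF assms] U_eq[OF assms(1) half_ball[OF assms(2)]] U_eq[OF assms(1) half_ball[OF assms(3)]] by simp

lemma V_lip:
  assumes "p \<in> frontier \<Omega>" "x \<in> ball p (\<rho>/2)" "y \<in> ball p (\<rho>/2)"
  shows "\<bar>V x - V y\<bar> \<le> M * norm (x - y)"
  using v_lip[OF assms] V_eq[OF assms(1) half_ball[OF assms(2)]] V_eq[OF assms(1) half_ball[OF assms(3)]] by simp

lemma V_bound: "p \<in> frontier \<Omega> \<Longrightarrow> x \<in> ball p (\<rho>/2) \<Longrightarrow> \<bar>V x\<bar> \<le> M"
  using v_bound[of p x] V_eq[of p x] half_ball[of x p] by simp

text \<open>
  The vector that represents the linear functional \<open>z \<mapsto> \<integral> Du(p) z \<cdot> v(p)\<close> over \<open>E\<close>, in the parameter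
  of the edge rather than in arc length.
\<close>

definition flux_density :: "(real^2) set \<Rightarrow> real^2" where
  "flux_density E = (\<chi> k. \<integral>s. indicator {0<..<1} s *
      (blinfun_apply (u' (edge_point E s)) (axis k 1) * v (edge_point E s)) \<partial>lborel)"

lemma edge_point_frontier:
  assumes "E \<in> polygon_edges \<Omega>" "0 \<le> s" "s \<le> 1" shows "edge_point E s \<in> frontier \<Omega>"
  using edge_point_in_edge(1)[OF polygon assms] edge_subset_frontier[OF polygon assms(1)] by blast

lemma edge_integrand:
  assumes E: "E \<in> polygon_edges \<Omega>"
  shows edge_integrand_borel: "(\<lambda>s. indicator {0<..<1} s *
      (blinfun_apply (u' (edge_point E s)) z * v (edge_point E s))) \<in> borel_measurable borel"
    and edge_integrand_bound: "0 < s \<Longrightarrow> s < 1 \<Longrightarrow> \<bar>blinfun_apply (u' (edge_point E s)) z * v (edge_point E s)\<bar> \<le> M * norm z * M"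
    and edge_integrand_integrable: "integrable lborel (\<lambda>s. indicator {0<..<1} s *
      (blinfun_apply (u' (edge_point E s)) z * v (edge_point E s)))"
proof -
  let ?f = "\<lambda>s. blinfun_apply (u' (edge_point E s)) z * v (edge_point E s)"
  have ce: "continuous_on {0<..<1} (edge_point E)" unfolding edge_point_def by (intro continuous_intros)
  have im: "edge_point E ` {0<..<1} \<subseteq> collar"
  proof (rule image_subsetI)
    fix s :: real assume "s \<in> {0<..<1}"
    then have "edge_point E s \<in> frontier \<Omega>" using edge_point_frontier[OF E, of s] by simp
    then show "edge_point E s \<in> collar" by (rule ball_subset_collar) (use \<rho> in simp)
  qed
  have "continuous_on {0<..<1} ?f"
    by (intro continuous_intros continuous_on_compose2[OF u'_cont[folded collar_def] ce im]
        continuous_on_compose2[OF v_cont[folded collar_def] ce im])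
  then have "(\<lambda>s. indicator {0<..<1} s *\<^sub>R ?f s) \<in> borel_measurable borel"
    by (intro borel_measurable_continuous_on_indicator) auto
  then show m: "(\<lambda>s. indicator {0<..<1} s * ?f s) \<in> borel_measurable borel" by simp
  show b: "\<bar>?f s\<bar> \<le> M * norm z * M" if "0 < s" "s < 1" for s
  proof -
    have p: "edge_point E s \<in> frontier \<Omega>" using edge_point_frontier[OF E] that by simp
    have pb: "edge_point E s \<in> ball (edge_point E s) (\<rho>/2)" using \<rho> by simp
    have "\<bar>blinfun_apply (u' (edge_point E s)) z\<bar> \<le> norm (u' (edge_point E s)) * norm z"
      using norm_blinfun[of "u' (edge_point E s)" z] by simp
    also have "\<dots> \<le> M * norm z" using u'_bound[OF p pb] by (intro mult_right_mono) auto
    finally show ?thesis unfolding abs_mult using v_bound[OF p pb] M by (intro mult_mono) auto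
  qed
  show "integrable lborel (\<lambda>s. indicator {0<..<1} s * ?f s)"
  proof (rule integrableI_bounded_set[where A="{0<..<1}" and B="M * norm z * M"])
    show "AE x in lborel. x \<in> {0<..<1} \<longrightarrow> norm (indicator {0<..<1} x * ?f x) \<le> M * norm z * M"
      using b by (intro AE_I2) simp
    show "(\<lambda>s. indicator {0<..<1} s * ?f s) \<in> borel_measurable lborel" using m by simp
  qed (auto intro!: AE_I2)
qed

lemma flux_density_inner:
  assumes E: "E \<in> polygon_edges \<Omega>"
  shows "flux_density E \<bullet> z = (\<integral>s. indicator {0<..<1} s *
      (blinfun_apply (u' (edge_point E s)) z * v (edge_point E s)) \<partial>lborel)"
proof -
  let ?g = "\<lambda>k s. indicator {0<..<1} s * (blinfun_apply (u' (edge_point E s)) (axis k 1) * v (edge_point E s)) :: real"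
  have z: "z = (z$1) *\<^sub>R axis 1 1 + (z$2) *\<^sub>R axis 2 1"
    by (simp add: vec_eq_iff forall_2 axis_def)
  have lin: "blinfun_apply L z = z$1 * blinfun_apply L (axis 1 1) + z$2 * blinfun_apply L (axis 2 1)" for L :: "(real^2) \<Rightarrow>\<^sub>L real"
    by (subst z) (simp only: blinfun.add_right blinfun.scaleR_right real_scaleR_def)
  have "(\<integral>s. indicator {0<..<1} s * (blinfun_apply (u' (edge_point E s)) z * v (edge_point E s)) \<partial>lborel)
     = (\<integral>s. z$1 * ?g 1 s + z$2 * ?g 2 s \<partial>lborel)"
    unfolding lin by (intro Bochner_Integration.integral_cong refl) (simp add: algebra_simps)
  also have "\<dots> = z$1 * (\<integral>s. ?g 1 s \<partial>lborel) + z$2 * (\<integral>s. ?g 2 s \<partial>lborel)"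
    using edge_integrand_integrable[OF E] by simp
  also have "\<dots> = flux_density E \<bullet> z"
    by (simp add: flux_density_def inner_vec_def sum_2)
  finally show ?thesis by simp
qed

text \<open>
  The normal derivative is known only strictly between the ends of an edge; the two remaining parameters
  form a null set.
\<close>

lemma boundary_integral_flux:
  "boundary_integral \<Omega> (\<lambda>x. \<sigma> * normal_derivative \<Omega> u x * v x)
     = (\<Sum>E\<in>polygon_edges \<Omega>. norm (edge_vector E) * (\<sigma> * (flux_density E \<bullet> edge_normal \<Omega> E)))"
  unfolding boundary_integral_def
proof (rule sum.cong[OF refl])
  fix E assume E: "E \<in> polygon_edges \<Omega>"
  let ?n = "edge_normal \<Omega> E"
  let ?h = "\<lambda>s. (norm (edge_vector E) * \<sigma>) * (indicator {0<..<1} s *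
      (blinfun_apply (u' (edge_point E s)) ?n * v (edge_point E s)))"
  have ae: "AE s in lborel. indicator {0..1} s *\<^sub>R (\<sigma> * normal_derivative \<Omega> u (edge_point E s) * v (edge_point E s) * norm (edge_vector E))
      = ?h s"
    using AE_lborel_singleton[of 0] AE_lborel_singleton[of 1]
  proof eventually_elim
    case (elim s)
    show ?case
    proof (cases "s \<in> {0<..<1}")
      case True
      then have s: "0 < s" "s < 1" by auto
      have "infdist (edge_point E s) (frontier \<Omega>) < \<rho>"
        using edge_point_frontier[OF E, of s] s \<rho> by (simp add: infdist_zero)
      then have "frechet_derivative u (at (edge_point E s)) = blinfun_apply (u' (edge_point E s))"
        by (intro frechet_derivative_at[symmetric] u_deriv)
      then have "normal_derivative \<Omega> u (edge_point E s) = blinfun_apply (u' (edge_point E s)) ?n"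
        unfolding normal_derivative_def outward_normal_edge_point[OF polygon E s] by simp
      then show ?thesis using s by simp
    next
      case False
      then have "s \<notin> {0..1}" using elim by auto
      then show ?thesis using False by simp
    qed
  qed
  have hb: "?h \<in> borel_measurable borel" by (rule borel_measurable_times[OF borel_measurable_const edge_integrand_borel[OF E]])
  have "segment_integral E (\<lambda>x. \<sigma> * normal_derivative \<Omega> u x * v x) = (\<integral>s. ?h s \<partial>lborel)"
    unfolding segment_integral_edge_point set_lebesgue_integral_def
    by (rule integral_lebesgue_eq_lborel[OF hb ae])
  also have "\<dots> = norm (edge_vector E) * (\<sigma> * (flux_density E \<bullet> ?n))"
    unfolding flux_density_inner[OF E] by simp
  finally show "segment_integral E (\<lambda>x. \<sigma> * normal_derivative \<Omega> u x * v x)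
    = norm (edge_vector E) * (\<sigma> * (flux_density E \<bullet> ?n))" .
qed

text \<open>
  The integrand for a pair \<open>x\<close>, \<open>x + z\<close> that is separated by the boundary. The weight \<open>v\<close> is taken at
  \<open>x + \<theta> *\<^sub>R z\<close>: at the inner point for \<open>\<theta> = 0\<close>, as in the first operator, and at the
  outer one for \<open>\<theta> = 1\<close>, as in the other two.
\<close>

definition crossing :: "real \<Rightarrow> real^2 \<Rightarrow> real^2 \<Rightarrow> real" where
  "crossing \<theta> x z = indicator \<Omega> x * indicator (- closure \<Omega>) (x + z) * ((U (x + z) - U x) * V (x + \<theta> *\<^sub>R z))"

lemma sets_polygon [measurable]: "\<Omega> \<in> sets borel" "closure \<Omega> \<in> sets borel"
  using polygon_open[OF polygon] by simp_all

lemma crossing_measurable [measurable (raw)]: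
  assumes [measurable]: "f \<in> N \<rightarrow>\<^sub>M borel" "h \<in> N \<rightarrow>\<^sub>M borel"
  shows "(\<lambda>w. crossing \<theta> (f w) (h w)) \<in> borel_measurable N"
  unfolding crossing_def by measurable

lemma segment_in_ball:
  fixes x z p :: "real^2"
  assumes "0 \<le> \<theta>" "\<theta> \<le> 1" "x \<in> ball p r" "x + z \<in> ball p (r::real)"
  shows "x + \<theta> *\<^sub>R z \<in> ball p (r::real)"
proof -
  have "(1 - \<theta>) *\<^sub>R x + \<theta> *\<^sub>R (x + z) \<in> ball p r"
    using assms by (intro convexD[OF convex_ball]) auto
  moreover have "(1 - \<theta>) *\<^sub>R x + \<theta> *\<^sub>R (x + z) = x + \<theta> *\<^sub>R z" by (simp add: algebra_simps)
  ultimately show ?thesis by (simp only:)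
qed

lemma crossing_bound:
  assumes z: "norm z < \<rho>/2" and \<theta>: "0 \<le> \<theta>" "\<theta> \<le> 1"
  shows "\<bar>crossing \<theta> x z\<bar> \<le> M * norm z * M * indicator \<Omega> x"
proof (cases "x \<in> \<Omega> \<and> x + z \<notin> closure \<Omega>")
  case True
  then have xz: "x \<in> \<Omega>" "x + z \<notin> \<Omega>" using closure_subset by auto
  obtain p where p: "p \<in> frontier \<Omega>" "x \<in> ball p (\<rho>/2)" "x + z \<in> ball p (\<rho>/2)"
    by (rule frontier_point_near[OF xz, of "\<rho>/2"]) (use z in simp_all)
  have "\<bar>crossing \<theta> x z\<bar> \<le> \<bar>U (x + z) - U x\<bar> * \<bar>V (x + \<theta> *\<^sub>R z)\<bar>"
    unfolding crossing_def using True by (simp add: abs_mult)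
  also have "\<dots> \<le> (M * norm z) * M"
    using U_lip[OF p(1,3,2)] V_bound[OF p(1) segment_in_ball[OF \<theta> p(2,3)]] M by (intro mult_mono) auto
  finally show ?thesis using True by simp
next
  case False
  then have "crossing \<theta> x z = 0" by (auto simp: crossing_def)
  then show ?thesis using M by simp
qed

text \<open>
  On the strips \<open>u(x+z) - u(x)\<close> is replaced by the derivative at the exit point with error
  \<open>M * \<delta> * norm z\<close>, and \<open>v\<close> by its value there with error \<open>M * \<delta>\<close>; the corners cost
  \<open>norm z * (norm z)\<^sup>2 \<le> \<delta> * (norm z)\<^sup>2\<close>.
\<close>

lemma crossing_integral_estimate:
  obtains C where "0 \<le> C"
    "\<And>\<theta> \<delta> z. 0 \<le> \<theta> \<Longrightarrow> \<theta> \<le> 1 \<Longrightarrow> \<delta> < \<rho>/2 \<Longrightarrow> norm z < \<delta> \<Longrightarrow>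
      \<bar>(\<integral>x. crossing \<theta> x z \<partial>lborel)
        - (\<Sum>E\<in>polygon_edges \<Omega>. norm (edge_vector E) * (max 0 (edge_normal \<Omega> E \<bullet> z) * (flux_density E \<bullet> z)))\<bar>
      \<le> C * \<delta> * (norm z)\<^sup>2"
proof (rule exit_set_integral_approx[OF polygon], goal_cases)
  case (1 C0)
  note C0 = 1(2) and est = 1(3)
  show ?thesis
  proof (rule that[of "C0 * (3 * M * M)"])
    show "0 \<le> C0 * (3 * M * M)" using C0 M by simp
    fix \<theta> \<delta> :: real and z :: "real^2"
    assume \<theta>: "0 \<le> \<theta>" "\<theta> \<le> 1" and \<delta>: "\<delta> < \<rho>/2" and z: "norm z < \<delta>"
    let ?f = "\<lambda>x. (U (x + z) - U x) * V (x + \<theta> *\<^sub>R z)"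
    let ?D = "\<lambda>E s. blinfun_apply (u' (edge_point E s)) z * v (edge_point E s)"
    let ?H = "\<lambda>E s. indicator {0<..<1} s * ?D E s"
    have \<delta>pos: "0 < \<delta>" using z norm_ge_zero[of z] by linarith
    have strip: "edge_point E s \<in> frontier \<Omega>" "edge_point E s - t *\<^sub>R z \<in> ball (edge_point E s) \<delta>"
        "edge_point E s - t *\<^sub>R z + z \<in> ball (edge_point E s) \<delta>"
      if E: "E \<in> polygon_edges \<Omega>" and st: "0 < s" "s < 1" "0 < t" "t < 1" for E s t
    proof -
      show "edge_point E s \<in> frontier \<Omega>" using edge_point_frontier[OF E] st by simp
      have "norm (t *\<^sub>R z) \<le> 1 * norm z" using st by (simp add: mult_left_le_one_le)
      then show "edge_point E s - t *\<^sub>R z \<in> ball (edge_point E s) \<delta>" using z by (simp add: dist_norm)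
      have "norm ((1 - t) *\<^sub>R z) \<le> 1 * norm z" using st by (simp add: mult_left_le_one_le)
      moreover have "edge_point E s - (edge_point E s - t *\<^sub>R z + z) = - ((1 - t) *\<^sub>R z)"
        by (simp add: algebra_simps)
      ultimately show "edge_point E s - t *\<^sub>R z + z \<in> ball (edge_point E s) \<delta>" using z by (simp add: dist_norm)
    qed
    have half: "x \<in> ball p (\<rho>/2)" if "x \<in> ball p \<delta>" for x p :: "real^2" using that \<delta> by simp
    have fb: "?f \<in> borel_measurable borel" by measurable
    have "\<bar>(\<integral>x. indicator (exit_set \<Omega> z) x * ?f x \<partial>lborel)
        - (\<Sum>E\<in>polygon_edges \<Omega>. norm (edge_vector E) * max 0 (edge_normal \<Omega> E \<bullet> z) *
             (\<integral>s. indicator {0<..<1} s * ?H E s \<partial>lborel))\<bar>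
        \<le> C0 * ((M * norm z * M) * (norm z)\<^sup>2 + (2 * M * M * \<delta> * norm z) * norm z)"
    proof (rule est[OF fb])
      show "0 \<le> M * norm z * M" "0 \<le> 2 * M * M * \<delta> * norm z" using M \<delta>pos by auto
      show "\<bar>?f x\<bar> \<le> M * norm z * M" if E: "E \<in> polygon_edges \<Omega>" and x: "x \<in> exit_strip E z" for E x
      proof -
        obtain s t where st: "0 < s" "s < 1" "0 < t" "t < 1" and xe: "x = edge_point E s - t *\<^sub>R z"
          using x unfolding exit_strip_def by blast
        note S = strip[OF E st, folded xe]
        have "\<bar>U (x + z) - U x\<bar> \<le> M * norm z" using U_lip[OF S(1) half[OF S(3)] half[OF S(2)]] by simp
        moreover have "\<bar>V (x + \<theta> *\<^sub>R z)\<bar> \<le> M"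
          by (rule V_bound[OF S(1) segment_in_ball[OF \<theta> half[OF S(2)] half[OF S(3)]]])
        ultimately show ?thesis unfolding abs_mult using M by (intro mult_mono) auto
      qed
      show "?H E \<in> borel_measurable borel" if "E \<in> polygon_edges \<Omega>" for E by (rule edge_integrand_borel[OF that])
      show "\<bar>?H E s\<bar> \<le> M * norm z * M" if "E \<in> polygon_edges \<Omega>" "0 < s" "s < 1" for E s
        using edge_integrand_bound[OF that, of z] that by simp
      show "\<bar>?f (edge_point E s - t *\<^sub>R z) - ?H E s\<bar> \<le> 2 * M * M * \<delta> * norm z"
        if E: "E \<in> polygon_edges \<Omega>" and st: "0 < s" "s < 1" "0 < t" "t < 1" for E s t
      proof -
        define x where "x = edge_point E s - t *\<^sub>R z"
        define p where "p = edge_point E s"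
        note S = strip[OF E st, folded x_def p_def]
        have pp: "p \<in> ball p \<delta>" using \<delta>pos by simp
        have xt: "x + \<theta> *\<^sub>R z \<in> ball p \<delta>" by (rule segment_in_ball[OF \<theta> S(2,3)])
        have Ux: "U x = u x" "U (x + z) = u (x + z)"
          using U_eq[OF S(1) half_ball[OF half[OF S(2)]]] U_eq[OF S(1) half_ball[OF half[OF S(3)]]] by auto
        have Vx: "V (x + \<theta> *\<^sub>R z) = v (x + \<theta> *\<^sub>R z)" by (rule V_eq[OF S(1) half_ball[OF half[OF xt]]])
        let ?L = "blinfun_apply (u' p) z"
        have "\<bar>u (x + z) - u x - blinfun_apply (u' p) (x + z - x)\<bar> \<le> M * \<delta> * norm (x + z - x)"
        proof (rule linearization_error[OF _ _ M S(2,3)])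
          fix w assume w: "w \<in> ball p \<delta>"
          have "w \<in> collar" by (rule ball_subset_collar[OF S(1) half_ball[OF half[OF w]]])
          then show "(u has_derivative blinfun_apply (u' w)) (at w)" by (intro u_deriv) (simp add: collar_def)
          show "norm (u' w - u' p) \<le> M * norm (w - p)" by (rule u'_lip[OF S(1) half[OF w] half[OF pp]])
        qed
        then have e1: "\<bar>u (x + z) - u x - ?L\<bar> \<le> M * \<delta> * norm z" by simp
        have e2: "\<bar>v (x + \<theta> *\<^sub>R z)\<bar> \<le> M" by (rule v_bound[OF S(1) half[OF xt]])
        have "\<bar>?L\<bar> \<le> norm (u' p) * norm z" using norm_blinfun[of "u' p" z] by simp
        also have "\<dots> \<le> M * norm z" using u'_bound[OF S(1) half[OF pp]] by (intro mult_right_mono) auto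
        finally have e3: "\<bar>?L\<bar> \<le> M * norm z" .
        have "\<bar>v (x + \<theta> *\<^sub>R z) - v p\<bar> \<le> M * norm (x + \<theta> *\<^sub>R z - p)" by (rule v_lip[OF S(1) half[OF xt] half[OF pp]])
        also have "\<dots> \<le> M * \<delta>" using xt M by (intro mult_left_mono) (simp_all add: dist_norm norm_minus_commute[of p])
        finally have e4: "\<bar>v (x + \<theta> *\<^sub>R z) - v p\<bar> \<le> M * \<delta>" .
        have "?f x - ?H E s = (u (x + z) - u x - ?L) * v (x + \<theta> *\<^sub>R z) + ?L * (v (x + \<theta> *\<^sub>R z) - v p)"
          unfolding Ux Vx p_def[symmetric] using st by (simp add: algebra_simps)
        also have "\<bar>\<dots>\<bar> \<le> \<bar>u (x + z) - u x - ?L\<bar> * \<bar>v (x + \<theta> *\<^sub>R z)\<bar> + \<bar>?L\<bar> * \<bar>v (x + \<theta> *\<^sub>R z) - v p\<bar>"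
          unfolding abs_mult[symmetric] by (rule abs_triangle_ineq)
        also have "\<dots> \<le> (M * \<delta> * norm z) * M + (M * norm z) * (M * \<delta>)"
          using e1 e2 e3 e4 M \<delta>pos by (intro add_mono mult_mono) auto
        finally show ?thesis unfolding x_def by (simp add: algebra_simps)
      qed
    qed
    also have "(\<lambda>x. indicator (exit_set \<Omega> z) x * ?f x) = (\<lambda>x. crossing \<theta> x z)"
      by (auto simp: fun_eq_iff crossing_def exit_set_def indicator_def)
    also have "(\<Sum>E\<in>polygon_edges \<Omega>. norm (edge_vector E) * max 0 (edge_normal \<Omega> E \<bullet> z) *
             (\<integral>s. indicator {0<..<1} s * ?H E s \<partial>lborel))
        = (\<Sum>E\<in>polygon_edges \<Omega>. norm (edge_vector E) * (max 0 (edge_normal \<Omega> E \<bullet> z) * (flux_density E \<bullet> z)))"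
    proof (rule sum.cong[OF refl])
      fix E assume E: "E \<in> polygon_edges \<Omega>"
      have "(\<integral>s. indicator {0<..<1} s * ?H E s \<partial>lborel) = (\<integral>s. ?H E s \<partial>lborel)"
        by (intro Bochner_Integration.integral_cong refl) (simp add: indicator_def)
      then show "norm (edge_vector E) * max 0 (edge_normal \<Omega> E \<bullet> z) * (\<integral>s. indicator {0<..<1} s * ?H E s \<partial>lborel)
        = norm (edge_vector E) * (max 0 (edge_normal \<Omega> E \<bullet> z) * (flux_density E \<bullet> z))"
        unfolding flux_density_inner[OF E] by simp
    qed
    also have "C0 * ((M * norm z * M) * (norm z)\<^sup>2 + (2 * M * M * \<delta> * norm z) * norm z) \<le> C0 * (3 * M * M) * \<delta> * (norm z)\<^sup>2"
    proof -
      have "(M * M * (norm z)\<^sup>2) * norm z \<le> (M * M * (norm z)\<^sup>2) * \<delta>" using z M by (intro mult_left_mono) auto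
      then have "(M * norm z * M) * (norm z)\<^sup>2 + (2 * M * M * \<delta> * norm z) * norm z \<le> (3 * M * M) * \<delta> * (norm z)\<^sup>2"
        by (simp add: algebra_simps power2_eq_square)
      then show ?thesis using mult_left_mono[OF _ C0] by (simp only: mult.assoc)
    qed
    finally show "\<bar>(\<integral>x. crossing \<theta> x z \<partial>lborel)
        - (\<Sum>E\<in>polygon_edges \<Omega>. norm (edge_vector E) * (max 0 (edge_normal \<Omega> E \<bullet> z) * (flux_density E \<bullet> z)))\<bar>
      \<le> C0 * (3 * M * M) * \<delta> * (norm z)\<^sup>2" .
  qed
qed

end

section \<open>Integration against the kernel\<close>

lemma moment_kernelD:
  assumes "moment_kernel \<delta> \<sigma> \<Gamma>"
  shows moment_kernel_borel: "\<Gamma> \<in> borel_measurable borel" and moment_kernel_nonneg: "0 \<le> \<Gamma> z"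
    and moment_kernel_support: "\<delta> \<le> norm z \<Longrightarrow> \<Gamma> z = 0" and moment_kernel_even: "\<Gamma> (- z) = \<Gamma> z"
    and moment_kernel_integrable: "integrable lborel \<Gamma>"
    and moment_kernel_integrable2: "integrable lborel (\<lambda>z. \<Gamma> z * (norm z)\<^sup>2)"
    and moment_kernel_second: "(\<integral>z. \<Gamma> z * (norm z)\<^sup>2 \<partial>lborel) = 4 * \<sigma>"
    and moment_kernel_half: "norm n = 1 \<Longrightarrow> (\<integral>z. \<Gamma> z * (max 0 (n \<bullet> z) * (a \<bullet> z)) \<partial>lborel) = \<sigma> * (a \<bullet> n)"
  using assms unfolding moment_kernel_def by blast+

lemma bounded_enlarged: "bounded \<Omega> \<Longrightarrow> bounded (enlarged \<delta> \<Omega>)"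
proof -
  assume "bounded \<Omega>"
  then obtain B where B: "\<And>x. x \<in> \<Omega> \<Longrightarrow> norm x \<le> B" unfolding bounded_iff by blast
  have "norm x \<le> B + \<bar>\<delta>\<bar>" if x: "x \<in> enlarged \<delta> \<Omega>" for x
  proof -
    obtain y where y: "y \<in> \<Omega>" "dist x y < \<delta>" using x unfolding enlarged_eq by (auto simp: ball_def)
    have "norm x \<le> norm y + norm (x - y)" by (rule norm_triangle_sub)
    then show ?thesis using B[OF y(1)] y(2) by (simp add: dist_norm)
  qed
  then show ?thesis unfolding bounded_iff by blast
qed

lemma bounded_outer_layer: "bounded \<Omega> \<Longrightarrow> bounded (outer_layer \<delta> \<Omega>)"
  by (rule bounded_subset[OF bounded_enlarged]) (auto simp: outer_layer_def)

lemma enlarged_borel: "enlarged \<delta> \<Omega> \<in> sets borel"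
  unfolding enlarged_def by simp

lemma outer_layer_borel: "outer_layer \<delta> \<Omega> \<in> sets borel"
  unfolding outer_layer_def using enlarged_borel by simp

text \<open>
  About \<open>1 / \<delta>\<close> equally spaced points on each edge are so dense that balls of radius proportional to \<open>\<delta>\<close>
  around them cover the layer; each ball has area of order \<open>\<delta>\<^sup>2\<close>.
\<close>

lemma measure_outer_layer:
  assumes polygon: "convex_polygon \<Omega>"
  obtains C where "0 \<le> C" "\<And>\<delta>. 0 < \<delta> \<Longrightarrow> \<delta> \<le> 1 \<Longrightarrow> measure lborel (outer_layer \<delta> \<Omega>) \<le> C * \<delta>"
proof -
  let ?E = "polygon_edges \<Omega>" and ?L = "\<lambda>E. norm (edge_vector E) + 1"
  have fin: "finite ?E" by (rule polygon_finite_edges[OF polygon])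
  define C where "C = (\<Sum>E\<in>?E. 3 * (pi * (?L E)\<^sup>2))"
  show ?thesis
  proof (rule that[of C])
    show "0 \<le> C" unfolding C_def by (intro sum_nonneg) simp
    fix \<delta> :: real assume \<delta>: "0 < \<delta>" "\<delta> \<le> 1"
    define m where "m = nat \<lceil>1 / \<delta>\<rceil>"
    have m: "1 / \<delta> \<le> real m" "real m \<le> 1 / \<delta> + 1" using \<delta> by (auto simp: m_def)
    have m0: "0 < m"
    proof -
      have "0 < 1 / \<delta>" using \<delta> by simp
      then have "0 < real m" using m by linarith
      then show ?thesis by simp
    qed
    let ?T = "\<lambda>E. \<Union>k\<in>{..m}. ball (edge_point E (real k / real m)) (?L E * \<delta>)"
    have cover: "outer_layer \<delta> \<Omega> \<subseteq> (\<Union>E\<in>?E. ?T E)"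
    proof
      fix x assume "x \<in> outer_layer \<delta> \<Omega>"
      then obtain p where p: "p \<in> frontier \<Omega>" "x \<in> ball p \<delta>" by (rule outer_layer_near_frontier)
      then obtain E where E: "E \<in> ?E" "p \<in> E" using frontier_eq_Union_edges[OF polygon] by blast
      obtain s where s: "0 \<le> s" "s \<le> 1" and ps: "p = edge_point E s"
        using edge_point_in_edge(2)[OF polygon E] by blast
      define k where "k = nat \<lfloor>s * m\<rfloor>"
      have k: "real k \<le> s * m" "s * m < real k + 1" using s by (auto simp: k_def)
      have "s * m \<le> 1 * real m" using s by (intro mult_right_mono) auto
      then have km: "k \<le> m" using k(1) by linarith
      have "\<bar>s - real k / real m\<bar> = (s * m - real k) / m" using k m0 by (simp add: field_simps)
      also have "\<dots> \<le> 1 / m" using k by (intro divide_right_mono) auto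
      also have "\<dots> \<le> \<delta>" using m \<delta> m0 by (simp add: field_simps)
      finally have sk: "\<bar>s - real k / real m\<bar> \<le> \<delta>" .
      have "dist (edge_point E (real k / real m)) p = norm ((s - real k / real m) *\<^sub>R edge_vector E)"
        unfolding ps edge_point_def by (simp add: dist_norm norm_minus_commute algebra_simps)
      also have "\<dots> \<le> \<delta> * norm (edge_vector E)" using sk by (simp add: mult_right_mono)
      finally have "dist (edge_point E (real k / real m)) x < \<delta> * norm (edge_vector E) + \<delta>"
        using p(2) dist_triangle[of "edge_point E (real k / real m)" x p] by simp
      then have "x \<in> ball (edge_point E (real k / real m)) (?L E * \<delta>)" by (simp add: algebra_simps)
      then show "x \<in> (\<Union>E\<in>?E. ?T E)" using E(1) km by blast
    qed
    have T: "measure lborel (?T E) \<le> 3 * (pi * (?L E)\<^sup>2) * \<delta>" if "E \<in> ?E" for E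
    proof -
      have "measure lborel (?T E) \<le> (\<Sum>k\<in>{..m}. measure lborel (ball (edge_point E (real k / real m)) (?L E * \<delta>)))"
        by (rule measure_UNION_le) auto
      also have "\<dots> = (real m + 1) * (pi * (?L E * \<delta>)\<^sup>2)"
        using \<delta> by (simp add: content_ball eval_unit_ball_vol)
      also have "\<dots> \<le> (3 / \<delta>) * (pi * (?L E * \<delta>)\<^sup>2)"
      proof (rule mult_right_mono)
        have "1 \<le> 1 / \<delta>" using \<delta> by simp
        then show "real m + 1 \<le> 3 / \<delta>" using m by simp
      qed simp
      also have "\<dots> = 3 * (pi * (?L E)\<^sup>2) * \<delta>" using \<delta> by (simp add: power2_eq_square)
      finally show ?thesis .
    qed
    have "measure lborel (outer_layer \<delta> \<Omega>) \<le> measure lborel (\<Union>E\<in>?E. ?T E)"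
    proof (rule measure_mono_fmeasurable[OF cover])
      show "outer_layer \<delta> \<Omega> \<in> sets lborel" using outer_layer_borel by simp
      have "bounded (\<Union>E\<in>?E. ?T E)" using fin by (intro bounded_UN ballI) auto
      then show "(\<Union>E\<in>?E. ?T E) \<in> fmeasurable lborel"
        by (intro fmeasurableI emeasure_bounded_finite) (auto intro!: borel_open)
    qed
    also have "\<dots> \<le> (\<Sum>E\<in>?E. measure lborel (?T E))"
      using fin by (intro measure_UNION_le) auto
    also have "\<dots> \<le> (\<Sum>E\<in>?E. 3 * (pi * (?L E)\<^sup>2) * \<delta>)" by (intro sum_mono T)
    also have "\<dots> = C * \<delta>" by (simp add: C_def sum_distrib_right)
    finally show "measure lborel (outer_layer \<delta> \<Omega>) \<le> C * \<delta>" .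
  qed
qed

context polygon_collar
begin

text \<open>
  Integration of \<open>crossing_integral_estimate\<close> against the kernel. The main term is evaluated edge by edge by
  the half plane moment, and the error is \<open>C * \<delta>\<close> times the second moment \<open>4 * \<sigma>\<close>.
\<close>

lemma crossing_flux_estimate:
  obtains C where "0 \<le> C"
    "\<And>\<sigma> \<Gamma> \<theta> \<delta>. moment_kernel \<delta> \<sigma> \<Gamma> \<Longrightarrow> 0 \<le> \<theta> \<Longrightarrow> \<theta> \<le> 1 \<Longrightarrow> 0 < \<delta> \<Longrightarrow> \<delta> < \<rho>/2 \<Longrightarrow>
      \<bar>(\<integral>z. \<Gamma> z * (\<integral>x. crossing \<theta> x z \<partial>lborel) \<partial>lborel)
        - boundary_integral \<Omega> (\<lambda>x. \<sigma> * normal_derivative \<Omega> u x * v x)\<bar> \<le> C * \<sigma> * \<delta>"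
proof (rule crossing_integral_estimate, goal_cases)
  case (1 C)
  note C = 1(2,3)
  show ?thesis
  proof (rule that[of "C * 4"])
    show "0 \<le> C * 4" using C(1) by simp
    fix \<sigma> \<theta> \<delta> :: real and \<Gamma> :: "real^2 \<Rightarrow> real"
    assume mk: "moment_kernel \<delta> \<sigma> \<Gamma>" and \<theta>: "0 \<le> \<theta>" "\<theta> \<le> 1" and \<delta>: "0 < \<delta>" "\<delta> < \<rho>/2"
    note [measurable] = moment_kernel_borel[OF mk]
    let ?F = "\<lambda>z. \<integral>x. crossing \<theta> x z \<partial>lborel"
    let ?s = "\<lambda>E z. max 0 (edge_normal \<Omega> E \<bullet> z) * (flux_density E \<bullet> z)"
    let ?S = "\<lambda>z. \<Sum>E\<in>polygon_edges \<Omega>. norm (edge_vector E) * ?s E z"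
    have [measurable]: "?F \<in> borel_measurable lborel" by measurable
    have sint: "integrable lborel (\<lambda>z. \<Gamma> z * ?s E z)" if E: "E \<in> polygon_edges \<Omega>" for E
    proof (rule Bochner_Integration.integrable_bound)
      show "integrable lborel (\<lambda>z. norm (flux_density E) * (\<Gamma> z * (norm z)\<^sup>2))"
        using moment_kernel_integrable2[OF mk] by simp
      show "AE z in lborel. norm (\<Gamma> z * ?s E z) \<le> norm (norm (flux_density E) * (\<Gamma> z * (norm z)\<^sup>2))"
      proof (rule AE_I2)
        fix z :: "real^2"
        have "\<bar>max 0 (edge_normal \<Omega> E \<bullet> z)\<bar> \<le> norm z" using normal_component_le[OF polygon E, of z] by simp
        moreover have "\<bar>flux_density E \<bullet> z\<bar> \<le> norm (flux_density E) * norm z" by (rule Cauchy_Schwarz_ineq2)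
        ultimately have "\<bar>?s E z\<bar> \<le> norm z * (norm (flux_density E) * norm z)"
          unfolding abs_mult by (intro mult_mono) auto
        then have "\<Gamma> z * \<bar>?s E z\<bar> \<le> \<Gamma> z * (norm z * (norm (flux_density E) * norm z))"
          using moment_kernel_nonneg[OF mk] by (intro mult_left_mono)
        then show "norm (\<Gamma> z * ?s E z) \<le> norm (norm (flux_density E) * (\<Gamma> z * (norm z)\<^sup>2))"
          using moment_kernel_nonneg[OF mk, of z] by (simp add: abs_mult power2_eq_square mult_ac)
      qed
    qed simp
    have eqS: "\<Gamma> z * ?S z = (\<Sum>E\<in>polygon_edges \<Omega>. norm (edge_vector E) * (\<Gamma> z * ?s E z))" for z
      by (simp add: sum_distrib_left mult_ac)
    have Sint: "integrable lborel (\<lambda>z. \<Gamma> z * ?S z)"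
      unfolding eqS using sint by (intro Bochner_Integration.integrable_sum integrable_mult_right)
    have Sval: "(\<integral>z. \<Gamma> z * ?S z \<partial>lborel) = boundary_integral \<Omega> (\<lambda>x. \<sigma> * normal_derivative \<Omega> u x * v x)"
    proof -
      have "(\<integral>z. \<Gamma> z * ?S z \<partial>lborel) = (\<Sum>E\<in>polygon_edges \<Omega>. \<integral>z. norm (edge_vector E) * (\<Gamma> z * ?s E z) \<partial>lborel)"
        unfolding eqS by (rule Bochner_Integration.integral_sum, intro integrable_mult_right sint)
      also have "\<dots> = (\<Sum>E\<in>polygon_edges \<Omega>. norm (edge_vector E) * (\<sigma> * (flux_density E \<bullet> edge_normal \<Omega> E)))"
        using moment_kernel_half[OF mk norm_edge_normal[OF polygon]] by (intro sum.cong refl) simp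
      finally show ?thesis unfolding boundary_integral_flux .
    qed
    have bnd: "\<bar>\<Gamma> z * (?F z - ?S z)\<bar> \<le> C * \<delta> * (\<Gamma> z * (norm z)\<^sup>2)" for z
    proof (cases "norm z < \<delta>")
      case True
      have "\<bar>\<Gamma> z * (?F z - ?S z)\<bar> = \<Gamma> z * \<bar>?F z - ?S z\<bar>"
        using moment_kernel_nonneg[OF mk, of z] by (simp add: abs_mult)
      also have "\<dots> \<le> \<Gamma> z * (C * \<delta> * (norm z)\<^sup>2)"
        by (rule mult_left_mono[OF C(2)[OF \<theta> \<delta>(2) True] moment_kernel_nonneg[OF mk]])
      finally show ?thesis by (simp add: mult_ac)
    qed (simp add: moment_kernel_support[OF mk])
    have dom: "integrable lborel (\<lambda>z. C * \<delta> * (\<Gamma> z * (norm z)\<^sup>2))" using moment_kernel_integrable2[OF mk] by simp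
    have Dint: "integrable lborel (\<lambda>z. \<Gamma> z * (?F z - ?S z))"
    proof (rule Bochner_Integration.integrable_bound[OF dom])
      show "AE z in lborel. norm (\<Gamma> z * (?F z - ?S z)) \<le> norm (C * \<delta> * (\<Gamma> z * (norm z)\<^sup>2))"
        using order_trans[OF bnd abs_ge_self] by (intro AE_I2) (simp only: real_norm_def)
    qed measurable
    have "(\<integral>z. \<Gamma> z * ?F z \<partial>lborel) = (\<integral>z. \<Gamma> z * (?F z - ?S z) + \<Gamma> z * ?S z \<partial>lborel)"
      by (simp add: algebra_simps)
    also have "\<dots> = (\<integral>z. \<Gamma> z * (?F z - ?S z) \<partial>lborel) + (\<integral>z. \<Gamma> z * ?S z \<partial>lborel)"
      by (rule Bochner_Integration.integral_add[OF Dint Sint])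
    finally have "(\<integral>z. \<Gamma> z * ?F z \<partial>lborel) - boundary_integral \<Omega> (\<lambda>x. \<sigma> * normal_derivative \<Omega> u x * v x)
        = (\<integral>z. \<Gamma> z * (?F z - ?S z) \<partial>lborel)" unfolding Sval by simp
    also have "\<bar>\<dots>\<bar> \<le> (\<integral>z. C * \<delta> * (\<Gamma> z * (norm z)\<^sup>2) \<partial>lborel)"
      by (rule integral_abs_bound_integral[OF Dint dom bnd])
    also have "\<dots> = C * 4 * \<sigma> * \<delta>" using moment_kernel_second[OF mk] by simp
    finally show "\<bar>(\<integral>z. \<Gamma> z * ?F z \<partial>lborel) - boundary_integral \<Omega> (\<lambda>x. \<sigma> * normal_derivative \<Omega> u x * v x)\<bar> \<le> C * 4 * \<sigma> * \<delta>" .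
  qed
qed

end

section \<open>The three Neumann operators\<close>

context polygon_collar
begin

context
  fixes g :: "real \<Rightarrow> real \<Rightarrow> real" and \<sigma> \<delta> :: real and \<Gamma> :: "real^2 \<Rightarrow> real"
  assumes \<delta>: "0 < \<delta>" "\<delta> < \<rho>/4" and mk: "moment_kernel \<delta> \<sigma> \<Gamma>"
    and g: "AE z in lborel. g \<delta> (norm z) = \<Gamma> z"
begin

lemmas \<Gamma>_borel [measurable] = moment_kernel_borel[OF mk]
lemmas \<Gamma>_nonneg = moment_kernel_nonneg[OF mk]
lemmas \<Gamma>_even = moment_kernel_even[OF mk]

lemma \<Gamma>_support: "\<Gamma> z \<noteq> 0 \<Longrightarrow> norm z < \<delta>"
  using moment_kernel_support[OF mk, of z] by force

lemma AE_kern: "AE y in lborel. kern g \<delta> x y = \<Gamma> (y - x)"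
  using AE_lborel_translate[OF g, of x] by (simp add: kern_def norm_minus_commute[of x])

lemma layer_values:
  shows "x \<in> inner_layer \<delta> \<Omega> \<Longrightarrow> U x = u x \<and> V x = v x"
    and "x \<in> outer_layer \<delta> \<Omega> \<Longrightarrow> U x = u x \<and> V x = v x"
proof -
  have *: "U x = u x \<and> V x = v x" if p: "p \<in> frontier \<Omega>" "x \<in> ball p \<delta>" for p x
  proof -
    have "x \<in> ball p \<rho>" using p(2) \<delta> by simp
    then show ?thesis using U_eq[OF p(1)] V_eq[OF p(1)] by simp
  qed
  show "x \<in> inner_layer \<delta> \<Omega> \<Longrightarrow> U x = u x \<and> V x = v x"
    by (rule inner_layer_near_frontier[OF \<delta>(1)]) (assumption, rule *)
  show "x \<in> outer_layer \<delta> \<Omega> \<Longrightarrow> U x = u x \<and> V x = v x"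
    by (rule outer_layer_near_frontier) (assumption, rule *)
qed

text \<open>
  Within range of the kernel the layers are no restriction: any pair separated by the boundary has its
  points in the two layers.
\<close>

lemma layers_opposite:
  assumes "norm (y - x) < \<delta>"
  shows "x \<in> \<Omega> \<Longrightarrow> y \<notin> closure \<Omega> \<Longrightarrow> x \<in> inner_layer \<delta> \<Omega> \<and> y \<in> outer_layer \<delta> \<Omega>"
proof -
  assume x: "x \<in> \<Omega>" and y: "y \<notin> closure \<Omega>"
  have "y \<in> ball x \<delta>" "x \<in> ball y \<delta>" using assms by (simp_all add: dist_norm norm_minus_commute[of x])
  moreover have "y \<notin> \<Omega>" using y closure_subset by blast
  ultimately show ?thesis unfolding inner_layer_eq[OF \<delta>(1)] outer_layer_eq using x y by blast
qed

text \<open>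
  The kernel vanishes beyond its range, so only the points within distance \<open>\<delta>\<close> of \<open>x\<close> matter. There
  the layers coincide, up to null sets, with sets that are easier to integrate over.
\<close>

lemma kern_integral_representation:
  assumes x: "U x = u x" and T[measurable]: "T \<in> sets borel"
    and ae: "AE y in lborel. norm (y - x) < \<delta> \<longrightarrow> (y \<in> S \<longleftrightarrow> y \<in> T) \<and> (y \<in> S \<longrightarrow> U y = u y)"
  shows "(LINT y:S|lebesgue. (u x - u y) * kern g \<delta> x y) = (\<integral>y. indicator T y * ((U x - U y) * \<Gamma> (y - x)) \<partial>lborel)"
  unfolding set_lebesgue_integral_def
proof (rule integral_lebesgue_eq_lborel)
  show "AE y in lborel. indicator S y *\<^sub>R ((u x - u y) * kern g \<delta> x y) = indicator T y * ((U x - U y) * \<Gamma> (y - x))"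
    using AE_kern[of x] ae
  proof eventually_elim
    case (elim y)
    show ?case
    proof (cases "norm (y - x) < \<delta>")
      case True
      then show ?thesis using elim x by (simp add: indicator_def)
    next
      case False
      then have "\<Gamma> (y - x) = 0" using \<Gamma>_support by blast
      then show ?thesis using elim(1) by simp
    qed
  qed
qed measurable

lemma neumann_minus_crossing:
  "indicator (inner_layer \<delta> \<Omega>) x *\<^sub>R (neumann_minus g \<delta> \<Omega> u x * v x) = (\<integral>z. \<Gamma> z * crossing 0 x z \<partial>lborel)"
proof (cases "x \<in> inner_layer \<delta> \<Omega>")
  case True
  then have x: "x \<in> \<Omega>" by (simp add: inner_layer_def)
  note ux = layer_values(1)[OF True]
  let ?h = "\<lambda>y. indicator (- closure \<Omega>) y * ((U x - U y) * \<Gamma> (y - x))"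
  have hb: "?h \<in> borel_measurable borel" by measurable
  have "(LINT y:outer_layer \<delta> \<Omega>|lebesgue. (u x - u y) * kern g \<delta> x y) = (\<integral>y. ?h y \<partial>lborel)"
  proof (intro kern_integral_representation AE_I2 impI conjI)
    fix y assume "norm (y - x) < \<delta>"
    then show "y \<in> outer_layer \<delta> \<Omega> \<longleftrightarrow> y \<in> - closure \<Omega>"
      using layers_opposite[of y x] x by (auto simp: outer_layer_def)
  qed (use ux layer_values(2) sets_polygon in auto)
  also have "\<dots> = (\<integral>z. ?h (x + z) \<partial>lborel)" by (rule integral_lborel_translate[OF hb, symmetric])
  finally have "neumann_minus g \<delta> \<Omega> u x * v x = (\<integral>z. ?h (x + z) * (- V x) \<partial>lborel)"
    unfolding neumann_minus_def using ux by simp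
  also have "\<dots> = (\<integral>z. \<Gamma> z * crossing 0 x z \<partial>lborel)"
    using x by (intro Bochner_Integration.integral_cong refl) (simp add: crossing_def algebra_simps)
  finally show ?thesis using True by simp
next
  case False
  have "\<Gamma> z * crossing 0 x z = 0" for z
  proof (rule ccontr)
    assume "\<Gamma> z * crossing 0 x z \<noteq> 0"
    then have "\<Gamma> z \<noteq> 0" "x \<in> \<Omega>" "x + z \<notin> closure \<Omega>" by (auto simp: crossing_def indicator_def split: if_splits)
    then show False using layers_opposite[of "x + z" x] \<Gamma>_support[of z] False by simp
  qed
  then have zero: "(\<lambda>z. \<Gamma> z * crossing 0 x z) = (\<lambda>_. 0)" by (rule ext)
  show ?thesis unfolding zero using False by simp
qed

lemma kernel_dominated:
  assumes "norm z < \<delta> \<Longrightarrow> \<bar>F\<bar> \<le> M * norm z * M * indicator S x"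
  shows "\<bar>\<Gamma> z * F\<bar> \<le> (M * \<delta> * M) * indicator S x * \<Gamma> z"
proof (cases "\<Gamma> z = 0")
  case False
  then have z: "norm z < \<delta>" by (rule \<Gamma>_support)
  have "\<bar>F\<bar> \<le> M * norm z * M * indicator S x" by (rule assms[OF z])
  also have "\<dots> \<le> M * \<delta> * M * indicator S x" using z M by (intro mult_right_mono mult_left_mono) auto
  finally have "\<Gamma> z * \<bar>F\<bar> \<le> \<Gamma> z * (M * \<delta> * M * indicator S x)"
    using \<Gamma>_nonneg by (rule mult_left_mono)
  then show ?thesis using \<Gamma>_nonneg[of z] by (simp add: abs_mult mult_ac)
qed simp

lemma crossing_dominated:
  assumes "0 \<le> \<theta>" "\<theta> \<le> 1"
  shows "\<bar>\<Gamma> z * crossing \<theta> x z\<bar> \<le> (M * \<delta> * M) * indicator \<Omega> x * \<Gamma> z"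
  by (rule kernel_dominated, rule crossing_bound) (use assms \<delta> in auto)

lemma neumann_minus_integral:
  "(LINT x:inner_layer \<delta> \<Omega>|lebesgue. neumann_minus g \<delta> \<Omega> u x * v x)
     = (\<integral>z. \<Gamma> z * (\<integral>x. crossing 0 x z \<partial>lborel) \<partial>lborel)"
proof -
  have m: "(\<lambda>(x, z). \<Gamma> z * crossing 0 x z) \<in> borel_measurable (lborel \<Otimes>\<^sub>M lborel)" by measurable
  have "(LINT x:inner_layer \<delta> \<Omega>|lebesgue. neumann_minus g \<delta> \<Omega> u x * v x)
      = (\<integral>x. (\<integral>z. \<Gamma> z * crossing 0 x z \<partial>lborel) \<partial>lborel)"
    unfolding set_lebesgue_integral_def neumann_minus_crossing
  proof (rule integral_lebesgue_eq_lborel)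
    have "(\<lambda>x. (\<integral>z. \<Gamma> z * crossing 0 x z \<partial>lborel)) \<in> borel_measurable lborel" by measurable
    then show "(\<lambda>x. (\<integral>z. \<Gamma> z * crossing 0 x z \<partial>lborel)) \<in> borel_measurable borel" by simp
  qed simp
  also have "\<dots> = (\<integral>z. (\<integral>x. \<Gamma> z * crossing 0 x z \<partial>lborel) \<partial>lborel)"
    by (rule integral_swap_dominated[OF m sets_polygon(1) polygon_bounded[OF polygon] moment_kernel_integrable[OF mk]
          crossing_dominated]) simp_all
  finally show ?thesis by simp
qed

text \<open>
  For the second and third operator the outer point is the variable of the outer integral; the inner point
  is then \<open>x - z\<close>, and \<open>crossing\<close> is evaluated there.
\<close>

lemma crossing_shift_dominated:
  "\<bar>\<Gamma> z * crossing 1 (x - z) z\<bar> \<le> (M * \<delta> * M) * indicator (outer_layer \<delta> \<Omega>) x * \<Gamma> z"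
proof (cases "x \<in> outer_layer \<delta> \<Omega>")
  case True
  have "\<bar>\<Gamma> z * crossing 1 (x - z) z\<bar> \<le> (M * \<delta> * M) * indicator \<Omega> (x - z) * \<Gamma> z" by (rule crossing_dominated) simp_all
  also have "\<dots> \<le> (M * \<delta> * M) * 1 * \<Gamma> z"
    using M \<delta> \<Gamma>_nonneg by (intro mult_right_mono mult_left_mono) (auto simp: indicator_def)
  finally show ?thesis using True by simp
next
  case False
  have "\<Gamma> z * crossing 1 (x - z) z = 0"
  proof (rule ccontr)
    assume "\<Gamma> z * crossing 1 (x - z) z \<noteq> 0"
    then have "\<Gamma> z \<noteq> 0" "x - z \<in> \<Omega>" "x \<notin> closure \<Omega>" by (auto simp: crossing_def indicator_def split: if_splits)
    then show False using layers_opposite[of x "x - z"] \<Gamma>_support[of z] False by simp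
  qed
  then show ?thesis using False by simp
qed

text \<open>
  The additional integrand of the third operator, for two points that both lie in the outer layer.
\<close>

definition outside_part :: "real^2 \<Rightarrow> real^2 \<Rightarrow> real" where
  "outside_part x z = indicator (outer_layer \<delta> \<Omega>) x * indicator (outer_layer \<delta> \<Omega>) (x + z) * ((U x - U (x + z)) * V x)"

lemma inside_integral:
  assumes x: "x \<in> outer_layer \<delta> \<Omega>"
  shows "(\<integral>y. indicator \<Omega> y * ((U x - U y) * \<Gamma> (y - x)) \<partial>lborel) * V x = (\<integral>z. \<Gamma> z * crossing 1 (x - z) z \<partial>lborel)"
proof -
  let ?h = "\<lambda>y. indicator \<Omega> y * ((U x - U y) * \<Gamma> (y - x))"
  have hb: "?h \<in> borel_measurable borel" by measurable
  have "x \<notin> closure \<Omega>" using x by (simp add: outer_layer_def)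
  have "(\<integral>y. ?h y \<partial>lborel) = (\<integral>z. ?h (x - z) \<partial>lborel)" by (rule integral_lborel_reflect[OF hb, symmetric])
  then have "(\<integral>y. ?h y \<partial>lborel) * V x = (\<integral>z. ?h (x - z) * V x \<partial>lborel)" by simp
  also have "\<dots> = (\<integral>z. \<Gamma> z * crossing 1 (x - z) z \<partial>lborel)"
    using \<open>x \<notin> closure \<Omega>\<close> by (intro Bochner_Integration.integral_cong refl) (simp add: crossing_def \<Gamma>_even)
  finally show ?thesis .
qed

lemma crossing_shift_zero: "x \<notin> outer_layer \<delta> \<Omega> \<Longrightarrow> (\<integral>z. \<Gamma> z * crossing 1 (x - z) z \<partial>lborel) = 0"
proof -
  assume x: "x \<notin> outer_layer \<delta> \<Omega>"
  have "\<Gamma> z * crossing 1 (x - z) z = 0" for z using crossing_shift_dominated[of z x] x by simp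
  then have zero: "(\<lambda>z. \<Gamma> z * crossing 1 (x - z) z) = (\<lambda>_. 0)" by (rule ext)
  show ?thesis unfolding zero by simp
qed

lemma neumann_plus_crossing:
  "indicator (outer_layer \<delta> \<Omega>) x *\<^sub>R (neumann_plus g \<delta> \<Omega> u x * v x) = (\<integral>z. \<Gamma> z * crossing 1 (x - z) z \<partial>lborel)"
proof (cases "x \<in> outer_layer \<delta> \<Omega>")
  case True
  then have x: "x \<notin> closure \<Omega>" by (simp add: outer_layer_def)
  note ux = layer_values(2)[OF True]
  have "neumann_plus g \<delta> \<Omega> u x = (\<integral>y. indicator \<Omega> y * ((U x - U y) * \<Gamma> (y - x)) \<partial>lborel)"
    unfolding neumann_plus_def
  proof (intro kern_integral_representation AE_I2 impI conjI)
    fix y assume "norm (y - x) < \<delta>"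
    then show "y \<in> inner_layer \<delta> \<Omega> \<longleftrightarrow> y \<in> \<Omega>"
      using layers_opposite[of x y] x by (auto simp: inner_layer_def norm_minus_commute[of y])
  qed (use ux layer_values(1) sets_polygon in auto)
  then show ?thesis using True ux inside_integral[OF True] by simp
next
  case False
  then show ?thesis using crossing_shift_zero by simp
qed

lemma shifted_crossing_integral:
  shows "(\<integral>x. (\<integral>z. \<Gamma> z * crossing 1 (x - z) z \<partial>lborel) \<partial>lborel)
      = (\<integral>z. \<Gamma> z * (\<integral>x. crossing 1 x z \<partial>lborel) \<partial>lborel)"
    and "integrable lborel (\<lambda>x. \<integral>z. \<Gamma> z * crossing 1 (x - z) z \<partial>lborel)"
proof -
  have m: "(\<lambda>(x, z). \<Gamma> z * crossing 1 (x - z) z) \<in> borel_measurable (lborel \<Otimes>\<^sub>M lborel)" by measurable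
  have bo: "bounded (outer_layer \<delta> \<Omega>)"
    by (rule bounded_outer_layer[OF polygon_bounded[OF polygon]])
  note dom = m outer_layer_borel bo moment_kernel_integrable[OF mk] crossing_shift_dominated
  have tr: "(\<integral>x. crossing 1 (x - z) z \<partial>lborel) = (\<integral>x. crossing 1 x z \<partial>lborel)" for z
  proof -
    have "(\<lambda>x. crossing 1 x z) \<in> borel_measurable borel" by measurable
    from integral_lborel_translate[OF this, of "- z"] show ?thesis by simp
  qed
  have "(\<integral>x. (\<integral>z. \<Gamma> z * crossing 1 (x - z) z \<partial>lborel) \<partial>lborel)
      = (\<integral>z. (\<integral>x. \<Gamma> z * crossing 1 (x - z) z \<partial>lborel) \<partial>lborel)"
    by (rule integral_swap_dominated[OF dom])
  then show "(\<integral>x. (\<integral>z. \<Gamma> z * crossing 1 (x - z) z \<partial>lborel) \<partial>lborel)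
      = (\<integral>z. \<Gamma> z * (\<integral>x. crossing 1 x z \<partial>lborel) \<partial>lborel)" by (simp add: tr)
  show "integrable lborel (\<lambda>x. \<integral>z. \<Gamma> z * crossing 1 (x - z) z \<partial>lborel)"
    by (rule integrable_fst_dominated[OF dom])
qed

lemma neumann_plus_integral:
  "(LINT x:outer_layer \<delta> \<Omega>|lebesgue. neumann_plus g \<delta> \<Omega> u x * v x)
     = (\<integral>z. \<Gamma> z * (\<integral>x. crossing 1 x z \<partial>lborel) \<partial>lborel)"
proof -
  have "(LINT x:outer_layer \<delta> \<Omega>|lebesgue. neumann_plus g \<delta> \<Omega> u x * v x)
      = (\<integral>x. (\<integral>z. \<Gamma> z * crossing 1 (x - z) z \<partial>lborel) \<partial>lborel)"
    unfolding set_lebesgue_integral_def neumann_plus_crossing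
  proof (rule integral_lebesgue_eq_lborel)
    have "(\<lambda>x. (\<integral>z. \<Gamma> z * crossing 1 (x - z) z \<partial>lborel)) \<in> borel_measurable lborel" by measurable
    then show "(\<lambda>x. (\<integral>z. \<Gamma> z * crossing 1 (x - z) z \<partial>lborel)) \<in> borel_measurable borel" by simp
  qed simp
  then show ?thesis using shifted_crossing_integral(1) by simp
qed

lemma outside_part_measurable [measurable (raw)]:
  assumes [measurable]: "f \<in> N \<rightarrow>\<^sub>M borel" "h \<in> N \<rightarrow>\<^sub>M borel"
  shows "(\<lambda>w. outside_part (f w) (h w)) \<in> borel_measurable N"
proof -
  note outer_layer_borel[measurable]
  show ?thesis unfolding outside_part_def by measurable
qed

lemma outer_pair_estimates:
  assumes x: "x \<in> outer_layer \<delta> \<Omega>" and z: "norm z < \<delta>"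
  shows "\<bar>U x - U (x + z)\<bar> \<le> M * norm z" "\<bar>V x - V (x + z)\<bar> \<le> M * norm z" "\<bar>V x\<bar> \<le> M"
proof -
  obtain p where p: "p \<in> frontier \<Omega>" "x \<in> ball p \<delta>" using x by (rule outer_layer_near_frontier)
  have xb: "x \<in> ball p (\<rho>/2)" using p(2) \<delta> by simp
  have "dist p (x + z) \<le> dist p x + norm z"
    using dist_triangle[of p "x + z" x] by (simp add: dist_norm)
  then have xz: "x + z \<in> ball p (\<rho>/2)" using p(2) z \<delta> by simp
  show "\<bar>U x - U (x + z)\<bar> \<le> M * norm z" "\<bar>V x - V (x + z)\<bar> \<le> M * norm z" "\<bar>V x\<bar> \<le> M"
    using U_lip[OF p(1) xb xz] V_lip[OF p(1) xb xz] V_bound[OF p(1) xb] by simp_all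
qed

lemma outside_part_bound:
  assumes "norm z < \<delta>"
  shows "\<bar>outside_part x z\<bar> \<le> M * norm z * M * indicator (outer_layer \<delta> \<Omega>) x"
proof (cases "x \<in> outer_layer \<delta> \<Omega> \<and> x + z \<in> outer_layer \<delta> \<Omega>")
  case True
  then have x: "x \<in> outer_layer \<delta> \<Omega>" by simp
  have "\<bar>outside_part x z\<bar> = \<bar>U x - U (x + z)\<bar> * \<bar>V x\<bar>" using True by (simp add: outside_part_def abs_mult)
  also have "\<dots> \<le> (M * norm z) * M"
    using outer_pair_estimates[OF x assms] M by (intro mult_mono) auto
  finally show ?thesis using x by simp
next
  case False
  then have "outside_part x z = 0" by (auto simp: outside_part_def)
  then show ?thesis using M by simp
qed

lemma outside_part_dominated:
  "\<bar>\<Gamma> z * outside_part x z\<bar> \<le> (M * \<delta> * M) * indicator (outer_layer \<delta> \<Omega>) x * \<Gamma> z"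
  by (rule kernel_dominated, rule outside_part_bound)

text \<open>
  The enlarged domain consists of \<open>\<Omega>\<close>, the outer layer and a part of the frontier, which is a null set
  because \<open>\<Omega>\<close> is convex.
\<close>

lemma neumann_star_crossing:
  "indicator (outer_layer \<delta> \<Omega>) x *\<^sub>R (neumann_star g \<delta> \<Omega> u x * v x)
    = (\<integral>z. \<Gamma> z * crossing 1 (x - z) z \<partial>lborel) + (\<integral>z. \<Gamma> z * outside_part x z \<partial>lborel)"
proof (cases "x \<in> outer_layer \<delta> \<Omega>")
  case True
  note ux = layer_values(2)[OF True]
  note outer_layer_borel[measurable]
  let ?O = "outer_layer \<delta> \<Omega>"
  let ?i = "\<lambda>y. indicator \<Omega> y * ((U x - U y) * \<Gamma> (y - x))"
  let ?o = "\<lambda>y. indicator ?O y * ((U x - U y) * \<Gamma> (y - x))"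
  have ib: "?i \<in> borel_measurable borel" and ob: "?o \<in> borel_measurable borel" by measurable
  have fr: "AE y in lborel. y \<notin> frontier \<Omega>"
  proof -
    have "negligible (frontier \<Omega>)" by (rule negligible_convex_frontier[OF polygon_convex[OF polygon]])
    then have "AE y in lebesgue. y \<notin> frontier \<Omega>" unfolding negligible_iff_null_sets by (rule AE_not_in)
    then show ?thesis unfolding AE_completion_iff .
  qed
  have dint: "integrable lborel (\<lambda>y. (M * \<delta>) * \<Gamma> (y - x))"
  proof -
    have "integrable (distr lborel borel ((+) (- x))) \<Gamma>" unfolding lborel_distr_plus by (rule moment_kernel_integrable[OF mk])
    then have "integrable lborel (\<lambda>y. \<Gamma> (- x + y))" by (subst (asm) integrable_distr_eq) auto
    then show ?thesis by simp
  qed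
  have db: "\<bar>(U x - U y) * \<Gamma> (y - x)\<bar> \<le> (M * \<delta>) * \<Gamma> (y - x)" for y
  proof (cases "\<Gamma> (y - x) = 0")
    case False
    then have n: "norm (y - x) < \<delta>" by (rule \<Gamma>_support)
    have "\<bar>U x - U y\<bar> \<le> M * norm (y - x)" using outer_pair_estimates(1)[OF True n] by simp
    also have "\<dots> \<le> M * \<delta>" using n M by (intro mult_left_mono) auto
    finally show ?thesis unfolding abs_mult using \<Gamma>_nonneg[of "y - x"] by (simp add: mult_right_mono)
  qed simp
  have int_ind: "integrable lborel (\<lambda>y. indicator S y * ((U x - U y) * \<Gamma> (y - x)))" if [measurable]: "S \<in> sets borel" for S
  proof (rule Bochner_Integration.integrable_bound[OF dint])
    show "AE y in lborel. norm (indicator S y * ((U x - U y) * \<Gamma> (y - x))) \<le> norm ((M * \<delta>) * \<Gamma> (y - x))"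
    proof (rule AE_I2)
      fix y
      have "\<bar>indicator S y * ((U x - U y) * \<Gamma> (y - x))\<bar> \<le> \<bar>(U x - U y) * \<Gamma> (y - x)\<bar>"
        by (simp add: indicator_def)
      also have "\<dots> \<le> \<bar>(M * \<delta>) * \<Gamma> (y - x)\<bar>" by (rule order_trans[OF db abs_ge_self])
      finally show "norm (indicator S y * ((U x - U y) * \<Gamma> (y - x))) \<le> norm ((M * \<delta>) * \<Gamma> (y - x))" by simp
    qed
  qed measurable
  have disj: "\<Omega> \<inter> ?O = {}" unfolding outer_layer_def using closure_subset by blast
  have "neumann_star g \<delta> \<Omega> u x = (\<integral>y. indicator (\<Omega> \<union> ?O) y * ((U x - U y) * \<Gamma> (y - x)) \<partial>lborel)"
    unfolding neumann_star_def
  proof (rule kern_integral_representation)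
    show "AE y in lborel. norm (y - x) < \<delta> \<longrightarrow>
        (y \<in> enlarged \<delta> \<Omega> \<longleftrightarrow> y \<in> \<Omega> \<union> ?O) \<and> (y \<in> enlarged \<delta> \<Omega> \<longrightarrow> U y = u y)"
      using fr
    proof (eventually_elim, intro impI)
      fix y assume fy: "y \<notin> frontier \<Omega>" and n: "norm (y - x) < \<delta>"
      have cl: "y \<in> closure \<Omega> \<longleftrightarrow> y \<in> \<Omega>" using fy polygon_frontier[OF polygon] closure_subset by blast
      have "\<Omega> \<subseteq> enlarged \<delta> \<Omega>" using \<delta>(1) centre_in_ball unfolding enlarged_eq by blast
      then have "y \<in> enlarged \<delta> \<Omega> \<longleftrightarrow> y \<in> \<Omega> \<union> ?O" unfolding outer_layer_def using cl by blast
      moreover have "y \<in> inner_layer \<delta> \<Omega>" if "y \<in> \<Omega>"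
        using layers_opposite[of x y] n that True by (simp add: outer_layer_def norm_minus_commute[of y])
      ultimately show "(y \<in> enlarged \<delta> \<Omega> \<longleftrightarrow> y \<in> \<Omega> \<union> ?O) \<and> (y \<in> enlarged \<delta> \<Omega> \<longrightarrow> U y = u y)"
        using layer_values by blast
    qed
  qed (use ux outer_layer_borel in auto)
  also have "\<dots> = (\<integral>y. ?i y + ?o y \<partial>lborel)"
    using disj by (intro Bochner_Integration.integral_cong refl) (auto simp: indicator_def)
  also have "\<dots> = (\<integral>y. ?i y \<partial>lborel) + (\<integral>y. ?o y \<partial>lborel)"
    by (rule Bochner_Integration.integral_add[OF int_ind int_ind]) (rule sets_polygon outer_layer_borel)+
  finally have "neumann_star g \<delta> \<Omega> u x * v x = (\<integral>y. ?i y \<partial>lborel) * V x + (\<integral>y. ?o y \<partial>lborel) * V x"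
    using ux by (simp add: distrib_right)
  also have "(\<integral>y. ?i y \<partial>lborel) * V x = (\<integral>z. \<Gamma> z * crossing 1 (x - z) z \<partial>lborel)" by (rule inside_integral[OF True])
  also have "(\<integral>y. ?o y \<partial>lborel) * V x = (\<integral>z. ?o (x + z) * V x \<partial>lborel)"
    using integral_lborel_translate[OF ob, of x] by simp
  also have "\<dots> = (\<integral>z. \<Gamma> z * outside_part x z \<partial>lborel)"
    using True by (intro Bochner_Integration.integral_cong refl) (simp add: outside_part_def mult_ac)
  finally show ?thesis using True by simp
next
  case False
  then show ?thesis using crossing_shift_zero by (simp add: outside_part_def)
qed

text \<open>
  After the translation by \<open>z\<close> the integrals for \<open>z\<close> and \<open>- z\<close> range over the same pairs, with opposite
  differences of \<open>u\<close> but with \<open>v\<close> at different points. Their sum has the integrand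
  \<open>(u(x) - u(x+z)) (v(x) - v(x+z))\<close>, which gains a factor \<open>norm z\<close>.
\<close>

lemma outside_part_antisymmetric:
  assumes z: "norm z < \<delta>"
  shows "\<bar>(\<integral>x. outside_part x z \<partial>lborel) + (\<integral>x. outside_part x (- z) \<partial>lborel)\<bar>
     \<le> M * M * measure lborel (outer_layer \<delta> \<Omega>) * (norm z)\<^sup>2"
proof -
  let ?O = "outer_layer \<delta> \<Omega>"
  note outer_layer_borel[measurable]
  have bo: "bounded ?O"
    by (rule bounded_outer_layer[OF polygon_bounded[OF polygon]])
  have fO: "emeasure lborel ?O < \<infinity>" using bo by (rule emeasure_bounded_finite)
  have iO: "integrable lborel (\<lambda>x. c * indicator ?O x :: real)" for c
    using fO by (intro integrable_mult_right) (simp add: integrable_indicator_iff)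
  have int: "integrable lborel (\<lambda>x. outside_part x w)" if "norm w < \<delta>" for w
  proof (rule Bochner_Integration.integrable_bound[OF iO])
    show "AE x in lborel. norm (outside_part x w) \<le> norm ((M * norm w * M) * indicator ?O x)"
      using order_trans[OF outside_part_bound[OF that] abs_ge_self] by (intro AE_I2) (simp only: real_norm_def)
  qed measurable
  have m: "(\<lambda>x. outside_part x (- z)) \<in> borel_measurable borel" by measurable
  have "(\<integral>x. outside_part x (- z) \<partial>lborel) = (\<integral>x. outside_part (z + x) (- z) \<partial>lborel)"
    by (rule integral_lborel_translate[OF m, symmetric])
  moreover have "integrable lborel (\<lambda>x. outside_part (z + x) (- z))"
  proof -
    have "integrable (distr lborel borel ((+) z)) (\<lambda>x. outside_part x (- z))" unfolding lborel_distr_plus using z by (intro int) simp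
    then show ?thesis by (subst (asm) integrable_distr_eq) auto
  qed
  ultimately have "(\<integral>x. outside_part x z \<partial>lborel) + (\<integral>x. outside_part x (- z) \<partial>lborel)
      = (\<integral>x. outside_part x z + outside_part (z + x) (- z) \<partial>lborel)"
    and isum: "integrable lborel (\<lambda>x. outside_part x z + outside_part (z + x) (- z))"
    using int[OF z] by simp_all
  then have "\<bar>(\<integral>x. outside_part x z \<partial>lborel) + (\<integral>x. outside_part x (- z) \<partial>lborel)\<bar>
      \<le> (\<integral>x. (M * M * (norm z)\<^sup>2) * indicator ?O x \<partial>lborel)"
  proof (simp only:, intro integral_abs_bound_integral[OF isum iO])
    fix x
    have eq: "outside_part x z + outside_part (z + x) (- z)
        = indicator ?O x * indicator ?O (x + z) * ((U x - U (x + z)) * (V x - V (x + z)))"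
      unfolding outside_part_def by (simp add: algebra_simps)
    show "\<bar>outside_part x z + outside_part (z + x) (- z)\<bar> \<le> (M * M * (norm z)\<^sup>2) * indicator ?O x"
    proof (cases "x \<in> ?O")
      case True
      have "\<bar>U x - U (x + z)\<bar> * \<bar>V x - V (x + z)\<bar> \<le> (M * norm z) * (M * norm z)"
        using outer_pair_estimates[OF True z] M by (intro mult_mono) auto
      moreover have "\<bar>indicator ?O (x + z) :: real\<bar> * (\<bar>U x - U (x + z)\<bar> * \<bar>V x - V (x + z)\<bar>) \<le> \<bar>U x - U (x + z)\<bar> * \<bar>V x - V (x + z)\<bar>"
        by (simp add: indicator_def)
      ultimately show ?thesis unfolding eq using True by (simp add: abs_mult power2_eq_square mult_ac)
    qed (simp add: eq)
  qed
  also have "\<dots> = M * M * measure lborel ?O * (norm z)\<^sup>2" by simp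
  finally show ?thesis .
qed

text \<open>
  The kernel is even, so twice the contribution of the outer pairs is the integral of the symmetrized
  integrand of \<open>outside_part_antisymmetric\<close>.
\<close>

lemma neumann_star_integral:
  "\<bar>(LINT x:outer_layer \<delta> \<Omega>|lebesgue. neumann_star g \<delta> \<Omega> u x * v x)
     - (\<integral>z. \<Gamma> z * (\<integral>x. crossing 1 x z \<partial>lborel) \<partial>lborel)\<bar> \<le> 2 * M * M * measure lborel (outer_layer \<delta> \<Omega>) * \<sigma>"
proof -
  let ?O = "outer_layer \<delta> \<Omega>"
  let ?G = "\<lambda>z. \<integral>x. outside_part x z \<partial>lborel"
  have bo: "bounded ?O"
    by (rule bounded_outer_layer[OF polygon_bounded[OF polygon]])
  have m: "(\<lambda>(x, z). \<Gamma> z * outside_part x z) \<in> borel_measurable (lborel \<Otimes>\<^sub>M lborel)" by measurable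
  note dom = m outer_layer_borel bo moment_kernel_integrable[OF mk] outside_part_dominated
  have "(LINT x:?O|lebesgue. neumann_star g \<delta> \<Omega> u x * v x)
      = (\<integral>x. (\<integral>z. \<Gamma> z * crossing 1 (x - z) z \<partial>lborel) + (\<integral>z. \<Gamma> z * outside_part x z \<partial>lborel) \<partial>lborel)"
    unfolding set_lebesgue_integral_def neumann_star_crossing
  proof (rule integral_lebesgue_eq_lborel)
    have "(\<lambda>x. (\<integral>z. \<Gamma> z * crossing 1 (x - z) z \<partial>lborel) + (\<integral>z. \<Gamma> z * outside_part x z \<partial>lborel)) \<in> borel_measurable lborel" by measurable
    then show "(\<lambda>x. (\<integral>z. \<Gamma> z * crossing 1 (x - z) z \<partial>lborel) + (\<integral>z. \<Gamma> z * outside_part x z \<partial>lborel)) \<in> borel_measurable borel" by simp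
  qed simp
  also have "\<dots> = (\<integral>x. (\<integral>z. \<Gamma> z * crossing 1 (x - z) z \<partial>lborel) \<partial>lborel) + (\<integral>x. (\<integral>z. \<Gamma> z * outside_part x z \<partial>lborel) \<partial>lborel)"
    by (rule Bochner_Integration.integral_add[OF shifted_crossing_integral(2) integrable_fst_dominated[OF dom]])
  also have "(\<integral>x. (\<integral>z. \<Gamma> z * outside_part x z \<partial>lborel) \<partial>lborel) = (\<integral>z. (\<integral>x. \<Gamma> z * outside_part x z \<partial>lborel) \<partial>lborel)"
    by (rule integral_swap_dominated[OF dom])
  finally have star: "(LINT x:?O|lebesgue. neumann_star g \<delta> \<Omega> u x * v x)
     - (\<integral>z. \<Gamma> z * (\<integral>x. crossing 1 x z \<partial>lborel) \<partial>lborel) = (\<integral>z. \<Gamma> z * ?G z \<partial>lborel)"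
    unfolding shifted_crossing_integral(1) by simp
  have iG: "integrable lborel (\<lambda>z. \<Gamma> z * ?G z)" using integrable_snd_dominated[OF dom] by simp
  have mG: "(\<lambda>z. \<Gamma> z * ?G z) \<in> borel_measurable borel" using borel_measurable_integrable[OF iG] by simp
  have refl: "(\<integral>z. \<Gamma> z * ?G (- z) \<partial>lborel) = (\<integral>z. \<Gamma> z * ?G z \<partial>lborel)"
    using integral_lborel_reflect[OF mG, of 0] by (simp add: \<Gamma>_even)
  have iG': "integrable lborel (\<lambda>z. \<Gamma> z * ?G (- z))"
  proof -
    have L: "distr lborel borel (\<lambda>x::real^2. 0 + (-1) *\<^sub>R x) = lborel"
      using lborel_affine[of "-1" "0::real^2"] by (simp add: density_1)
    have "integrable (distr lborel borel (\<lambda>x::real^2. 0 + (-1) *\<^sub>R x)) (\<lambda>z. \<Gamma> z * ?G z)" unfolding L by (rule iG)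
    then have "integrable lborel (\<lambda>z. \<Gamma> (0 + (-1) *\<^sub>R z) * ?G (0 + (-1) *\<^sub>R z))"
      by (subst (asm) integrable_distr_eq) (use mG in auto)
    then show ?thesis by (simp add: \<Gamma>_even)
  qed
  have "2 * (\<integral>z. \<Gamma> z * ?G z \<partial>lborel) = (\<integral>z. \<Gamma> z * ?G z + \<Gamma> z * ?G (- z) \<partial>lborel)"
    unfolding Bochner_Integration.integral_add[OF iG iG'] refl by simp
  also have "\<bar>\<dots>\<bar> \<le> (\<integral>z. (M * M * measure lborel ?O) * (\<Gamma> z * (norm z)\<^sup>2) \<partial>lborel)"
  proof (rule integral_abs_bound_integral)
    show "integrable lborel (\<lambda>z. \<Gamma> z * ?G z + \<Gamma> z * ?G (- z))" by (rule Bochner_Integration.integrable_add[OF iG iG'])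
    show "integrable lborel (\<lambda>z. (M * M * measure lborel ?O) * (\<Gamma> z * (norm z)\<^sup>2))"
      using moment_kernel_integrable2[OF mk] by simp
    fix z :: "real^2"
    show "\<bar>\<Gamma> z * ?G z + \<Gamma> z * ?G (- z)\<bar> \<le> (M * M * measure lborel ?O) * (\<Gamma> z * (norm z)\<^sup>2)"
    proof (cases "\<Gamma> z = 0")
      case False
      then have z: "norm z < \<delta>" by (rule \<Gamma>_support)
      have "\<bar>\<Gamma> z * ?G z + \<Gamma> z * ?G (- z)\<bar> = \<Gamma> z * \<bar>?G z + ?G (- z)\<bar>"
        using \<Gamma>_nonneg[of z] by (simp add: abs_mult flip: distrib_left)
      also have "\<dots> \<le> \<Gamma> z * (M * M * measure lborel ?O * (norm z)\<^sup>2)"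
        by (rule mult_left_mono[OF outside_part_antisymmetric[OF z] \<Gamma>_nonneg])
      finally show ?thesis by (simp add: mult_ac)
    qed simp
  qed
  also have "\<dots> = (M * M * measure lborel ?O) * (4 * \<sigma>)" using moment_kernel_second[OF mk] by simp
  finally show ?thesis unfolding star by (simp add: abs_mult mult_ac)
qed

end

end

theorem theorem2p4:
  fixes \<Omega> :: "(real^2) set"
    and g :: "real \<Rightarrow> real \<Rightarrow> real"
    and \<sigma> \<delta>\<^sub>0 :: real
    and u v :: "real^2 \<Rightarrow> real"
    and N :: "real \<Rightarrow> (real^2) set \<Rightarrow> (real^2 \<Rightarrow> real) \<Rightarrow> real^2 \<Rightarrow> real"
    and G :: "real \<Rightarrow> (real^2) set \<Rightarrow> (real^2) set"
  assumes kernel: "kernel_family g \<sigma>"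
    and polygon: "convex_polygon \<Omega>"
    and lowest_vertex: "0 \<in> polygon_vertices \<Omega>" "\<forall>p\<in>polygon_vertices \<Omega>. 0 \<le> p $ 2"
    and edge_on_axis: "\<exists>E\<in>polygon_edges \<Omega>. E \<subseteq> {x. x $ 2 = 0}"
    and layer: "0 < \<delta>\<^sub>0"
    and u_C2: "C2_on u {x. infdist x (frontier \<Omega>) < \<delta>\<^sub>0}"
    and v_C1: "C1_on v {x. infdist x (frontier \<Omega>) < \<delta>\<^sub>0}"
    and operator: "(N, G) \<in> {(neumann_minus g, inner_layer),
                             (neumann_plus g, outer_layer),
                             (neumann_star g, outer_layer)}"
    and u_S_N: "\<forall>\<delta>. 0 < \<delta> \<and> \<delta> < \<delta>\<^sub>0 \<longrightarrow> u \<in> S_N (N \<delta> \<Omega>) (G \<delta> \<Omega>)"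
  shows "(\<lambda>\<delta>. (LINT x:G \<delta> \<Omega>|lebesgue. N \<delta> \<Omega> u x * v x)
              - boundary_integral \<Omega> (\<lambda>x. \<sigma> * normal_derivative \<Omega> u x * v x))
         \<in> O[at_right 0](\<lambda>\<delta>. \<delta>)"
proof -
  obtain u' M where "polygon_collar \<Omega> u v u' \<delta>\<^sub>0 M"
    using polygon_collar_exists[OF polygon layer u_C2 v_C1] by blast
  then interpret polygon_collar \<Omega> u v u' \<delta>\<^sub>0 M .
  let ?b = "boundary_integral \<Omega> (\<lambda>x. \<sigma> * normal_derivative \<Omega> u x * v x)"
  let ?I = "\<lambda>\<delta>. (LINT x:G \<delta> \<Omega>|lebesgue. N \<delta> \<Omega> u x * v x)"
  obtain C where C: "0 \<le> C"
    "\<And>\<sigma> \<Gamma> \<theta> \<delta>. moment_kernel \<delta> \<sigma> \<Gamma> \<Longrightarrow> 0 \<le> \<theta> \<Longrightarrow> \<theta> \<le> 1 \<Longrightarrow> 0 < \<delta> \<Longrightarrow> \<delta> < \<delta>\<^sub>0/2 \<Longrightarrow>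
      \<bar>(\<integral>z. \<Gamma> z * (\<integral>x. crossing \<theta> x z \<partial>lborel) \<partial>lborel)
        - boundary_integral \<Omega> (\<lambda>x. \<sigma> * normal_derivative \<Omega> u x * v x)\<bar> \<le> C * \<sigma> * \<delta>"
    using crossing_flux_estimate by blast
  obtain A where A: "0 \<le> A" "\<And>\<delta>. 0 < \<delta> \<Longrightarrow> \<delta> \<le> 1 \<Longrightarrow> measure lborel (outer_layer \<delta> \<Omega>) \<le> A * \<delta>"
    using measure_outer_layer[OF polygon] by blast
  have est: "\<bar>?I \<delta> - ?b\<bar> \<le> (C * \<sigma> + 2 * M * M * A * \<sigma>) * \<delta>" if d: "0 < \<delta>" "\<delta> < min 1 (\<delta>\<^sub>0/4)" for \<delta>
  proof -
    \<comment> \<open>Two steps of length \<open>\<delta>\<close> from the frontier stay in the balls of radius \<open>\<delta>\<^sub>0 / 2\<close> of the local bounds.\<close>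
    have d1: "\<delta> < \<delta>\<^sub>0/4" "\<delta> < \<delta>\<^sub>0/2" "\<delta> \<le> 1" using d layer by auto
    obtain \<Gamma> where mk: "moment_kernel \<delta> \<sigma> \<Gamma>" and g: "AE z in lborel. g \<delta> (norm z) = \<Gamma> z"
      by (rule kernel_family_moment_kernel[OF kernel d(1)])
    note flux = C(2)[OF mk _ _ d(1) d1(2)]
    have s0: "0 \<le> \<sigma>"
    proof -
      have "0 \<le> (\<integral>z. \<Gamma> z * (norm z)\<^sup>2 \<partial>lborel)"
        using moment_kernel_nonneg[OF mk] by (intro integral_nonneg_AE AE_I2) simp
      then show ?thesis using moment_kernel_second[OF mk] by simp
    qed
    have extra: "0 \<le> 2 * M * M * A * \<sigma> * \<delta>" using A(1) s0 M d(1) by simp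
    consider "N = neumann_minus g" "G = inner_layer" | "N = neumann_plus g" "G = outer_layer"
      | "N = neumann_star g" "G = outer_layer" using operator by auto
    then show ?thesis
    proof cases
      case 1
      have "\<bar>?I \<delta> - ?b\<bar> \<le> C * \<sigma> * \<delta>"
        unfolding 1 neumann_minus_integral[where g=g, OF d(1) d1(1) mk g] by (rule flux) simp_all
      then show ?thesis using extra unfolding distrib_right by linarith
    next
      case 2
      have "\<bar>?I \<delta> - ?b\<bar> \<le> C * \<sigma> * \<delta>"
        unfolding 2 neumann_plus_integral[where g=g, OF d(1) d1(1) mk g] by (rule flux) simp_all
      then show ?thesis using extra unfolding distrib_right by linarith
    next
      case 3
      have "\<bar>?I \<delta> - (\<integral>z. \<Gamma> z * (\<integral>x. crossing 1 x z \<partial>lborel) \<partial>lborel)\<bar>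
          \<le> 2 * M * M * measure lborel (outer_layer \<delta> \<Omega>) * \<sigma>"
        unfolding 3 by (rule neumann_star_integral[where g=g, OF d(1) d1(1) mk g])
      also have "\<dots> \<le> 2 * M * M * (A * \<delta>) * \<sigma>"
        using A(2)[OF d(1) d1(3)] s0 M by (intro mult_right_mono mult_left_mono) auto
      finally have "\<bar>?I \<delta> - (\<integral>z. \<Gamma> z * (\<integral>x. crossing 1 x z \<partial>lborel) \<partial>lborel)\<bar> \<le> 2 * M * M * A * \<sigma> * \<delta>"
        by (simp add: mult_ac)
      moreover have "\<bar>(\<integral>z. \<Gamma> z * (\<integral>x. crossing 1 x z \<partial>lborel) \<partial>lborel) - ?b\<bar> \<le> C * \<sigma> * \<delta>"
        by (rule flux) simp_all
      ultimately show ?thesis unfolding distrib_right by linarith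
    qed
  qed
  have "eventually (\<lambda>\<delta>. \<delta> \<in> {0<..<min 1 (\<delta>\<^sub>0/4)}) (at_right 0)"
    using layer by (intro eventually_at_right_real) simp
  then have "eventually (\<lambda>\<delta>. norm (?I \<delta> - ?b) \<le> (C * \<sigma> + 2 * M * M * A * \<sigma>) * norm \<delta>) (at_right 0)"
  proof eventually_elim
    case (elim \<delta>)
    then show ?case using est[of \<delta>] by simp
  qed
  then show ?thesis by (rule bigoI)
qed

end
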